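(* Fix a constant $c\ge 0$. Let $\mathsf{Fix}(|\lambda\setminus S|)\subseteq\mathcal{SVT}$ be the subset of triples $(\lambda,N,S)$ with $|\lambda\setminus S|\le c$, and let $\mathsf{Fix}(k-|\lambda\setminus S|)\subseteq\mathcal{SVT}$ be the subset of triples $(\lambda,N,S)$ with $k-|\lambda\setminus S|\le c$, where $S$ is an $N\langle k\rangle$-standard set-valued pre-tableau. Then the Markov chain $\mathcal{MC}_{\mathsf{SVT}}(\lambda,N,S)$ is rapidly mixing, and hence gives a fully polynomial almost uniform sampler (FPAUS), for $\mathsf{Fix}(|\lambda\setminus S|)$ and for $\mathsf{Fix}(k-|\lambda\setminus S|)$.
   Context: Partitions and tableaux. A partition is a finite weakly decreasing sequence of positive integers, identified with its Young diagram $\{(r,c):1\le c\le\lambda_r\}$ (rows from the top, columns from the left); $|\lambda|$ is the number of boxes. For $N\ge|\lambda|$, an $N$-standard set-valued tableau of shape $\lambda$ assigns to each box $(r,c)$ a nonempty set $T(r,c)\subseteq\{1,\ldots,N\}$ such that each value in $\{1,\ldots,N\}$ appears exactly once and, whenever one value is selected from each box, the filling increases down columns and weakly increases along rows. $\mathsf{SVT}(\lambda,N)$ is the set of these. Pre-tableaux. For $0\le k\le N$, an $N\langle k\rangle$-standard set-valued pre-tableau of shape $\lambda$ assigns a (possibly empty) subset of $\{k+1,\ldots,N\}$ to each box of $\lambda$ such that: (i) each value in $\{k+1,\ldots,N\}$ appears exactly once; (ii) if $T(r,c)\ne\emptyset$, then $(r+1,c)\in\lambda$ implies $T(r+1,c)\neq\emptyset$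 and $(r,c+1)\in\lambda$ implies $T(r,c+1)\ne\emptyset$; (iii) if $T(r,c)\neq\emptyset$, then $(r+1,c)\in\lambda$ implies $\max T(r,c)<\min T(r+1,c)$ and $(r,c+1)\in\lambda$ implies $\max T(r,c)<\min T(r,c+1)$; (iv) at most $k$ boxes have $T(r,c)=\emptyset$. For such an $S$, $\mathsf{SVT}(\lambda,N,S)$ is the set of $T\in\mathsf{SVT}(\lambda,N)$ with $S(r,c)\subseteq T(r,c)$ for all boxes, and $\lambda\setminus S=\{(r,c)\in\lambda:S(r,c)=\emptyset\}$. $\mathcal{SVT}$ is the set of all triples $(\lambda,N,S)$ with $\lambda$ a partition, $N\ge|\lambda|$, and $S$ an $N\langle k\rangle$-standard set-valued pre-tableau of shape $\lambda$ for some $0\le k\le N$ ($k$ always denotes the integer associated with $S$). Generation algorithm. For $(r,c)\in\lambda$, $h_\lambda(r,c)=\{(p,q)\in\lambda: p=r,\ q>c,\text{ or } q=c,\ p>r\}$. $\mathrm{Hook}(\lambda)$: choose $(r,c)\in\lambda$ uniformly at random; while $h_\lambda(r,c)\ne\emptyset$, replace $(r,c)$ by a uniformly random element of $h_\lambda(r,c)$; return $(r,c)$. For $A\subset\mathbb{N}^2$, $NW(A)=\{(r,c)\in A:\{(r,c)\}=A\cap([r]\times[c])\}$, where $[n]=\{1,\dots,n\}$. $\mathsf{SVGen}(\lambda,N,k,T)$, with $T$ an $N\langle k\rangle$-standard set-valued pre-tableau of shape $\lambda$: if $k=N$, let $(r,c)=\mathrm{Hook}(\lambda)$, set $T(r,c)=\{N\}$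 and replace $k$ by $N-1$. Then for $M=k,k-1,\ldots,1$: let $\lambda'=\{(r,c)\in\lambda:T(r,c)=\emptyset\}$; with probability $(M-|\lambda'|)/M$ choose $(r,c)$ uniformly at random from $NW(\{(p,q)\in\lambda:T(p,q)\ne\emptyset\})$ and add $M$ to $T(r,c)$; otherwise let $(r,c)=\mathrm{Hook}(\lambda')$ and set $T(r,c)=\{M\}$. Return $T$. All random choices are independent. For $T\in\mathsf{SVT}(\lambda,N,S)$, $\mathbb{P}_{\mathsf{SVG}}(T,k)$ is the probability that $\mathsf{SVGen}(\lambda,N,k,S)$ returns $T$. The chain. $\mathcal{MC}_{\mathsf{SVT}}(\lambda,N,S)$ is the Markov chain on state space $\mathsf{SVT}(\lambda,N,S)$ with transition matrix $P(T,F)=\mathbb{P}_{\mathsf{SVG}}(F,k)\min\{1,\mathbb{P}_{\mathsf{SVG}}(T,k)/\mathbb{P}_{\mathsf{SVG}}(F,k)\}$ for $F\ne T$ and $P(T,T)=1-\sum_{R\neq T}P(T,R)$ (the Metropolis chain with uniform target distribution $U$). Mixing and sampling. $d_{\mathsf{TV}}(\mu,\nu)=\max_{A}|\mu(A)-\nu(A)|$. With $\pi$ the stationary distribution, $d(t)=\max_x d_{\mathsf{TV}}(P^t(x,\cdot),\pi)$ and $t_{\mathsf{mix}}(\epsilon)=\min\{t:d(t)\le\epsilon\}$. Rapidly mixing on a family of triples means that $t_{\mathsf{mix}}(\epsilon)$ is bounded by a polynomial in $\epsilon^{-1}$ and the problem size parameters $|\lambda\setminus S|$ and $k$, uniformly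 over the family (the polynomial may depend on $c$). A FPAUS for a subset $\mathcal{F}\subseteq\mathcal{SVT}$ is a randomized algorithm that, given $(\lambda,N,S)\in\mathcal{F}$ and a bias parameter $\delta$, outputs a random $T\in\mathsf{SVT}(\lambda,N,S)$ from a distribution $\Gamma$ with $d_{\mathsf{TV}}(\Gamma,U)\le\delta$, where $U$ is uniform on $\mathsf{SVT}(\lambda,N,S)$, in time polynomial in $k$, $|\lambda\setminus S|$ and $\log\delta^{-1}$. That the chain gives a FPAUS means that simulating it yields such an algorithm. *)

theory Defs
  imports "HOL-Probability.Probability"
begin

section \<open>Partitions and set-valued tableaux\<close>

type_synonym box = "nat \<times> nat"

text \<open>Fillings are total functions on boxes; all tableaux below are required to be empty off the
  diagram, so that two of them are equal iff they agree on the diagram.\<close>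

type_synonym filling = "box \<Rightarrow> nat set"

definition partition :: "nat list \<Rightarrow> bool" where
  "partition lam \<longleftrightarrow> sorted_wrt (\<ge>) lam \<and> (\<forall>x\<in>set lam. 0 < x)"

definition diagram :: "nat list \<Rightarrow> box set" where
  "diagram lam = {(r, c). 1 \<le> r \<and> r \<le> length lam \<and> 1 \<le> c \<and> c \<le> lam ! (r - 1)}"

definition SVT :: "nat list \<Rightarrow> nat \<Rightarrow> filling set" where
  "SVT lam N = {T.
     (\<forall>b. b \<notin> diagram lam \<longrightarrow> T b = {}) \<and>
     (\<forall>b\<in>diagram lam. T b \<noteq> {} \<and> T b \<subseteq> {1..N}) \<and>
     (\<forall>v\<in>{1..N}. \<exists>!b. b \<in> diagram lam \<and> v \<in> T b) \<and>
     (\<forall>f. (\<forall>b\<in>diagram lam. f b \<in> T b) \<longrightarrow>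
        (\<forall>r r' c. (r, c) \<in> diagram lam \<longrightarrow> (r', c) \<in> diagram lam \<longrightarrow> r < r' \<longrightarrow> f (r, c) < f (r', c)) \<and>
        (\<forall>r c c'. (r, c) \<in> diagram lam \<longrightarrow> (r, c') \<in> diagram lam \<longrightarrow> c < c' \<longrightarrow> f (r, c) \<le> f (r, c')))}"

text \<open>The set of boxes \<open>\<lambda> \<setminus> S\<close> that are empty in \<open>S\<close>.\<close>

definition empty_boxes :: "nat list \<Rightarrow> filling \<Rightarrow> box set" where
  "empty_boxes lam S = {b \<in> diagram lam. S b = {}}"

definition pretableau :: "nat list \<Rightarrow> nat \<Rightarrow> nat \<Rightarrow> filling \<Rightarrow> bool" where
  "pretableau lam N k S \<longleftrightarrow> k \<le> N \<and>
     (\<forall>b. b \<notin> diagram lam \<longrightarrow> S b = {}) \<and>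
     (\<forall>b\<in>diagram lam. S b \<subseteq> {k+1..N}) \<and>
     (\<forall>v\<in>{k+1..N}. \<exists>!b. b \<in> diagram lam \<and> v \<in> S b) \<and>
     (\<forall>r c. (r, c) \<in> diagram lam \<longrightarrow> S (r, c) \<noteq> {} \<longrightarrow>
        ((r + 1, c) \<in> diagram lam \<longrightarrow> S (r + 1, c) \<noteq> {}) \<and>
        ((r, c + 1) \<in> diagram lam \<longrightarrow> S (r, c + 1) \<noteq> {})) \<and>
     (\<forall>r c. (r, c) \<in> diagram lam \<longrightarrow> S (r, c) \<noteq> {} \<longrightarrow>
        ((r + 1, c) \<in> diagram lam \<longrightarrow> Max (S (r, c)) < Min (S (r + 1, c))) \<and>
        ((r, c + 1) \<in> diagram lam \<longrightarrow> Max (S (r, c)) < Min (S (r, c + 1)))) \<and>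
     card (empty_boxes lam S) \<le> k"

text \<open>The integer \<open>k\<close> is determined by \<open>S\<close>, so quantifying over all \<open>k\<close> with \<open>pretableau lam N k S\<close>
  (as is done below) just names the integer associated with \<open>S\<close>.\<close>

lemma pretableau_unique:
  assumes "pretableau lam N k S" "pretableau lam N k' S"
  shows "k = k'"
proof -
  have aux: "\<not> i < j" if p: "pretableau lam N i S" and q: "pretableau lam N j S" for i j
  proof
    assume "i < j"
    with q have "j \<in> {i+1..N}" by (auto simp: pretableau_def)
    then obtain b where "b \<in> diagram lam" "j \<in> S b"
      using p unfolding pretableau_def by blast
    moreover have "S b \<subseteq> {j+1..N}"
      using q \<open>b \<in> diagram lam\<close> unfolding pretableau_def by blast
    ultimately show False by auto
  qed
  show ?thesis
    using aux[OF assms] aux[OF assms(2,1)] by simp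
qed

definition SVT_ext :: "nat list \<Rightarrow> nat \<Rightarrow> filling \<Rightarrow> filling set" where
  "SVT_ext lam N S = {T \<in> SVT lam N. \<forall>b\<in>diagram lam. S b \<subseteq> T b}"

text \<open>The empty partition is left out: its only pre-tableaux have \<open>k = N\<close>, and then the generation
  algorithm would have to choose a box from the empty diagram.\<close>

type_synonym triple = "nat list \<times> nat \<times> filling"

definition SVT_triples :: "triple set" where
  "SVT_triples = {(lam, N, S). partition lam \<and> lam \<noteq> [] \<and> card (diagram lam) \<le> N \<and>
     (\<exists>k. pretableau lam N k S)}"

definition Fix_empty :: "real \<Rightarrow> triple set" where
  "Fix_empty c = {(lam, N, S) \<in> SVT_triples. real (card (empty_boxes lam S)) \<le> c}"

definition Fix_diff :: "real \<Rightarrow> triple set" where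
  "Fix_diff c = {(lam, N, S) \<in> SVT_triples.
     \<exists>k. pretableau lam N k S \<and> real k - real (card (empty_boxes lam S)) \<le> c}"


section \<open>The generation algorithm\<close>

definition hook :: "box set \<Rightarrow> box \<Rightarrow> box set" where
  "hook A b = {(p, q) \<in> A. (p = fst b \<and> q > snd b) \<or> (q = snd b \<and> p > fst b)}"

text \<open>The walk only matters for finite \<open>A\<close>; finiteness is tested to make the recursion total.\<close>

function hook_walk :: "box set \<Rightarrow> box \<Rightarrow> box pmf" where
  "hook_walk A b =
     (if finite A \<and> hook A b \<noteq> {} then bind_pmf (pmf_of_set (hook A b)) (hook_walk A)
      else return_pmf b)"
  by pat_completeness auto
termination
proof (relation "Wellfounded.measure (\<lambda>(A, b). card {x \<in> A. fst x + snd x > fst b + snd b})", simp)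
  fix A :: "box set" and b z :: box
  assume A: "finite A \<and> hook A b \<noteq> {}" and z: "z \<in> set_pmf (pmf_of_set (hook A b))"
  have "finite (hook A b)"
    by (rule finite_subset[of _ A]) (use A in \<open>auto simp: hook_def\<close>)
  with A z have zh: "z \<in> hook A b" by (auto simp: set_pmf_of_set)
  have "{x \<in> A. fst x + snd x > fst z + snd z} \<subset> {x \<in> A. fst x + snd x > fst b + snd b}"
    using zh by (force simp: hook_def)
  then show "((A, z), (A, b)) \<in> Wellfounded.measure (\<lambda>(A, b). card {x \<in> A. fst x + snd x > fst b + snd b})"
    using A by (auto intro!: psubset_card_mono)
qed

declare hook_walk.simps [simp del]

definition Hook :: "box set \<Rightarrow> box pmf" where
  "Hook A = bind_pmf (pmf_of_set A) (hook_walk A)"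

definition NW :: "box set \<Rightarrow> box set" where
  "NW A = {(r, c) \<in> A. {(r, c)} = A \<inter> ({1..r} \<times> {1..c})}"

text \<open>If there are no empty boxes, the first branch has probability 1 and \<open>Hook {}\<close> is irrelevant.\<close>

definition svgen_step :: "nat list \<Rightarrow> nat \<Rightarrow> filling \<Rightarrow> filling pmf" where
  "svgen_step lam M T =
     (let lam' = empty_boxes lam T in
      bind_pmf (bernoulli_pmf ((real M - real (card lam')) / real M)) (\<lambda>add.
        if add
        then map_pmf (\<lambda>b. T(b := insert M (T b))) (pmf_of_set (NW {b \<in> diagram lam. T b \<noteq> {}}))
        else map_pmf (\<lambda>b. T(b := {M})) (Hook lam')))"

fun svgen_loop :: "nat list \<Rightarrow> nat \<Rightarrow> filling \<Rightarrow> filling pmf" where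
  "svgen_loop lam 0 T = return_pmf T"
| "svgen_loop lam (Suc M) T = bind_pmf (svgen_step lam (Suc M) T) (svgen_loop lam M)"

definition SVGen :: "nat list \<Rightarrow> nat \<Rightarrow> nat \<Rightarrow> filling \<Rightarrow> filling pmf" where
  "SVGen lam N k T =
     (if k = N then bind_pmf (Hook (diagram lam)) (\<lambda>b. svgen_loop lam (N - 1) (T(b := {N})))
      else svgen_loop lam k T)"

definition P_SVG :: "nat list \<Rightarrow> nat \<Rightarrow> nat \<Rightarrow> filling \<Rightarrow> filling \<Rightarrow> real" where
  "P_SVG lam N k S T = pmf (SVGen lam N k S) T"


section \<open>Finite Markov chains, mixing, and the Metropolis chain\<close>

text \<open>A transition matrix on a finite state space \<open>\<Omega>\<close> is a function \<open>P\<close> whose values are only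
  used on \<open>\<Omega> \<times> \<Omega>\<close>.\<close>

fun mat_pow :: "'s set \<Rightarrow> ('s \<Rightarrow> 's \<Rightarrow> real) \<Rightarrow> nat \<Rightarrow> 's \<Rightarrow> 's \<Rightarrow> real" where
  "mat_pow \<Omega> P 0 x y = (if x = y then 1 else 0)"
| "mat_pow \<Omega> P (Suc t) x y = (\<Sum>z\<in>\<Omega>. P x z * mat_pow \<Omega> P t z y)"

definition is_stationary :: "'s set \<Rightarrow> ('s \<Rightarrow> 's \<Rightarrow> real) \<Rightarrow> ('s \<Rightarrow> real) \<Rightarrow> bool" where
  "is_stationary \<Omega> P \<pi> \<longleftrightarrow>
     (\<forall>x\<in>\<Omega>. 0 \<le> \<pi> x) \<and> (\<forall>x. x \<notin> \<Omega> \<longrightarrow> \<pi> x = 0) \<and> (\<Sum>x\<in>\<Omega>. \<pi> x) = 1 \<and>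
     (\<forall>y\<in>\<Omega>. (\<Sum>x\<in>\<Omega>. \<pi> x * P x y) = \<pi> y)"

definition stationary_distr :: "'s set \<Rightarrow> ('s \<Rightarrow> 's \<Rightarrow> real) \<Rightarrow> 's \<Rightarrow> real" where
  "stationary_distr \<Omega> P = (THE \<pi>. is_stationary \<Omega> P \<pi>)"

definition d_TV :: "'s set \<Rightarrow> ('s \<Rightarrow> real) \<Rightarrow> ('s \<Rightarrow> real) \<Rightarrow> real" where
  "d_TV \<Omega> \<mu> \<nu> = Max ((\<lambda>A. \<bar>(\<Sum>x\<in>A. \<mu> x) - (\<Sum>x\<in>A. \<nu> x)\<bar>) ` Pow \<Omega>)"

definition mix_dist :: "'s set \<Rightarrow> ('s \<Rightarrow> 's \<Rightarrow> real) \<Rightarrow> nat \<Rightarrow> real" where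
  "mix_dist \<Omega> P t = Max ((\<lambda>x. d_TV \<Omega> (mat_pow \<Omega> P t x) (stationary_distr \<Omega> P)) ` \<Omega>)"

definition t_mix :: "'s set \<Rightarrow> ('s \<Rightarrow> 's \<Rightarrow> real) \<Rightarrow> real \<Rightarrow> nat" where
  "t_mix \<Omega> P \<epsilon> = (LEAST t. mix_dist \<Omega> P t \<le> \<epsilon>)"

definition metropolis_off :: "nat list \<Rightarrow> nat \<Rightarrow> nat \<Rightarrow> filling \<Rightarrow> filling \<Rightarrow> filling \<Rightarrow> real" where
  "metropolis_off lam N k S T F =
     P_SVG lam N k S F * min 1 (P_SVG lam N k S T / P_SVG lam N k S F)"

definition MC_SVT :: "nat list \<Rightarrow> nat \<Rightarrow> nat \<Rightarrow> filling \<Rightarrow> filling \<Rightarrow> filling \<Rightarrow> real" where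
  "MC_SVT lam N k S T F =
     (if F \<noteq> T then metropolis_off lam N k S T F
      else 1 - (\<Sum>R\<in>SVT_ext lam N S - {T}. metropolis_off lam N k S T R))"

definition polynomial3 :: "(real \<Rightarrow> real \<Rightarrow> real \<Rightarrow> real) \<Rightarrow> bool" where
  "polynomial3 p \<longleftrightarrow> (\<exists>(D::nat) (a :: nat \<Rightarrow> nat \<Rightarrow> nat \<Rightarrow> real). \<forall>x y z.
     p x y z = (\<Sum>i\<le>D. \<Sum>j\<le>D. \<Sum>l\<le>D. a i j l * x ^ i * y ^ j * z ^ l))"

text \<open>The existence of a suitable \<open>t\<close> is demanded separately, since \<open>LEAST\<close> is unspecified when
  the chain never gets \<open>\<epsilon>\<close>-close.\<close>

definition rapidly_mixing :: "triple set \<Rightarrow> bool" where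
  "rapidly_mixing \<F> \<longleftrightarrow> (\<exists>p. polynomial3 p \<and>
     (\<forall>(lam, N, S)\<in>\<F>. \<forall>k. pretableau lam N k S \<longrightarrow> (\<forall>\<epsilon>>0.
        (\<exists>t. mix_dist (SVT_ext lam N S) (MC_SVT lam N k S) t \<le> \<epsilon>) \<and>
        real (t_mix (SVT_ext lam N S) (MC_SVT lam N k S) \<epsilon>)
          \<le> p (1 / \<epsilon>) (real (card (empty_boxes lam S))) (real k))))"


section \<open>Randomized algorithms and their running time\<close>

text \<open>
  Algorithms are programs of a randomized random access machine with unit cost per instruction.
  Memory cells hold natural numbers and are addressed by tuples of natural numbers (arrays of any
  dimension). The only arithmetic is addition and truncated subtraction, so that the bit length of
  the numbers grows at most linearly with the running time and unit cost is an honest measure;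
  the random instruction draws exactly uniformly from \<open>{0..<x}\<close>, independently of the past.
\<close>

datatype expr =
    Const nat
  | Cell "expr list"
  | Plus expr expr
  | Minus expr expr

type_synonym mem = "nat list \<Rightarrow> nat"

fun val :: "mem \<Rightarrow> expr \<Rightarrow> nat" where
  "val m (Const n) = n"
| "val m (Cell es) = m (map (val m) es)"
| "val m (Plus e1 e2) = val m e1 + val m e2"
| "val m (Minus e1 e2) = val m e1 - val m e2"

text \<open>The tests of \<open>IfLess\<close> and \<open>WhileLess\<close> compare the values of two expressions by \<open><\<close>.\<close>

datatype prog =
    Halt
  | Assign "expr list" expr
  | Random "expr list" expr
  | Seq prog prog
  | IfLess expr expr prog prog
  | WhileLess expr expr prog

fun exec_step :: "prog \<times> mem \<Rightarrow> (prog \<times> mem) pmf" where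
  "exec_step (Halt, m) = return_pmf (Halt, m)"
| "exec_step (Assign es e, m) = return_pmf (Halt, m(map (val m) es := val m e))"
| "exec_step (Random es e, m) =
     (if val m e = 0 then return_pmf (Halt, m(map (val m) es := 0))
      else map_pmf (\<lambda>u. (Halt, m(map (val m) es := u))) (pmf_of_set {0..<val m e}))"
| "exec_step (Seq c1 c2, m) =
     (if c1 = Halt then return_pmf (c2, m)
      else map_pmf (\<lambda>(c1', m'). (Seq c1' c2, m')) (exec_step (c1, m)))"
| "exec_step (IfLess e1 e2 c1 c2, m) =
     return_pmf (if val m e1 < val m e2 then c1 else c2, m)"
| "exec_step (WhileLess e1 e2 c, m) =
     return_pmf (if val m e1 < val m e2 then Seq c (WhileLess e1 e2 c) else Halt, m)"

fun exec :: "nat \<Rightarrow> prog \<times> mem \<Rightarrow> (prog \<times> mem) pmf" where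
  "exec 0 cf = return_pmf cf"
| "exec (Suc n) cf = bind_pmf (exec_step cf) (exec n)"

text \<open>Started in memory \<open>m\<close>, the program surely halts within \<open>n\<close> steps, and \<open>D\<close> is the law of the
  final memory.\<close>

definition halts_within :: "prog \<Rightarrow> mem \<Rightarrow> nat \<Rightarrow> mem pmf \<Rightarrow> bool" where
  "halts_within c m n D \<longleftrightarrow> exec n (c, m) = map_pmf (\<lambda>m'. (Halt, m')) D"

text \<open>
  The input is \<open>(\<lambda>, N, S)\<close> with its \<open>k\<close> and the rational bias parameter \<open>\<delta> = a / b\<close>. Since the time
  bound is in terms of \<open>k\<close> and \<open>|\<lambda> \<setminus> S|\<close>, which may be much smaller than the size of \<open>\<lambda>\<close> and \<open>S\<close>,
  the input is accessed at random: cell \<open>[4, r]\<close> holds \<open>\<lambda>\<^sub>r\<close>, cell \<open>[5, r, c]\<close> holds \<open>|S(r,c)|\<close>, and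
  cell \<open>[6, r, c, v]\<close> tells whether \<open>v \<in> S(r,c)\<close>. For the same reason the output is produced in
  place, in the cells \<open>[6, r, c, v]\<close>.
\<close>

definition input_mem :: "nat list \<Rightarrow> nat \<Rightarrow> nat \<Rightarrow> filling \<Rightarrow> nat \<Rightarrow> nat \<Rightarrow> mem" where
  "input_mem lam N k S a b adr =
     (case adr of
        [i] \<Rightarrow> if i = 0 then k else if i = 1 then N else if i = 2 then a else if i = 3 then b else 0
      | [i, r] \<Rightarrow> if i = 4 \<and> 1 \<le> r \<and> r \<le> length lam then lam ! (r - 1) else 0
      | [i, r, c] \<Rightarrow> if i = 5 then card (S (r, c)) else 0
      | [i, r, c, v] \<Rightarrow> if i = 6 \<and> v \<in> S (r, c) then 1 else 0
      | _ \<Rightarrow> 0)"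

definition output_filling :: "mem \<Rightarrow> filling" where
  "output_filling m = (\<lambda>(r, c). {v. m [6, r, c, v] = 1})"

definition outputs_within ::
  "prog \<Rightarrow> nat list \<Rightarrow> nat \<Rightarrow> nat \<Rightarrow> filling \<Rightarrow> nat \<Rightarrow> nat \<Rightarrow> nat \<Rightarrow> filling pmf \<Rightarrow> bool" where
  "outputs_within c lam N k S a b n \<Gamma> \<longleftrightarrow>
     (\<exists>D. halts_within c (input_mem lam N k S a b) n D \<and> \<Gamma> = map_pmf output_filling D)"

definition is_FPAUS :: "prog \<Rightarrow> triple set \<Rightarrow> bool" where
  "is_FPAUS c \<F> \<longleftrightarrow> (\<exists>p. polynomial3 p \<and>
     (\<forall>(lam, N, S)\<in>\<F>. \<forall>k. pretableau lam N k S \<longrightarrow> (\<forall>a b. 0 < a \<longrightarrow> a < b \<longrightarrow>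
        (let \<delta> = real a / real b; \<Omega> = SVT_ext lam N S in
         \<exists>n \<Gamma>. real n \<le> p (real k) (real (card (empty_boxes lam S))) (ln (1 / \<delta>)) \<and>
           outputs_within c lam N k S a b n \<Gamma> \<and>
           set_pmf \<Gamma> \<subseteq> \<Omega> \<and>
           d_TV \<Omega> (pmf \<Gamma>) (pmf (pmf_of_set \<Omega>)) \<le> \<delta>))))"

text \<open>On every input the program simulates the chain: it outputs the state \<open>X\<^sub>t\<close> of the chain
  started at some \<open>X\<^sub>0 = x\<close>.\<close>

definition simulates_chain :: "prog \<Rightarrow> triple set \<Rightarrow> bool" where
  "simulates_chain c \<F> \<longleftrightarrow>
     (\<forall>(lam, N, S)\<in>\<F>. \<forall>k. pretableau lam N k S \<longrightarrow> (\<forall>a b. 0 < a \<longrightarrow> a < b \<longrightarrow>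
        (let \<Omega> = SVT_ext lam N S in
         \<exists>n \<Gamma>. outputs_within c lam N k S a b n \<Gamma> \<and>
           (\<exists>x\<in>\<Omega>. \<exists>t. \<forall>y\<in>\<Omega>. pmf \<Gamma> y = mat_pow \<Omega> (MC_SVT lam N k S) t x y))))"

definition chain_gives_FPAUS :: "triple set \<Rightarrow> bool" where
  "chain_gives_FPAUS \<F> \<longleftrightarrow> (\<exists>c. simulates_chain c \<F> \<and> is_FPAUS c \<F>)"

end

theory Submission
  imports Defs
begin

text \<open>
  Let \<open>m\<close> be the number of empty boxes of \<open>S\<close>. By the theorem of Greene, Nijenhuis and Wilf the
  algorithm opens these boxes in the order of a uniformly random standard filling; the times at
  which it does so form a uniformly random set, and all other values are spread uniformly over the
  north-west corners. So it returns \<open>T\<close> with probability \<open>1 / (Z * w T)\<close>, where \<open>w T\<close> is the product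
  of the numbers of corners available when a value is added to a nonempty box, and \<open>Z\<close> does not
  depend on \<open>T\<close>. If \<open>k - m\<close> is bounded, then \<open>w\<close> is polynomially bounded and there are at least \<open>Z\<close>
  tableaux; if \<open>m\<close> is bounded, then \<open>Z \<le> k ^ m\<close> and there are at least \<open>w T\<close> tableaux. In both cases
  every tableau is proposed with probability at least \<open>1 / ((k + 1) ^ (2 * c) * |\<Omega>|)\<close>, so that the
  symmetric Metropolis chain satisfies a minorization condition and converges geometrically.

  A proposal is accepted with probability \<open>min 1 (w F / w T)\<close>, and a program can maintain the
  integers \<open>w\<close> by additions only; hence it simulates the chain exactly.
\<close>

section \<open>Young diagrams and the hook walk\<close>

text \<open>All bounds have to be in terms of \<open>k\<close>, although \<open>\<lambda>\<close>
  and \<open>S\<close> may be arbitrarily large. This is possible because the empty boxes and the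
  north-west corners never leave a square of side \<open>k + 1\<close>. The square bounds every
  factor of \<open>w\<close>, and it confines every scan of the program.

  The other obstacle is the machine, which neither multiplies nor takes logarithms. The product
  \<open>w\<close> grows by adding the current weight once for each corner in a list; the acceptance
  test compares a uniform number below \<open>w T\<close> with \<open>w F\<close>, so that the
  unknown \<open>Z\<close> does not occur; a power of \<open>k + 1\<close> is realized by nested
  loops; and the number of rounds is counted by doubling the numerator of the bias until it reaches
  the denominator. Finally, an initial tableau would have to be computed as well. Instead the chain
  starts in a fictitious state of weight 1 that accepts every proposal, and from the first step on
  this cannot be told from a start at a tableau of least weight.\<close>

definition young :: "box set \<Rightarrow> bool" where
  "young A \<longleftrightarrow> finite A \<and> A \<subseteq> {1..} \<times> {1..} \<and>
     (\<forall>r c r' c'. (r, c) \<in> A \<longrightarrow> 1 \<le> r' \<longrightarrow> r' \<le> r \<longrightarrow> 1 \<le> c' \<longrightarrow> c' \<le> c \<longrightarrow> (r', c') \<in> A)"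

lemma youngD: "young A \<Longrightarrow> (r, c) \<in> A \<Longrightarrow> 1 \<le> r' \<Longrightarrow> r' \<le> r \<Longrightarrow> 1 \<le> c' \<Longrightarrow> c' \<le> c \<Longrightarrow> (r', c') \<in> A"
  unfolding young_def by blast

lemma young_pos: "young A \<Longrightarrow> (r, c) \<in> A \<Longrightarrow> 1 \<le> r \<and> 1 \<le> c"
  unfolding young_def by auto

lemma young_finite: "young A \<Longrightarrow> finite A"
  unfolding young_def by auto

definition row_len :: "box set \<Rightarrow> nat \<Rightarrow> nat" where
  "row_len A r = card {c. (r, c) \<in> A}"

definition col_len :: "box set \<Rightarrow> nat \<Rightarrow> nat" where
  "col_len A c = card {r. (r, c) \<in> A}"

lemma down_closed_eq_interval:
  fixes X :: "nat set"
  assumes "finite X" "\<And>x. x \<in> X \<Longrightarrow> 1 \<le> x" "\<And>x y. x \<in> X \<Longrightarrow> 1 \<le> y \<Longrightarrow> y \<le> x \<Longrightarrow> y \<in> X"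
  shows "X = {1..card X}"
proof (cases "X = {}")
  case False
  have "X = {1..Max X}"
  proof (intro equalityI subsetI)
    fix x assume "x \<in> {1..Max X}"
    then show "x \<in> X" using assms(3)[OF Max_in[OF assms(1) False], of x] by auto
  qed (use assms(1,2) in auto)
  then show ?thesis by (metis card_atLeastAtMost diff_Suc_1 One_nat_def)
qed simp

lemma young_row: "young A \<Longrightarrow> {c. (r, c) \<in> A} = {1..row_len A r}"
  unfolding row_len_def
proof (rule down_closed_eq_interval)
  assume A: "young A"
  have "{c. (r, c) \<in> A} \<subseteq> snd ` A" by force
  then show "finite {c. (r, c) \<in> A}" using A finite_subset by (auto simp: young_def)
  show "1 \<le> x" if "x \<in> {c. (r, c) \<in> A}" for x using A that by (auto simp: young_def)
  show "y \<in> {c. (r, c) \<in> A}" if "x \<in> {c. (r, c) \<in> A}" "1 \<le> y" "y \<le> x" for x y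
    using youngD[OF A, of r x r y] young_pos[OF A, of r x] that by simp
qed

lemma young_col: "young A \<Longrightarrow> {r. (r, c) \<in> A} = {1..col_len A c}"
  unfolding col_len_def
proof (rule down_closed_eq_interval)
  assume A: "young A"
  have "{r. (r, c) \<in> A} \<subseteq> fst ` A" by force
  then show "finite {r. (r, c) \<in> A}" using A finite_subset by (auto simp: young_def)
  show "1 \<le> x" if "x \<in> {r. (r, c) \<in> A}" for x using A that by (auto simp: young_def)
  show "y \<in> {r. (r, c) \<in> A}" if "x \<in> {r. (r, c) \<in> A}" "1 \<le> y" "y \<le> x" for x y
    using youngD[OF A, of x c y c] young_pos[OF A, of x c] that by simp
qed

lemma young_mem_row: "young A \<Longrightarrow> (r, c) \<in> A \<longleftrightarrow> 1 \<le> c \<and> c \<le> row_len A r"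
  by (drule young_row[of A r], drule eqset_imp_iff[of _ _ c]) simp

lemma young_mem_col: "young A \<Longrightarrow> (r, c) \<in> A \<longleftrightarrow> 1 \<le> r \<and> r \<le> col_len A c"
  by (drule young_col[of A c], drule eqset_imp_iff[of _ _ r]) simp

lemma finite_hook: "finite A \<Longrightarrow> finite (hook A b)"
  by (rule finite_subset[of _ A]) (auto simp: hook_def)

lemma hook_young:
  assumes "young A"
  shows "hook A (r, c) = {r} \<times> ({c<..row_len A r} \<inter> {1..}) \<union> ({r<..col_len A c} \<inter> {1..}) \<times> {c}"
proof (intro set_eqI)
  fix x :: box
  obtain p q where x: "x = (p, q)" by force
  show "x \<in> hook A (r, c) \<longleftrightarrow> x \<in> {r} \<times> ({c<..row_len A r} \<inter> {1..}) \<union> ({r<..col_len A c} \<inter> {1..}) \<times> {c}"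
    using young_mem_row[OF assms, of r q] young_mem_col[OF assms, of p c]
    unfolding x hook_def by auto
qed

lemma sum_singleton_times_left: "sum G ({r} \<times> X) = sum (\<lambda>q. G (r, q)) X"
proof -
  have "{r} \<times> X = Pair r ` X" by auto
  then show ?thesis by (simp add: sum.reindex inj_on_def comp_def)
qed

lemma sum_singleton_times_right: "sum G (X \<times> {c}) = sum (\<lambda>p. G (p, c)) X"
proof -
  have "X \<times> {c} = (\<lambda>p. (p, c)) ` X" by auto
  then show ?thesis by (simp add: sum.reindex inj_on_def comp_def)
qed

lemma prod_singleton_times_left: "prod G ({r} \<times> X) = prod (\<lambda>q. G (r, q)) X"
proof -
  have "{r} \<times> X = Pair r ` X" by auto
  then show ?thesis by (simp add: prod.reindex inj_on_def comp_def)
qed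

lemma prod_singleton_times_right: "prod G (X \<times> {c}) = prod (\<lambda>p. G (p, c)) X"
proof -
  have "X \<times> {c} = (\<lambda>p. (p, c)) ` X" by auto
  then show ?thesis by (simp add: prod.reindex inj_on_def comp_def)
qed

lemma sum_hook_young:
  assumes "young A" "(r, c) \<in> A"
  shows "(\<Sum>x\<in>hook A (r, c). G x) =
    (\<Sum>q\<in>{c<..row_len A r}. G (r, q)) + (\<Sum>p\<in>{r<..col_len A c}. G (p, c))"
proof -
  have rc: "1 \<le> r" "1 \<le> c" using young_pos[OF assms] by auto
  then have *: "hook A (r, c) = {r} \<times> {c<..row_len A r} \<union> {r<..col_len A c} \<times> {c}"
    using hook_young[OF assms(1)] by auto
  show ?thesis unfolding *
    by (subst sum.union_disjoint) (auto simp: sum_singleton_times_left sum_singleton_times_right)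
qed

lemma card_hook_young:
  assumes "young A" "(r, c) \<in> A"
  shows "card (hook A (r, c)) = (row_len A r - c) + (col_len A c - r)"
  using sum_hook_young[OF assms, of "\<lambda>_. 1::nat"] by simp

definition corner :: "box set \<Rightarrow> box \<Rightarrow> bool" where
  "corner A z \<longleftrightarrow> z \<in> A \<and> hook A z = {}"

lemma corner_iff:
  assumes "young A"
  shows "corner A (\<alpha>, \<beta>) \<longleftrightarrow> (\<alpha>, \<beta>) \<in> A \<and> row_len A \<alpha> = \<beta> \<and> col_len A \<beta> = \<alpha>"
proof -
  have "hook A (\<alpha>, \<beta>) = {} \<longleftrightarrow> card (hook A (\<alpha>, \<beta>)) = 0"
    using finite_hook[OF young_finite[OF assms]] by auto
  then show ?thesis
    using card_hook_young[OF assms, of \<alpha> \<beta>] young_mem_row[OF assms, of \<alpha> \<beta>] young_mem_col[OF assms, of \<alpha> \<beta>]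
    by (auto simp: corner_def)
qed

definition hook_prod :: "box set \<Rightarrow> real" where
  "hook_prod A = (\<Prod>x\<in>A. real (card (hook A x) + 1))"

text \<open>The probability that the hook walk from \<open>(r, c)\<close> ends in a fixed corner is the product of a
  factor for \<open>r\<close> and a factor for \<open>c\<close>, both of the following form.\<close>

definition tele :: "(nat \<Rightarrow> nat) \<Rightarrow> nat \<Rightarrow> nat \<Rightarrow> real" where
  "tele f a r = (if r < a then (\<Prod>i\<in>{r<..<a}. 1 + 1 / real (f i)) / real (f r) else if r = a then 1 else 0)"

text \<open>Peel off the factor of \<open>Suc r\<close>: its summand 1 yields the remaining product,
  which is the remaining sum by induction, and its summand \<open>1 / f (Suc r)\<close> yields the
  term \<open>tele f a (Suc r)\<close>.\<close>

lemma tele_sum: "r < a \<Longrightarrow> (\<Sum>r'\<in>{r<..a}. tele f a r') = (\<Prod>i\<in>{r<..<a}. 1 + 1 / real (f i))"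
proof (induction "a - r" arbitrary: r)
  case (Suc d)
  show ?case
  proof (cases "Suc r = a")
    case True
    then have "{r<..a} = {a}" "{r<..<a} = {}" by auto
    then show ?thesis by (simp add: tele_def)
  next
    case False
    with Suc have l: "Suc r < a" by simp
    have *: "{r<..a} = insert (Suc r) {Suc r<..a}" "{r<..<a} = insert (Suc r) {Suc r<..<a}"
      using l by auto
    show ?thesis unfolding *
      using Suc(1)[of "Suc r"] Suc(2) l by (simp add: tele_def algebra_simps)
  qed
qed simp

text \<open>The mean value property of the walk in one coordinate, with weight \<open>f r\<close>.
  At \<open>a\<close> both sides vanish because \<open>f a = 0\<close>, beyond \<open>a\<close>
  because \<open>tele\<close> does.\<close>

lemma tele_sum_beyond:
  assumes "a \<le> b" "r < a \<longrightarrow> f r \<noteq> 0" "f a = 0"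
  shows "(\<Sum>r'\<in>{r<..b}. tele f a r') = real (f r) * tele f a r"
proof -
  have "(\<Sum>r'\<in>{r<..b}. tele f a r') = (\<Sum>r'\<in>{r<..a}. tele f a r')"
    using assms(1) by (intro sum.mono_neutral_right) (auto simp: tele_def)
  also have "\<dots> = real (f r) * tele f a r"
    using tele_sum[of r a f] assms(2,3) by (cases "r < a") (auto simp: tele_def)
  finally show ?thesis .
qed

lemma sum_tele: "1 \<le> a \<Longrightarrow> (\<Sum>r\<in>{1..a}. tele f a r) = (\<Prod>i\<in>{1..<a}. 1 + 1 / real (f i))"
proof -
  assume "1 \<le> a"
  then have "(\<Sum>r\<in>{0<..a}. tele f a r) = (\<Prod>i\<in>{0<..<a}. 1 + 1 / real (f i))"
    by (intro tele_sum) simp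
  moreover have "{0<..a} = {1..a}" "{0<..<a} = {1..<a}" by auto
  ultimately show ?thesis by simp
qed

context
  fixes A :: "box set" and \<alpha> \<beta> :: nat
  assumes A: "young A" and z: "corner A (\<alpha>, \<beta>)"
begin

lemma corner_in: "(\<alpha>, \<beta>) \<in> A" and corner_row_len: "row_len A \<alpha> = \<beta>" and corner_col_len: "col_len A \<beta> = \<alpha>"
  using z corner_iff[OF A] by auto

lemma corner_rect: "1 \<le> r \<Longrightarrow> r \<le> \<alpha> \<Longrightarrow> 1 \<le> c \<Longrightarrow> c \<le> \<beta> \<Longrightarrow> (r, c) \<in> A"
  using youngD[OF A corner_in] .

lemma corner_pos: "1 \<le> \<alpha>" "1 \<le> \<beta>"
  using young_pos[OF A corner_in] by auto

text \<open>The arm of \<open>(r, c)\<close> splits at column \<open>\<beta>\<close> and its leg at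
  row \<open>\<alpha>\<close>, and the corner is the end of both its row and its column. This
  additivity is what makes a product of a row factor and a column factor satisfy the equation of the
  walk.\<close>

lemma hook_split:
  assumes "1 \<le> r" "r \<le> \<alpha>" "1 \<le> c" "c \<le> \<beta>"
  shows "card (hook A (r, c)) = card (hook A (r, \<beta>)) + card (hook A (\<alpha>, c))"
proof -
  note m = corner_rect[OF assms] corner_rect[OF assms(1,2) corner_pos(2) order_refl] corner_rect[OF corner_pos(1) order_refl assms(3,4)]
  show ?thesis
    using assms m[THEN card_hook_young[OF A]] corner_row_len corner_col_len
      young_mem_row[OF A, of r \<beta>] young_mem_col[OF A, of \<alpha> c] m by auto
qed

abbreviation (input) "frow \<equiv> \<lambda>i. card (hook A (i, \<beta>))"
abbreviation (input) "fcol \<equiv> \<lambda>j. card (hook A (\<alpha>, j))"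

lemma frow_pos: "1 \<le> r \<Longrightarrow> r < \<alpha> \<Longrightarrow> frow r \<noteq> 0"
  using card_hook_young[OF A corner_rect[of r \<beta>]] corner_pos corner_col_len by auto

lemma fcol_pos: "1 \<le> c \<Longrightarrow> c < \<beta> \<Longrightarrow> fcol c \<noteq> 0"
  using card_hook_young[OF A corner_rect[of \<alpha> c]] corner_pos corner_row_len by auto

lemma corner_card: "card (hook A (\<alpha>, \<beta>)) = 0"
  using z by (simp add: corner_def)

text \<open>The absorption probability is determined by its values at the corners and by being,
  elsewhere, its own mean over the hook. The product has this property: by
  \<open>tele_sum_beyond\<close> its sum over the arm is \<open>fcol c\<close> times and its sum
  over the leg \<open>frow r\<close> times the value at \<open>(r, c)\<close>, and by
  \<open>hook_split\<close> these two numbers add up to the size of the hook.\<close>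

lemma pmf_hook_walk_corner:
  assumes "(r, c) \<in> A"
  shows "pmf (hook_walk A (r, c)) (\<alpha>, \<beta>) = tele frow \<alpha> r * tele fcol \<beta> c"
proof -
  have "B = A \<Longrightarrow> b \<in> A \<Longrightarrow> pmf (hook_walk B b) (\<alpha>, \<beta>) = tele frow \<alpha> (fst b) * tele fcol \<beta> (snd b)" for B b
  proof (induction B b rule: hook_walk.induct)
    case (1 B b)
    obtain r c where b: "b = (r, c)" by force
    have rc: "(r, c) \<in> A" "1 \<le> r" "1 \<le> c" and fin: "finite A"
      using 1 b young_pos[OF A, of r c] young_finite[OF A] by auto
    let ?G = "\<lambda>x. tele frow \<alpha> (fst x) * tele fcol \<beta> (snd x)"
    have sum: "(\<Sum>x\<in>hook A (r, c). ?G x) = real (card (hook A (r, c))) * ?G (r, c)"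
    proof (cases "r \<le> \<alpha> \<and> c \<le> \<beta>")
      case True
      then have "\<beta> \<le> row_len A r" "\<alpha> \<le> col_len A c"
        using rc corner_pos young_mem_row[OF A, of r \<beta>] young_mem_col[OF A, of \<alpha> c] corner_rect[of r \<beta>] corner_rect[of \<alpha> c] by auto
      then have "(\<Sum>q\<in>{c<..row_len A r}. tele fcol \<beta> q) = real (fcol c) * tele fcol \<beta> c"
        "(\<Sum>p\<in>{r<..col_len A c}. tele frow \<alpha> p) = real (frow r) * tele frow \<alpha> r"
        using corner_card fcol_pos[of c] frow_pos[of r] rc by (intro tele_sum_beyond; simp)+
      then show ?thesis
        using hook_split[of r c] True rc
        by (simp add: sum_hook_young[OF A] flip: sum_distrib_left sum_distrib_right) (simp add: algebra_simps)
    next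
      case False
      have "tele frow \<alpha> p = 0" if "r > \<alpha>" "p \<ge> r" for p using that by (simp add: tele_def)
      moreover have "tele fcol \<beta> p = 0" if "c > \<beta>" "p \<ge> c" for p using that by (simp add: tele_def)
      ultimately show ?thesis
        using False by (simp add: sum_hook_young[OF A rc(1)] not_le) (auto intro!: sum.neutral)
    qed
    show ?case
    proof (cases "hook A (r, c) = {}")
      case True
      then have *: "hook_walk B b = return_pmf b"
        using 1 b by (simp add: hook_walk.simps[of A])
      show ?thesis
      proof (cases "b = (\<alpha>, \<beta>)")
        case True
        then show ?thesis unfolding * by (simp add: tele_def)
      next
        case False
        have "corner A (r, c)" using True rc by (simp add: corner_def)
        then have "row_len A r = c" "col_len A c = r" using corner_iff[OF A] by auto
        moreover have "r \<le> \<alpha> \<Longrightarrow> c \<le> \<beta> \<Longrightarrow> (r, \<beta>) \<in> A \<and> (\<alpha>, c) \<in> A" using corner_rect rc corner_pos by auto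
        ultimately have "\<not> (r \<le> \<alpha> \<and> c \<le> \<beta>)"
          using False b young_mem_row[OF A, of r \<beta>] young_mem_col[OF A, of \<alpha> c] by auto
        then show ?thesis unfolding * using False b by (auto simp: tele_def)
      qed
    next
      case False
      have fh: "finite (hook A (r, c))" by (rule finite_hook[OF fin])
      have ih: "pmf (hook_walk A x) (\<alpha>, \<beta>) = ?G x" if "x \<in> hook A (r, c)" for x
        using 1(1)[of x] 1(2,3) that False fh b fin by (auto simp: hook_def)
      have "hook_walk B b = bind_pmf (pmf_of_set (hook A (r, c))) (hook_walk A)"
        using 1(2) b False fin by (simp add: hook_walk.simps[of A])
      then have "pmf (hook_walk B b) (\<alpha>, \<beta>) = (\<Sum>x\<in>hook A (r, c). ?G x) / card (hook A (r, c))"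
        using False fh ih by (simp add: pmf_bind_pmf_of_set)
      then show ?thesis using sum False fh b by simp
    qed
  qed
  then show ?thesis using assms by auto
qed

text \<open>Only starting boxes weakly north-west of the corner contribute. They form a rectangle,
  on which the sum of products is a product of two sums of the kind evaluated by
  \<open>sum_tele\<close>.\<close>

lemma pmf_Hook_corner:
  "pmf (Hook A) (\<alpha>, \<beta>) =
     (\<Prod>i\<in>{1..<\<alpha>}. 1 + 1 / real (frow i)) * (\<Prod>j\<in>{1..<\<beta>}. 1 + 1 / real (fcol j)) / card A"
proof -
  have fin: "finite A" "A \<noteq> {}" using young_finite[OF A] corner_in by auto
  let ?G = "\<lambda>x. tele frow \<alpha> (fst x) * tele fcol \<beta> (snd x)"
  have "pmf (Hook A) (\<alpha>, \<beta>) = (\<Sum>x\<in>A. ?G x) / card A"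
    unfolding Hook_def using fin pmf_hook_walk_corner by (subst pmf_bind_pmf_of_set) (auto intro!: sum.cong)
  also have "(\<Sum>x\<in>A. ?G x) = (\<Sum>x\<in>{1..\<alpha>} \<times> {1..\<beta>}. ?G x)"
  proof (intro sum.mono_neutral_right ballI)
    show "{1..\<alpha>} \<times> {1..\<beta>} \<subseteq> A" by (auto intro: corner_rect)
    fix x assume "x \<in> A - {1..\<alpha>} \<times> {1..\<beta>}"
    then have "\<not> fst x \<le> \<alpha> \<or> \<not> snd x \<le> \<beta>" using young_pos[OF A, of "fst x" "snd x"] by (cases x) auto
    then show "?G x = 0" by (auto simp: tele_def)
  qed (rule fin)
  also have "\<dots> = (\<Sum>r\<in>{1..\<alpha>}. tele frow \<alpha> r) * (\<Sum>c\<in>{1..\<beta>}. tele fcol \<beta> c)"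
    by (simp add: sum_product sum.cartesian_product split_def)
  finally show ?thesis using sum_tele corner_pos by simp
qed

text \<open>Removing a corner shortens by one exactly the hooks that contain it, those of the boxes
  above it and to its left. Each such hook length loses the factor
  \<open>1 + 1 / card (hook A x)\<close>, so the quotient is the very product in
  \<open>pmf_Hook_corner\<close>.\<close>

lemma hook_prod_remove_corner:
  "hook_prod A = hook_prod (A - {(\<alpha>, \<beta>)}) *
     ((\<Prod>i\<in>{1..<\<alpha>}. 1 + 1 / real (frow i)) * (\<Prod>j\<in>{1..<\<beta>}. 1 + 1 / real (fcol j)))"
proof -
  let ?z = "(\<alpha>, \<beta>)"
  let ?C = "{1..<\<alpha>} \<times> {\<beta>}" and ?R = "{\<alpha>} \<times> {1..<\<beta>}"
  have fin: "finite A" using young_finite[OF A] .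
  let ?q = "\<lambda>x. if x \<in> ?C \<union> ?R then 1 + 1 / real (card (hook A x)) else 1"
  have h: "hook (A - {?z}) x = hook A x - {?z}" for x by (auto simp: hook_def)
  have in_hook: "?z \<in> hook A x \<longleftrightarrow> x \<in> ?C \<union> ?R" if "x \<in> A" for x
    using that corner_in young_pos[OF A, of "fst x" "snd x"] by (cases x) (auto simp: hook_def)
  have "hook_prod A = (\<Prod>x\<in>A - {?z}. real (card (hook A x) + 1))"
    unfolding hook_prod_def using fin corner_in corner_card by (subst prod.remove[of _ ?z]) auto
  also have "\<dots> = (\<Prod>x\<in>A - {?z}. real (card (hook (A - {?z}) x) + 1) * ?q x)"
  proof (intro prod.cong refl)
    fix x assume x: "x \<in> A - {?z}"
    show "real (card (hook A x) + 1) = real (card (hook (A - {?z}) x) + 1) * ?q x"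
    proof (cases "x \<in> ?C \<union> ?R")
      case True
      then have "?z \<in> hook A x" using in_hook x by auto
      then have "card (hook (A - {?z}) x) + 1 = card (hook A x)" "card (hook A x) > 0"
        using finite_hook[OF fin, of x] card_Suc_Diff1[of "hook A x" ?z] by (auto simp: card_gt_0_iff h)
      then show ?thesis using True by (simp add: field_simps)
    next
      case False
      then have "hook (A - {?z}) x = hook A x" using in_hook x h by auto
      then show ?thesis using False by simp
    qed
  qed
  also have "\<dots> = hook_prod (A - {?z}) * (\<Prod>x\<in>A - {?z}. ?q x)"
    by (simp only: prod.distrib hook_prod_def)
  also have "(\<Prod>x\<in>A - {?z}. ?q x) = (\<Prod>x\<in>?C \<union> ?R. 1 + 1 / real (card (hook A x)))"
  proof (intro prod.mono_neutral_cong_right)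
    show "?C \<union> ?R \<subseteq> A - {?z}" using corner_pos by (auto intro: corner_rect)
  qed (use fin in auto)
  also have "\<dots> = (\<Prod>x\<in>?C. 1 + 1 / real (card (hook A x))) * (\<Prod>x\<in>?R. 1 + 1 / real (card (hook A x)))"
    by (intro prod.union_disjoint) auto
  also have "(\<Prod>x\<in>?C. 1 + 1 / real (card (hook A x))) = (\<Prod>i\<in>{1..<\<alpha>}. 1 + 1 / real (frow i))"
    by (simp add: prod_singleton_times_left prod_singleton_times_right)
  also have "(\<Prod>x\<in>?R. 1 + 1 / real (card (hook A x))) = (\<Prod>j\<in>{1..<\<beta>}. 1 + 1 / real (fcol j))"
    by (simp add: prod_singleton_times_left prod_singleton_times_right)
  finally show ?thesis .
qed

end

text \<open>For a Young diagram this is the hook length formula, which counts the standard fillings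
  of \<open>A\<close>.\<close>

definition ydim :: "box set \<Rightarrow> real" where
  "ydim A = fact (card A) / hook_prod A"

lemma hook_prod_ge_1: "1 \<le> hook_prod A"
  unfolding hook_prod_def by (intro prod_ge_1) auto

lemma ydim_pos: "0 < ydim A"
  using hook_prod_ge_1[of A] by (simp add: ydim_def)

lemma ydim_le_fact: "ydim A \<le> fact (card A)"
  using hook_prod_ge_1[of A] by (simp add: ydim_def field_simps)

lemma ydim_empty: "ydim {} = 1"
  by (simp add: ydim_def hook_prod_def)

text \<open>The ratios telescope when corners are removed one after the other: every order of
  removal down to the empty diagram has probability \<open>1 / ydim A\<close>.\<close>

theorem pmf_Hook:
  assumes "young A" "corner A z"
  shows "pmf (Hook A) z = ydim (A - {z}) / ydim A"
proof -
  obtain \<alpha> \<beta> where z: "z = (\<alpha>, \<beta>)" by force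
  have zA: "z \<in> A" and fin: "finite A" using assms by (auto simp: corner_def young_def)
  then obtain n where n: "card A = Suc n" "card (A - {z}) = n"
    by (metis card_Suc_Diff1)
  obtain Q where "pmf (Hook A) z = Q / Suc n" "hook_prod A = hook_prod (A - {z}) * Q"
    using pmf_Hook_corner[OF assms(1), of \<alpha> \<beta>] hook_prod_remove_corner[OF assms(1), of \<alpha> \<beta>] assms(2) n z
    by auto
  moreover have "Q \<noteq> 0" using calculation(2) hook_prod_ge_1[of A] by auto
  ultimately show ?thesis
    using hook_prod_ge_1[of "A - {z}"] by (simp add: ydim_def n)
qed

lemma set_pmf_hook_walk:
  "finite A \<Longrightarrow> b \<in> A \<Longrightarrow> x \<in> set_pmf (hook_walk A b) \<Longrightarrow> corner A x"
proof (induction A b rule: hook_walk.induct)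
  case (1 A b)
  show ?case
  proof (cases "hook A b = {}")
    case True
    then show ?thesis using 1 by (simp add: hook_walk.simps[of A b] corner_def)
  next
    case False
    then obtain y where "y \<in> hook A b" "x \<in> set_pmf (hook_walk A y)"
      using 1 finite_hook[of A b] by (auto simp: hook_walk.simps[of A b])
    then show ?thesis using 1 False finite_hook[of A b] by (auto simp: hook_def)
  qed
qed

lemma set_pmf_Hook:
  "finite A \<Longrightarrow> A \<noteq> {} \<Longrightarrow> x \<in> set_pmf (Hook A) \<Longrightarrow> corner A x"
  by (auto simp: Hook_def intro: set_pmf_hook_walk)

section \<open>Finite chains with a minorization\<close>

lemma d_TV_le:
  assumes "finite \<Omega>" "\<And>A. A \<subseteq> \<Omega> \<Longrightarrow> \<bar>(\<Sum>x\<in>A. \<mu> x) - (\<Sum>x\<in>A. \<nu> x)\<bar> \<le> e"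
  shows "d_TV \<Omega> \<mu> \<nu> \<le> e"
  unfolding d_TV_def using assms by (subst Max_le_iff) auto

context
  fixes \<Omega> :: "'s set" and P :: "'s \<Rightarrow> 's \<Rightarrow> real" and \<beta> :: real
  assumes fin: "finite \<Omega>" and ne: "\<Omega> \<noteq> {}"
    and rows: "\<And>x. x \<in> \<Omega> \<Longrightarrow> (\<Sum>y\<in>\<Omega>. P x y) = 1"
    and sym: "\<And>x y. x \<in> \<Omega> \<Longrightarrow> y \<in> \<Omega> \<Longrightarrow> P x y = P y x"
    and minor: "\<And>x y. x \<in> \<Omega> \<Longrightarrow> y \<in> \<Omega> \<Longrightarrow> \<beta> / card \<Omega> \<le> P x y"
    and beta: "0 < \<beta>"
begin

lemma card_space_pos: "0 < card \<Omega>"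
  using fin ne by (simp add: card_gt_0_iff)

lemma column_sums: "y \<in> \<Omega> \<Longrightarrow> (\<Sum>x\<in>\<Omega>. P x y) = 1"
  using rows[of y] sym by (metis (no_types, lifting) sum.cong)

lemma minor_sum: "x \<in> \<Omega> \<Longrightarrow> (\<Sum>y\<in>\<Omega>. P x y - \<beta> / card \<Omega>) = 1 - \<beta>"
  using card_space_pos by (simp add: sum_subtractf rows)

lemma beta_le_1: "\<beta> \<le> 1"
proof -
  obtain x where x: "x \<in> \<Omega>" using ne by auto
  have "0 \<le> (\<Sum>y\<in>\<Omega>. P x y - \<beta> / card \<Omega>)"
    using minor x by (intro sum_nonneg) auto
  then show ?thesis using minor_sum[OF x] by simp
qed

lemma mat_pow_col_sum: "y \<in> \<Omega> \<Longrightarrow> (\<Sum>x\<in>\<Omega>. mat_pow \<Omega> P t x y) = 1"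
proof (induction t)
  case 0
  then show ?case using fin by simp
next
  case (Suc t)
  have "(\<Sum>x\<in>\<Omega>. mat_pow \<Omega> P (Suc t) x y) = (\<Sum>z\<in>\<Omega>. \<Sum>x\<in>\<Omega>. P x z * mat_pow \<Omega> P t z y)"
    by simp (rule sum.swap)
  also have "\<dots> = (\<Sum>z\<in>\<Omega>. mat_pow \<Omega> P t z y)"
    by (simp add: column_sums flip: sum_distrib_right)
  finally show ?case using Suc by simp
qed

text \<open>Split \<open>P\<close> into the constant \<open>\<beta> / card \<Omega>\<close> and a
  nonnegative rest with row sums \<open>1 - \<beta>\<close>. The deviations from
  \<open>card A / card \<Omega>\<close> sum to 0 over all starting states, since the column sums of
  the powers are 1. Hence the constant part drops out, and each step contracts the deviation by
  \<open>1 - \<beta>\<close>.\<close>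

lemma mat_pow_uniform:
  assumes "A \<subseteq> \<Omega>" "x \<in> \<Omega>"
  shows "\<bar>(\<Sum>y\<in>A. mat_pow \<Omega> P t x y) - card A / card \<Omega>\<bar> \<le> (1 - \<beta>) ^ t"
  using assms(2)
proof (induction t arbitrary: x)
  case 0
  have "finite A" "card A \<le> card \<Omega>" using assms fin by (auto intro: finite_subset card_mono)
  moreover have "0 \<le> real (card A) / card \<Omega>" "real (card A) / card \<Omega> \<le> 1"
    using calculation card_space_pos by auto
  moreover have "(\<Sum>y\<in>A. mat_pow \<Omega> P 0 x y) = (if x \<in> A then 1 else 0)"
    using calculation(1) by simp
  ultimately show ?case by (cases "x \<in> A"; simp only: if_True if_False power_0; linarith)
next
  case (Suc t)
  define a b where "a = real (card A) / card \<Omega>" and "b = \<beta> / card \<Omega>"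
  let ?f = "\<lambda>z. (\<Sum>y\<in>A. mat_pow \<Omega> P t z y) - a"
  let ?R = "\<lambda>z. P x z - b"
  have "(\<Sum>z\<in>\<Omega>. \<Sum>y\<in>A. mat_pow \<Omega> P t z y) = (\<Sum>y\<in>A. \<Sum>z\<in>\<Omega>. mat_pow \<Omega> P t z y)"
    by (rule sum.swap)
  also have "\<dots> = card A" using mat_pow_col_sum assms(1) by (subst sum.cong[OF refl, of _ _ "\<lambda>_. 1"]) auto
  finally have f0: "(\<Sum>z\<in>\<Omega>. ?f z) = 0" using card_space_pos by (simp add: sum_subtractf a_def)
  have "(\<Sum>y\<in>A. mat_pow \<Omega> P (Suc t) x y) = (\<Sum>z\<in>\<Omega>. P x z * (\<Sum>y\<in>A. mat_pow \<Omega> P t z y))"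
    by (simp add: sum_distrib_left) (rule sum.swap)
  also have "\<dots> - a = (\<Sum>z\<in>\<Omega>. P x z * ?f z)"
    using rows[OF Suc.prems] by (simp add: right_diff_distrib sum_subtractf flip: sum_distrib_right)
  also have "\<dots> = (\<Sum>z\<in>\<Omega>. ?R z * ?f z)"
    using f0 by (simp add: left_diff_distrib sum_subtractf flip: sum_distrib_left)
  also have "\<bar>\<dots>\<bar> \<le> (\<Sum>z\<in>\<Omega>. ?R z * (1 - \<beta>) ^ t)"
    using Suc minor
    by (intro order_trans[OF sum_abs] sum_mono) (auto simp: abs_mult a_def b_def intro!: mult_left_mono)
  also have "\<dots> = (1 - \<beta>) ^ Suc t"
    using minor_sum[OF Suc.prems] by (simp add: b_def flip: sum_distrib_right)
  finally show ?case by (simp add: a_def)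
qed

text \<open>The uniform distribution is stationary because all column sums are 1. For uniqueness,
  the difference \<open>g\<close> from it has sum 0, so the constant part of \<open>P\<close> may be
  subtracted again; then the sum of the \<open>\<bar>g x\<bar>\<close> is at most
  \<open>1 - \<beta>\<close> times itself.\<close>

lemma stationary_distr_uniform:
  "stationary_distr \<Omega> P = (\<lambda>x. if x \<in> \<Omega> then 1 / card \<Omega> else 0)" (is "_ = ?u")
  unfolding stationary_distr_def
proof (rule the_equality)
  show "is_stationary \<Omega> P ?u"
    using card_space_pos column_sums by (auto simp: is_stationary_def simp flip: sum_divide_distrib)
next
  fix \<pi> assume s: "is_stationary \<Omega> P \<pi>"
  define g where "g = (\<lambda>x. \<pi> x - ?u x)"
  define b where "b = \<beta> / card \<Omega>"
  let ?S = "\<Sum>x\<in>\<Omega>. \<bar>g x\<bar>"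
  have g0: "(\<Sum>x\<in>\<Omega>. g x) = 0"
    using s card_space_pos by (simp add: is_stationary_def sum_subtractf g_def)
  have "?S \<le> (\<Sum>y\<in>\<Omega>. \<Sum>x\<in>\<Omega>. \<bar>g x\<bar> * (P x y - b))"
  proof (rule sum_mono)
    fix y assume y: "y \<in> \<Omega>"
    have "(\<Sum>x\<in>\<Omega>. ?u x * P x y) = ?u y"
      using column_sums[OF y] y by (simp flip: sum_divide_distrib)
    then have "g y = (\<Sum>x\<in>\<Omega>. g x * P x y)"
      using s y by (simp add: is_stationary_def left_diff_distrib sum_subtractf g_def)
    also have "\<dots> = (\<Sum>x\<in>\<Omega>. g x * (P x y - b))"
      using g0 by (simp add: right_diff_distrib sum_subtractf flip: sum_distrib_right)
    also have "\<bar>\<dots>\<bar> \<le> (\<Sum>x\<in>\<Omega>. \<bar>g x\<bar> * (P x y - b))"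
      using minor y by (intro order_trans[OF sum_abs] sum_mono) (auto simp: abs_mult b_def)
    finally show "\<bar>g y\<bar> \<le> (\<Sum>x\<in>\<Omega>. \<bar>g x\<bar> * (P x y - b))" .
  qed
  also have "\<dots> = (\<Sum>x\<in>\<Omega>. \<Sum>y\<in>\<Omega>. \<bar>g x\<bar> * (P x y - b))" by (rule sum.swap)
  also have "\<dots> = ?S * (1 - \<beta>)"
    using minor_sum unfolding b_def by (simp flip: sum_distrib_left sum_distrib_right)
  finally have "\<beta> * ?S \<le> 0" by (simp add: algebra_simps)
  then have "?S \<le> 0" using beta by (simp add: mult_le_0_iff)
  moreover have "0 \<le> ?S" by (rule sum_nonneg) simp
  ultimately have "\<forall>x\<in>\<Omega>. \<bar>g x\<bar> = 0"
    using fin sum_nonneg_eq_0_iff[of \<Omega> "\<lambda>x. \<bar>g x\<bar>"] by auto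
  moreover have "\<pi> x = 0" if "x \<notin> \<Omega>" for x using s that by (simp add: is_stationary_def)
  ultimately show "\<pi> = ?u" by (intro ext) (auto simp: g_def)
qed

lemma d_TV_mat_pow_uniform:
  assumes "x \<in> \<Omega>" "\<And>y. y \<in> \<Omega> \<Longrightarrow> \<mu> y = mat_pow \<Omega> P t x y" "\<And>y. y \<in> \<Omega> \<Longrightarrow> \<nu> y = 1 / card \<Omega>"
  shows "d_TV \<Omega> \<mu> \<nu> \<le> (1 - \<beta>) ^ t"
proof (rule d_TV_le[OF fin])
  fix A assume A: "A \<subseteq> \<Omega>"
  have "(\<Sum>y\<in>A. \<mu> y) = (\<Sum>y\<in>A. mat_pow \<Omega> P t x y)" "(\<Sum>y\<in>A. \<nu> y) = card A / card \<Omega>"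
    using A assms(2,3) by (auto intro!: sum.cong simp: subset_iff)
  then show "\<bar>(\<Sum>y\<in>A. \<mu> y) - (\<Sum>y\<in>A. \<nu> y)\<bar> \<le> (1 - \<beta>) ^ t"
    using mat_pow_uniform[OF A assms(1)] by simp
qed

lemma mix_dist_le: "mix_dist \<Omega> P t \<le> (1 - \<beta>) ^ t"
  unfolding mix_dist_def stationary_distr_uniform
  using fin ne by (subst Max_le_iff) (auto intro!: d_TV_mat_pow_uniform)

lemma one_minus_beta_power: "(1 - \<beta>) ^ t \<le> exp (- \<beta> * real t)"
proof -
  have "(1 - \<beta>) ^ t \<le> exp (- \<beta>) ^ t"
    using beta_le_1 exp_ge_add_one_self[of "- \<beta>"] by (intro power_mono) auto
  then show ?thesis by (simp add: exp_of_nat_mult[symmetric] mult.commute)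
qed

lemma t_mix_bound:
  assumes "0 < \<epsilon>"
  shows "\<exists>t. mix_dist \<Omega> P t \<le> \<epsilon>" "real (t_mix \<Omega> P \<epsilon>) \<le> 1 / \<beta> * (1 / \<epsilon>) + 1"
proof -
  \<comment> \<open>A bound polynomial in \<open>1 / \<epsilon>\<close> is all that is asked for, so
    no logarithm is taken: this \<open>t\<close> brings the exponent down to
    \<open>- (1 / \<epsilon>)\<close>, and
    \<open>exp (- (1 / \<epsilon>)) \<le> \<epsilon>\<close>.\<close>
  define t where "t = nat \<lceil>1 / \<beta> * (1 / \<epsilon>)\<rceil>"
  have x0: "0 \<le> 1 / \<beta> * (1 / \<epsilon>)" using assms beta by simp
  have t: "1 / \<beta> * (1 / \<epsilon>) \<le> t" "t \<le> 1 / \<beta> * (1 / \<epsilon>) + 1"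
    unfolding t_def using x0 by linarith+
  have e: "1 / \<epsilon> \<le> exp (1 / \<epsilon>)" using exp_ge_add_one_self[of "1 / \<epsilon>"] by linarith
  have "mix_dist \<Omega> P t \<le> exp (- \<beta> * real t)"
    using mix_dist_le one_minus_beta_power by (rule order_trans)
  also have "\<dots> \<le> exp (- (1 / \<epsilon>))"
    using t(1) beta assms by (simp add: field_simps)
  also have "\<dots> \<le> \<epsilon>"
    using e assms by (simp add: exp_minus field_simps)
  finally have m: "mix_dist \<Omega> P t \<le> \<epsilon>" .
  then show "\<exists>t. mix_dist \<Omega> P t \<le> \<epsilon>" by blast
  have "t_mix \<Omega> P \<epsilon> \<le> t" unfolding t_mix_def using m by (rule Least_le)
  then show "real (t_mix \<Omega> P \<epsilon>) \<le> 1 / \<beta> * (1 / \<epsilon>) + 1" using t(2) by linarith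
qed

end

section \<open>Randomized programs as implementations of random results\<close>

lemma exec_Halt [simp]: "exec n (Halt, m) = return_pmf (Halt, m)"
  by (induction n) (auto simp: bind_return_pmf)

lemma exec_add: "exec (n + k) cf = bind_pmf (exec n cf) (exec k)"
  by (induction n arbitrary: cf) (auto simp: bind_return_pmf bind_assoc_pmf intro!: bind_pmf_cong)

lemma halts_mono:
  assumes "halts_within c m n D" "n \<le> n'"
  shows "halts_within c m n' D"
proof -
  obtain d where "n' = n + d" using assms(2) le_Suc_ex by blast
  then show ?thesis using assms(1)
    by (simp add: halts_within_def exec_add bind_map_pmf) (simp add: map_pmf_def)
qed

lemma halts_within_Suc:
  assumes "exec_step (c, m) = map_pmf (\<lambda>x. (c' x, m' x)) p" "\<And>x. x \<in> set_pmf p \<Longrightarrow> halts_within (c' x) (m' x) n (D x)"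
  shows "halts_within c m (Suc n) (bind_pmf p D)"
  using assms
  by (auto simp: halts_within_def bind_map_pmf map_bind_pmf intro!: bind_pmf_cong)

text \<open>The additional 1 pays for the step from \<open>Seq Halt c2\<close> to \<open>c2\<close>.
  Since \<open>exec\<close> idles in \<open>Halt\<close>, a run shorter than its bound does no
  harm.\<close>

lemma halts_Seq:
  "halts_within c1 m n1 D \<Longrightarrow> (\<And>m'. m' \<in> set_pmf D \<Longrightarrow> halts_within c2 m' n2 (E m')) \<Longrightarrow>
     halts_within (Seq c1 c2) m (n1 + n2 + 1) (bind_pmf D E)"
proof (induction n1 arbitrary: c1 m D)
  case 0
  then have h: "return_pmf (c1, m) = map_pmf (\<lambda>m'. (Halt, m')) D" by (simp add: halts_within_def)
  then have "set_pmf (map_pmf (\<lambda>m'. (Halt, m')) D) = {(c1, m)}" by (metis set_return_pmf)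
  then have c1: "c1 = Halt" and "set_pmf D \<subseteq> {m}" by auto
  then have D: "D = return_pmf m" using set_pmf_subset_singleton by metis
  show ?case
    using halts_within_Suc[of "Seq c1 c2" m "\<lambda>_. c2" "\<lambda>_. m" "return_pmf ()" n2 "\<lambda>_. E m"] c1 0(2)[of m]
    by (simp add: D bind_return_pmf)
next
  case (Suc n1)
  show ?case
  proof (cases "c1 = Halt")
    case True
    have "return_pmf (Halt, m) = map_pmf (\<lambda>m'. (Halt, m')) D" using Suc.prems(1) True
      by (simp add: halts_within_def bind_return_pmf)
    then have "set_pmf (map_pmf (\<lambda>m'. (Halt, m')) D) = {(Halt, m)}" by (metis set_return_pmf)
    then have "set_pmf D \<subseteq> {m}" by auto
    then have D: "D = return_pmf m" using set_pmf_subset_singleton by metis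
    have "halts_within (Seq c1 c2) m (Suc n2) (E m)"
      using halts_within_Suc[of "Seq c1 c2" m "\<lambda>_. c2" "\<lambda>_. m" "return_pmf ()" n2 "\<lambda>_. E m"] True Suc.prems(2)[of m]
      by (simp add: D bind_return_pmf)
    then have "halts_within (Seq c1 c2) m (Suc n1 + n2 + 1) (E m)" by (rule halts_mono) simp
    then show ?thesis by (simp add: D bind_return_pmf)
  next
    case False
    have e: "bind_pmf (exec_step (c1, m)) (exec n1) = map_pmf (\<lambda>m'. (Halt, m')) D"
      using Suc.prems(1) by (simp add: halts_within_def)
    \<comment> \<open>\<open>halts_within\<close> speaks of the run as a whole. A successor
      configuration inherits sure halting because its outcomes are among those of the whole
      run.\<close>
    define Dx where "Dx x = map_pmf snd (exec n1 x)" for x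
    have hx: "halts_within (fst x) (snd x) n1 (Dx x)" if x: "x \<in> set_pmf (exec_step (c1, m))" for x
    proof -
      have "fst y = Halt" if "y \<in> set_pmf (exec n1 x)" for y
      proof -
        have "y \<in> set_pmf (bind_pmf (exec_step (c1, m)) (exec n1))" using x that by auto
        then show ?thesis unfolding e by auto
      qed
      then have "exec n1 x = map_pmf (\<lambda>y. (Halt, snd y)) (exec n1 x)"
        by (subst map_pmf_idI[symmetric]) (auto simp: prod_eq_iff intro!: map_pmf_cong)
      then show ?thesis by (simp add: halts_within_def Dx_def pmf.map_comp comp_def)
    qed
    have "map_pmf snd (map_pmf (\<lambda>m'. (Halt, m')) D) = D" by (simp add: pmf.map_comp comp_def)
    then have D: "D = bind_pmf (exec_step (c1, m)) Dx"
      unfolding e[symmetric] by (simp add: map_bind_pmf Dx_def[abs_def])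
    have "halts_within (Seq c1 c2) m (Suc (n1 + n2 + 1)) (bind_pmf (exec_step (c1, m)) (\<lambda>x. bind_pmf (Dx x) E))"
    proof (rule halts_within_Suc)
      show "exec_step (Seq c1 c2, m) = map_pmf (\<lambda>x. (Seq (fst x) c2, snd x)) (exec_step (c1, m))"
        using False by (simp add: split_def)
      fix x assume x: "x \<in> set_pmf (exec_step (c1, m))"
      show "halts_within (Seq (fst x) c2) (snd x) (n1 + n2 + 1) (bind_pmf (Dx x) E)"
        using Suc.IH[OF hx[OF x]] Suc.prems(2) x by (auto simp: D)
    qed
    then show ?thesis by (simp add: D bind_assoc_pmf)
  qed
qed

text \<open>Refinement by coupling: \<open>p\<close> need not determine the final memory, nor conversely.\<close>

definition implements :: "prog \<Rightarrow> mem \<Rightarrow> nat \<Rightarrow> 'a pmf \<Rightarrow> ('a \<Rightarrow> mem \<Rightarrow> bool) \<Rightarrow> bool" where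
  "implements c m n p R \<longleftrightarrow> (\<exists>D :: ('a \<times> mem) pmf. map_pmf fst D = p \<and>
     (\<forall>(a, m')\<in>set_pmf D. R a m') \<and> halts_within c m n (map_pmf snd D))"

lemma implements_conseq:
  assumes "implements c m n p R" "n \<le> n'" "\<And>a m'. a \<in> set_pmf p \<Longrightarrow> R a m' \<Longrightarrow> R' a m'"
  shows "implements c m n' p R'"
proof -
  obtain D where D: "map_pmf fst D = p" "\<forall>(a, m')\<in>set_pmf D. R a m'" "halts_within c m n (map_pmf snd D)"
    using assms(1) unfolding implements_def by blast
  have "R' a m'" if "(a, m') \<in> set_pmf D" for a m'
  proof (rule assms(3))
    show "a \<in> set_pmf p" using that D(1) by force
    show "R a m'" using D(2) that by blast
  qed
  then show ?thesis using D halts_mono[OF D(3) assms(2)] unfolding implements_def by blast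
qed

lemma implements_Halt: "R a m \<Longrightarrow> implements Halt m 0 (return_pmf a) R"
  unfolding implements_def
  by (intro exI[of _ "return_pmf (a, m)"]) (auto simp: halts_within_def)

lemma implements_Assign:
  "R a (m(map (val m) es := val m e)) \<Longrightarrow> implements (Assign es e) m 1 (return_pmf a) R"
  unfolding implements_def
  by (intro exI[of _ "return_pmf (a, m(map (val m) es := val m e))"])
    (auto simp: halts_within_def bind_return_pmf)

lemma implements_Random:
  assumes "0 < val m e" "\<And>u. u < val m e \<Longrightarrow> R u (m(map (val m) es := u))"
  shows "implements (Random es e) m 1 (pmf_of_set {0..<val m e}) R"
  unfolding implements_def
proof (intro exI conjI)
  let ?D = "map_pmf (\<lambda>u. (u, m(map (val m) es := u))) (pmf_of_set {0..<val m e})"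
  have s: "set_pmf (pmf_of_set {0..<val m e}) = {0..<val m e}" using assms(1) by (intro set_pmf_of_set) auto
  show "map_pmf fst ?D = pmf_of_set {0..<val m e}" by (simp add: pmf.map_comp comp_def)
  show "\<forall>(a, m')\<in>set_pmf ?D. R a m'" using assms(2) s by auto
  show "halts_within (Random es e) m 1 (map_pmf snd ?D)"
    using assms(1)
    by (simp add: halts_within_def pmf.map_comp comp_def bind_return_pmf' exec.simps(1)[abs_def])
qed

lemma implements_Seq:
  assumes 1: "implements c1 m n1 p R" and 2: "\<And>a m'. a \<in> set_pmf p \<Longrightarrow> R a m' \<Longrightarrow> implements c2 m' n2 (q a) R'"
  shows "implements (Seq c1 c2) m (n1 + n2 + 1) (bind_pmf p q) R'"
proof -
  obtain D where D: "map_pmf fst D = p" "\<forall>(a, m')\<in>set_pmf D. R a m'" "halts_within c1 m n1 (map_pmf snd D)"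
    using 1 unfolding implements_def by blast
  have "\<forall>x\<in>set_pmf D. \<exists>E. map_pmf fst E = q (fst x) \<and> (\<forall>(b, m')\<in>set_pmf E. R' b m') \<and>
      halts_within c2 (snd x) n2 (map_pmf snd E)"
    using 2 D unfolding implements_def by fastforce
  then obtain E where E: "\<And>x. x \<in> set_pmf D \<Longrightarrow> map_pmf fst (E x) = q (fst x)"
    "\<And>x. x \<in> set_pmf D \<Longrightarrow> \<forall>(b, m')\<in>set_pmf (E x). R' b m'"
    "\<And>x. x \<in> set_pmf D \<Longrightarrow> halts_within c2 (snd x) n2 (map_pmf snd (E x))"
    by metis
  \<comment> \<open>The coupling \<open>E x\<close> depends on the abstract result and on the
    memory, while \<open>halts_Seq\<close> wants a law that depends on the memory alone. The memory
    marginal of \<open>E x\<close> is such a law, because the run determines it.\<close>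
  have m2: "map_pmf snd (E x) = map_pmf snd (exec n2 (c2, snd x))" if "x \<in> set_pmf D" for x
    using E(3)[OF that] by (simp add: halts_within_def pmf.map_comp comp_def)
  have "halts_within (Seq c1 c2) m (n1 + n2 + 1) (bind_pmf (map_pmf snd D) (\<lambda>m'. map_pmf snd (exec n2 (c2, m'))))"
    by (rule halts_Seq[OF D(3)]) (use E(3) m2 in auto)
  also have "bind_pmf (map_pmf snd D) (\<lambda>m'. map_pmf snd (exec n2 (c2, m'))) = map_pmf snd (bind_pmf D E)"
    unfolding map_bind_pmf bind_map_pmf using m2 by (intro bind_pmf_cong) auto
  finally have h: "halts_within (Seq c1 c2) m (n1 + n2 + 1) (map_pmf snd (bind_pmf D E))" .
  have "map_pmf fst (bind_pmf D E) = bind_pmf D (\<lambda>x. q (fst x))"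
    unfolding map_bind_pmf using E(1) by (intro bind_pmf_cong) auto
  also have "\<dots> = bind_pmf p q" by (simp add: D(1)[symmetric] bind_map_pmf)
  finally show ?thesis unfolding implements_def using h E(2) by fastforce
qed

lemma implements_exec_step:
  assumes "exec_step (c, m) = return_pmf (c', m)" "implements c' m n p R"
  shows "implements c m (Suc n) p R"
proof -
  have "halts_within c m (Suc n) D" if "halts_within c' m n D" for D
    using halts_within_Suc[of c m "\<lambda>_. c'" "\<lambda>_. m" "return_pmf ()" n "\<lambda>_. D"] assms(1) that
    by (simp add: bind_return_pmf)
  then show ?thesis using assms(2) unfolding implements_def by blast
qed

lemma implements_IfLess:
  assumes "val m e1 < val m e2 \<Longrightarrow> implements c1 m n p R" "\<not> val m e1 < val m e2 \<Longrightarrow> implements c2 m n p R"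
  shows "implements (IfLess e1 e2 c1 c2) m (Suc n) p R"
  using assms by (intro implements_exec_step[of _ _ "if val m e1 < val m e2 then c1 else c2"]) auto

lemma implements_WhileLess_done:
  assumes "\<not> val m e1 < val m e2" "R a m"
  shows "implements (WhileLess e1 e2 c) m 1 (return_pmf a) R"
  using implements_exec_step[of "WhileLess e1 e2 c" m Halt, OF _ implements_Halt[of R a m, OF assms(2)]] assms by simp

lemma implements_WhileLess_iterate:
  assumes "val m e1 < val m e2" "implements c m n1 p Q"
    "\<And>a m'. a \<in> set_pmf p \<Longrightarrow> Q a m' \<Longrightarrow> implements (WhileLess e1 e2 c) m' n2 (q a) R"
  shows "implements (WhileLess e1 e2 c) m (n1 + n2 + 2) (bind_pmf p q) R"
  using implements_exec_step[of "WhileLess e1 e2 c" m "Seq c (WhileLess e1 e2 c)", OF _ implements_Seq[OF assms(2,3)]] assms(1)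
  by simp

section \<open>Partially filled tableaux\<close>

declare split_paired_All [simp del] split_paired_Ex [simp del]

definition le_box :: "box \<Rightarrow> box \<Rightarrow> bool" where
  "le_box x y \<longleftrightarrow> fst x \<le> fst y \<and> snd x \<le> snd y"

lemma young_diagram:
  assumes "partition lam"
  shows "young (diagram lam)"
proof -
  have "diagram lam \<subseteq> (SIGMA r:{1..length lam}. {1..lam ! (r - 1)})" by (auto simp: diagram_def)
  then have "finite (diagram lam)" by (rule finite_subset) auto
  moreover have "lam ! (r - 1) \<le> lam ! (r' - 1)" if "1 \<le> r'" "r' \<le> r" "r \<le> length lam" for r r'
    using assms that sorted_wrt_nth_less[of "(\<ge>)" lam "r' - 1" "r - 1"]
    by (cases "r' = r") (auto simp: partition_def)
  ultimately show ?thesis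
    by (auto simp: young_def diagram_def) (meson order_trans)
qed

lemma diagram_ne: "partition lam \<Longrightarrow> lam \<noteq> [] \<Longrightarrow> (1, 1) \<in> diagram lam"
  by (cases lam) (auto simp: partition_def diagram_def Suc_le_eq)

text \<open>One invariant for the given pre-tableau, for all intermediate states and, with
  \<open>M = 0\<close>, for the result. The conditions on neighbouring boxes are stated for all
  comparable boxes, so that later arguments need no paths.\<close>

definition good :: "nat list \<Rightarrow> nat \<Rightarrow> nat \<Rightarrow> filling \<Rightarrow> bool" where
  "good lam N M T \<longleftrightarrow>
     (\<forall>b. b \<notin> diagram lam \<longrightarrow> T b = {}) \<and> (\<forall>b. T b \<subseteq> {M+1..N}) \<and>
     (\<forall>v\<in>{M+1..N}. \<exists>!b. v \<in> T b) \<and>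
     (\<forall>x\<in>diagram lam. \<forall>y\<in>diagram lam. le_box x y \<longrightarrow> T x \<noteq> {} \<longrightarrow> T y \<noteq> {}) \<and>
     (\<forall>x y u v. le_box x y \<longrightarrow> x \<noteq> y \<longrightarrow> u \<in> T x \<longrightarrow> v \<in> T y \<longrightarrow> u < v) \<and>
     card (empty_boxes lam T) \<le> M"

lemma goodD:
  assumes "good lam N M T"
  shows "b \<notin> diagram lam \<Longrightarrow> T b = {}" "v \<in> T b \<Longrightarrow> M < v" "v \<in> T b \<Longrightarrow> v \<le> N"
    "M < w \<Longrightarrow> w \<le> N \<Longrightarrow> \<exists>b. w \<in> T b" "v \<in> T b \<Longrightarrow> v \<in> T b' \<Longrightarrow> b = b'"
    "x \<in> diagram lam \<Longrightarrow> y \<in> diagram lam \<Longrightarrow> le_box x y \<Longrightarrow> T x \<noteq> {} \<Longrightarrow> T y \<noteq> {}"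
    "le_box x y \<Longrightarrow> x \<noteq> y \<Longrightarrow> u \<in> T x \<Longrightarrow> v \<in> T y \<Longrightarrow> u < v"
    "card (empty_boxes lam T) \<le> M"
proof -
  note g = assms[unfolded good_def] and c2 = conjunct2
  have sub: "T b \<subseteq> {M+1..N}" for b using g[THEN c2, THEN conjunct1] by blast
  have un: "\<exists>!b. v \<in> T b" if "v \<in> {M+1..N}" for v
    by (rule bspec[OF g[THEN c2, THEN c2, THEN conjunct1] that])
  have off: "T b = {}" if "b \<notin> diagram lam" for b using g[THEN conjunct1] that by blast
  show r: "v \<in> T b \<Longrightarrow> M < v" "v \<in> T b \<Longrightarrow> v \<le> N" for v b
    using sub[of b] by (auto simp: Suc_le_eq)
  show "b \<notin> diagram lam \<Longrightarrow> T b = {}" by (rule off)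
  show "M < w \<Longrightarrow> w \<le> N \<Longrightarrow> \<exists>b. w \<in> T b" using un[of w] by auto
  show "v \<in> T b \<Longrightarrow> v \<in> T b' \<Longrightarrow> b = b'"
    using un[of v] sub[of b] by blast
  show "x \<in> diagram lam \<Longrightarrow> y \<in> diagram lam \<Longrightarrow> le_box x y \<Longrightarrow> T x \<noteq> {} \<Longrightarrow> T y \<noteq> {}"
    "le_box x y \<Longrightarrow> x \<noteq> y \<Longrightarrow> u \<in> T x \<Longrightarrow> v \<in> T y \<Longrightarrow> u < v"
    "card (empty_boxes lam T) \<le> M"
    using g[THEN c2, THEN c2, THEN c2] by blast+
qed

lemma goodI:
  assumes "\<And>b. b \<notin> diagram lam \<Longrightarrow> T b = {}" "\<And>b. T b \<subseteq> {M+1..N}"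
    "\<And>v. v \<in> {M+1..N} \<Longrightarrow> \<exists>!b. v \<in> T b"
    "\<And>x y. x \<in> diagram lam \<Longrightarrow> y \<in> diagram lam \<Longrightarrow> le_box x y \<Longrightarrow> T x \<noteq> {} \<Longrightarrow> T y \<noteq> {}"
    "\<And>x y u v. le_box x y \<Longrightarrow> x \<noteq> y \<Longrightarrow> u \<in> T x \<Longrightarrow> v \<in> T y \<Longrightarrow> u < v"
    "card (empty_boxes lam T) \<le> M"
  shows "good lam N M T"
  unfolding good_def by (intro conjI ballI allI impI; (rule assms; assumption)?)

lemma good_mem_diagram: "good lam N M T \<Longrightarrow> v \<in> T b \<Longrightarrow> b \<in> diagram lam"
  using goodD(1) by blast

text \<open>The path runs right along the row of \<open>x\<close> and then down the column of
  \<open>y\<close>. It stays in \<open>D\<close> because all its boxes are weakly north-west of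
  \<open>y\<close>.\<close>

lemma young_path_induct:
  assumes D: "young D" and xy: "x \<in> D" "y \<in> D" "le_box x y" and "P x"
    and right: "\<And>r c. (r, c) \<in> D \<Longrightarrow> (r, c + 1) \<in> D \<Longrightarrow> P (r, c) \<Longrightarrow> P (r, c + 1)"
    and down: "\<And>r c. (r, c) \<in> D \<Longrightarrow> (r + 1, c) \<in> D \<Longrightarrow> P (r, c) \<Longrightarrow> P (r + 1, c)"
  shows "P y"
proof -
  obtain r c where x: "x = (r, c)" by force
  obtain r' c' where "y = (r', c')" by force
  then have y: "y = (r + (r' - r), c + (c' - c))" using xy(3) x by (simp add: le_box_def)
  define i j where "i = r' - r" and "j = c' - c"
  note y = y[folded i_def j_def]
  have pos: "1 \<le> r" "1 \<le> c" using young_pos[OF D, of r c] xy x by auto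
  have "(r, c + j) \<in> D" using youngD[OF D, of "r + i" "c + j" r "c + j"] pos xy y by simp
  then have "P (r, c + j)"
  proof (induction j)
    case 0
    then show ?case using \<open>P x\<close> x by simp
  next
    case (Suc j)
    moreover have "(r, c + j) \<in> D" using youngD[OF D Suc.prems, of r "c + j"] pos by simp
    ultimately show ?case using right[of r "c + j"] by simp
  qed
  moreover have "(r + i, c + j) \<in> D" using xy y by simp
  ultimately show ?thesis unfolding y
  proof (induction i)
    case (Suc i)
    moreover have "(r + i, c + j) \<in> D" using youngD[OF D Suc.prems(2), of "r + i" "c + j"] pos by simp
    ultimately show ?case using down[of "r + i" "c + j"] by simp
  qed simp
qed

text \<open>The two conditions on neighbours work together along a path: every box after a nonempty
  one is nonempty, so there is always a value through which the inequality can be chained.\<close>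

lemma pretableau_good:
  assumes lam: "partition lam" and S: "pretableau lam N k S"
  shows "good lam N k S"
proof -
  note D = young_diagram[OF lam]
  note p = S[unfolded pretableau_def] and c2 = conjunct2
  note p2 = p[THEN c2] note p3 = p2[THEN c2] note p4 = p3[THEN c2] note p5 = p4[THEN c2] note p6 = p5[THEN c2]
  have off: "S b = {}" if "b \<notin> diagram lam" for b using p2[THEN conjunct1] that by blast
  have sub: "S b \<subseteq> {k+1..N}" for b
    using p3[THEN conjunct1] off[of b] by (cases "b \<in> diagram lam") (blast, simp)
  have fin: "finite (S b)" for b using sub[of b] finite_subset by blast
  have right: "S (r, c + 1) \<noteq> {}" "Max (S (r, c)) < Min (S (r, c + 1))"
    if "(r, c) \<in> diagram lam" "(r, c + 1) \<in> diagram lam" "S (r, c) \<noteq> {}" for r c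
    using p5[THEN conjunct1] p6[THEN conjunct1] that by blast+
  have down: "S (r + 1, c) \<noteq> {}" "Max (S (r, c)) < Min (S (r + 1, c))"
    if "(r, c) \<in> diagram lam" "(r + 1, c) \<in> diagram lam" "S (r, c) \<noteq> {}" for r c
    using p5[THEN conjunct1] p6[THEN conjunct1] that by blast+
  have mm: "u < v" if "Max (S x) < Min (S y)" "u \<in> S x" "v \<in> S y" for x y u v
    using that fin[of x] fin[of y] Max_ge[of "S x" u] Min_le[of "S y" v] by linarith
  have path: "S y \<noteq> {} \<and> (x \<noteq> y \<longrightarrow> (\<forall>u\<in>S x. \<forall>v\<in>S y. u < v))"
    if "x \<in> diagram lam" "y \<in> diagram lam" "le_box x y" "S x \<noteq> {}" for x y
  proof (rule young_path_induct[OF D that(1-3), of "\<lambda>y. S y \<noteq> {} \<and> (x \<noteq> y \<longrightarrow> (\<forall>u\<in>S x. \<forall>v\<in>S y. u < v))"])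
    fix r c
    assume m: "(r, c) \<in> diagram lam" "(r, c + 1) \<in> diagram lam"
      and p: "S (r, c) \<noteq> {} \<and> (x \<noteq> (r, c) \<longrightarrow> (\<forall>u\<in>S x. \<forall>v\<in>S (r, c). u < v))"
    note R = right[OF m conjunct1[OF p]]
    show "S (r, c + 1) \<noteq> {} \<and> (x \<noteq> (r, c + 1) \<longrightarrow> (\<forall>u\<in>S x. \<forall>v\<in>S (r, c + 1). u < v))"
      using R(1) p mm[OF R(2)] by (metis all_not_in_conv order_less_trans)
  next
    fix r c
    assume m: "(r, c) \<in> diagram lam" "(r + 1, c) \<in> diagram lam"
      and p: "S (r, c) \<noteq> {} \<and> (x \<noteq> (r, c) \<longrightarrow> (\<forall>u\<in>S x. \<forall>v\<in>S (r, c). u < v))"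
    note R = down[OF m conjunct1[OF p]]
    show "S (r + 1, c) \<noteq> {} \<and> (x \<noteq> (r + 1, c) \<longrightarrow> (\<forall>u\<in>S x. \<forall>v\<in>S (r + 1, c). u < v))"
      using R(1) p mm[OF R(2)] by (metis all_not_in_conv order_less_trans)
  qed (use that in simp)
  have mem: "(b \<in> diagram lam \<and> v \<in> S b) \<longleftrightarrow> v \<in> S b" for b v using off by blast
  have "u < v" if "le_box x y" "x \<noteq> y" "u \<in> S x" "v \<in> S y" for x y u v
    using path[of x y] mem that by blast
  moreover have "S y \<noteq> {}" if "x \<in> diagram lam" "y \<in> diagram lam" "le_box x y" "S x \<noteq> {}" for x y
    using path[OF that] by blast
  ultimately show ?thesis
    using goodI[OF off sub bspec[OF p4[THEN conjunct1, unfolded mem]] _ _ p6[THEN conjunct2]] by blast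
qed

lemma good_0_iff_SVT: 
  assumes lam: "partition lam"
  shows "good lam N 0 F \<longleftrightarrow> F \<in> SVT lam N"
proof
  note D = young_diagram[OF lam]
  assume g: "good lam N 0 F"
  note G = goodD[OF g]
  have "empty_boxes lam F = {}"
    using G(8) young_finite[OF D] by (simp add: empty_boxes_def)
  then have ne: "F b \<noteq> {}" if "b \<in> diagram lam" for b using that unfolding empty_boxes_def by blast
  have sub: "F b \<subseteq> {1..N}" for b using G(2)[of _ b] G(3)[of _ b] by (auto simp: Suc_le_eq)
  have "\<exists>!b. b \<in> diagram lam \<and> v \<in> F b" if v: "v \<in> {1..N}" for v
  proof -
    obtain b where "v \<in> F b" using G(4)[of v] v by auto
    then show ?thesis using G(5) good_mem_diagram[OF g] by blast
  qed
  moreover have "f x < f y" if "\<forall>b\<in>diagram lam. f b \<in> F b" "x \<in> diagram lam" "y \<in> diagram lam" "le_box x y" "x \<noteq> y" for f x y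
    using G(7)[OF that(4,5)] that by blast
  ultimately show "F \<in> SVT lam N"
    unfolding SVT_def mem_Collect_eq using ne sub G(1)
    by (intro conjI ballI allI impI) (auto simp: le_box_def intro!: less_imp_le)
next
  note D = young_diagram[OF lam]
  assume F: "F \<in> SVT lam N"
  note p = F[unfolded SVT_def mem_Collect_eq] and c2 = conjunct2
  have off: "F b = {}" if "b \<notin> diagram lam" for b using p[THEN conjunct1] that by blast
  have ne: "F b \<noteq> {}" and sub: "F b \<subseteq> {1..N}" if "b \<in> diagram lam" for b
    using p[THEN c2, THEN conjunct1] that by blast+
  have un: "\<exists>!b. b \<in> diagram lam \<and> v \<in> F b" if "v \<in> {1..N}" for v
    by (rule bspec[OF p[THEN c2, THEN c2, THEN conjunct1] that])
  have un': "b = b'" if "v \<in> F b" "v \<in> F b'" for v b b'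
    using un[of v] sub[of b] off that by blast
  have sel: "(\<forall>r r' c. (r, c) \<in> diagram lam \<longrightarrow> (r', c) \<in> diagram lam \<longrightarrow> r < r' \<longrightarrow> f (r, c) < f (r', c)) \<and>
        (\<forall>r c c'. (r, c) \<in> diagram lam \<longrightarrow> (r, c') \<in> diagram lam \<longrightarrow> c < c' \<longrightarrow> f (r, c) \<le> f (r, c'))"
    if "\<forall>b\<in>diagram lam. f b \<in> F b" for f
    by (rule mp[OF spec[OF p[THEN c2, THEN c2, THEN c2]] that])
  have ord: "u < v" if "le_box x y" "x \<noteq> y" "u \<in> F x" "v \<in> F y" for x y u v
  proof -
    \<comment> \<open>The definition of set-valued tableaux speaks of selections, so take one that
      hits \<open>u\<close> and \<open>v\<close>. Passing through the box in the row of
      \<open>x\<close> and the column of \<open>y\<close>, it gives only \<open>u \<le> v\<close>,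
      as rows increase weakly; strictness comes from the values occurring once.\<close>
    define f where "f = (\<lambda>b. if b = x then u else if b = y then v else SOME w. w \<in> F b)"
    have m: "x \<in> diagram lam" "y \<in> diagram lam" using that off[of x] off[of y] by blast+
    have f: "\<forall>b\<in>diagram lam. f b \<in> F b"
    proof
      fix b assume "b \<in> diagram lam"
      then show "f b \<in> F b" using ne[of b] that by (simp add: f_def some_in_eq)
    qed
    obtain r c r' c' where xy: "x = (r, c)" "y = (r', c')" by force
    have le: "r \<le> r'" "c \<le> c'" using that(1) xy by (auto simp: le_box_def)
    have z: "(r, c') \<in> diagram lam"
      using youngD[OF D, of r' c' r c'] m xy le young_pos[OF D, of r c] young_pos[OF D, of r' c'] by auto
    have "f (r, c) \<le> f (r, c')" using sel[OF f] z m xy le by (cases "c = c'") auto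
    moreover have "f (r, c') \<le> f (r', c')" using sel[OF f] z m xy le by (cases "r = r'") (auto simp: less_imp_le)
    ultimately have "u \<le> v" using that(2) xy by (auto simp: f_def split: if_splits)
    moreover have "u \<noteq> v" using un' that by blast
    ultimately show ?thesis by simp
  qed
  have "empty_boxes lam F = {}" unfolding empty_boxes_def using ne by blast
  then have "card (empty_boxes lam F) \<le> 0" by simp
  moreover have "\<exists>!b. v \<in> F b" if "v \<in> {1..N}" for v using un[OF that] un' by blast
  moreover have "F b \<subseteq> {1..N}" for b using sub[of b] off[of b] by (cases "b \<in> diagram lam") auto
  ultimately show "good lam N 0 F"
    using off ne ord by (intro goodI; simp)
qed

lemma young_empty_boxes:
  assumes lam: "partition lam" and g: "good lam N M T"
  shows "young (empty_boxes lam T)"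
proof -
  note D = young_diagram[OF lam]
  have "(r', c') \<in> empty_boxes lam T" if "(r, c) \<in> empty_boxes lam T" "1 \<le> r'" "r' \<le> r" "1 \<le> c'" "c' \<le> c" for r c r' c'
  proof -
    have "(r, c) \<in> diagram lam" using that by (simp add: empty_boxes_def)
    moreover from this have "(r', c') \<in> diagram lam" using youngD[OF D] that by blast
    ultimately show ?thesis using goodD(6)[OF g, of "(r', c')" "(r, c)"] that by (auto simp: empty_boxes_def le_box_def)
  qed
  moreover have "finite (empty_boxes lam T)" "empty_boxes lam T \<subseteq> {1..} \<times> {1..}"
    using D by (auto simp: young_def empty_boxes_def)
  ultimately show ?thesis unfolding young_def by blast
qed

definition filled :: "nat list \<Rightarrow> filling \<Rightarrow> box set" where
  "filled lam T = {b \<in> diagram lam. T b \<noteq> {}}"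

lemma NW_filled_iff:
  assumes "partition lam"
  shows "b \<in> NW (filled lam T) \<longleftrightarrow> b \<in> filled lam T \<and> (\<forall>x\<in>filled lam T. le_box x b \<longrightarrow> x = b)"
proof -
  note D = young_diagram[OF assms]
  obtain r c where b: "b = (r, c)" by force
  have *: "x \<in> {1..r} \<times> {1..c} \<longleftrightarrow> le_box x b" if "x \<in> filled lam T" for x
    using that young_pos[OF D, of "fst x" "snd x"] b by (cases x) (auto simp: filled_def le_box_def)
  have "b \<in> NW (filled lam T) \<longleftrightarrow> b \<in> filled lam T \<and> {b} = filled lam T \<inter> {1..r} \<times> {1..c}"
    unfolding NW_def b by blast
  also have "filled lam T \<inter> {1..r} \<times> {1..c} = {x \<in> filled lam T. le_box x b}" using * by blast
  also have "b \<in> filled lam T \<and> {b} = {x \<in> filled lam T. le_box x b} \<longleftrightarrow>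
      b \<in> filled lam T \<and> (\<forall>x\<in>filled lam T. le_box x b \<longrightarrow> x = b)"
    unfolding le_box_def by blast
  finally show ?thesis .
qed

text \<open>Filled boxes are closed towards the south-east, so a filled box strictly north-west of
  \<open>(r, c)\<close> would force the upper or the left neighbour to be filled. Minimality thus
  becomes a test of two neighbours, which a program can evaluate.\<close>

lemma NW_iff:
  assumes lam: "partition lam" and T: "good lam N M T" and "1 \<le> r" "1 \<le> c"
  shows "(r, c) \<in> NW (filled lam T) \<longleftrightarrow> (r, c) \<in> diagram lam \<and> (r, c) \<notin> empty_boxes lam T \<and>
    (r = 1 \<or> (r - 1, c) \<in> empty_boxes lam T) \<and> (c = 1 \<or> (r, c - 1) \<in> empty_boxes lam T)"
    (is "?L \<longleftrightarrow> ?R")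
proof
  note D = young_diagram[OF lam]
  have f: "x \<in> filled lam T \<longleftrightarrow> x \<in> diagram lam \<and> x \<notin> empty_boxes lam T" for x
    unfolding filled_def empty_boxes_def by blast
  {
    assume L: ?L
    then have rc: "(r, c) \<in> diagram lam" "(r, c) \<notin> empty_boxes lam T"
      and min: "\<And>x. x \<in> filled lam T \<Longrightarrow> le_box x (r, c) \<Longrightarrow> x = (r, c)"
      by (simp_all add: NW_filled_iff[OF lam] f)
    have "(r - 1, c) \<in> empty_boxes lam T" if "r \<noteq> 1"
    proof -
      have "1 \<le> r - 1" "r - 1 \<noteq> r" using that assms(3,4) by auto
      then show ?thesis using min[of "(r - 1, c)"] youngD[OF D rc(1), of "r - 1" c] assms(3,4) f[of "(r - 1, c)"]
        by (auto simp: le_box_def)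
    qed
    moreover have "(r, c - 1) \<in> empty_boxes lam T" if "c \<noteq> 1"
    proof -
      have "1 \<le> c - 1" "c - 1 \<noteq> c" using that assms(3,4) by auto
      then show ?thesis using min[of "(r, c - 1)"] youngD[OF D rc(1), of r "c - 1"] assms(3,4) f[of "(r, c - 1)"]
        by (auto simp: le_box_def)
    qed
    ultimately show ?R using rc by blast
  next
    assume R: ?R
    have "y = (r, c)" if y: "y \<in> filled lam T" "le_box y (r, c)" for y
    proof (rule ccontr)
      assume ne: "y \<noteq> (r, c)"
      obtain r' c' where y': "y = (r', c')" by force
      have D': "y \<in> diagram lam" "T y \<noteq> {}" using y(1) by (auto simp: filled_def)
      have pos: "1 \<le> r'" "1 \<le> c'" using young_pos[OF D, of r' c'] D' y' by auto
      have "\<not> (z \<in> empty_boxes lam T)" if "le_box y z" for z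
        using goodD(6)[OF T D'(1) _ that D'(2)] by (auto simp: empty_boxes_def)
      then have "\<not> le_box y (r - 1, c) \<or> r = 1" "\<not> le_box y (r, c - 1) \<or> c = 1" using R by blast+
      then show False using y(2) ne y' pos by (auto simp: le_box_def)
    qed
    then show ?L using R by (simp add: NW_filled_iff[OF lam] f)
  }
qed

text \<open>The boxes that may receive the value \<open>M\<close>. The strict inequality reserves a
  later value for each box that is still empty.\<close>

definition adm :: "nat list \<Rightarrow> nat \<Rightarrow> filling \<Rightarrow> box \<Rightarrow> bool" where
  "adm lam M T b \<longleftrightarrow> corner (empty_boxes lam T) b \<or>
     b \<in> NW (filled lam T) \<and> card (empty_boxes lam T) < M"

lemma adm_iff:
  assumes "partition lam"
  shows "adm lam M T b \<longleftrightarrow> b \<in> diagram lam \<and>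
    (T b = {} \<and> corner (empty_boxes lam T) b \<or>
     T b \<noteq> {} \<and> (\<forall>x\<in>diagram lam. T x \<noteq> {} \<longrightarrow> le_box x b \<longrightarrow> x = b) \<and> card (empty_boxes lam T) < M)"
proof -
  have "b \<in> NW (filled lam T) \<longleftrightarrow> b \<in> diagram lam \<and> T b \<noteq> {} \<and> (\<forall>x\<in>diagram lam. T x \<noteq> {} \<longrightarrow> le_box x b \<longrightarrow> x = b)"
    unfolding NW_filled_iff[OF assms] by (simp add: filled_def) blast
  moreover have "corner (empty_boxes lam T) b \<Longrightarrow> b \<in> diagram lam \<and> T b = {}"
    by (simp add: corner_def empty_boxes_def)
  ultimately show ?thesis unfolding adm_def by blast
qed

definition put :: "nat \<Rightarrow> filling \<Rightarrow> box \<Rightarrow> filling" where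
  "put v T b = T(b := insert v (T b))"

lemma empty_boxes_put: "empty_boxes lam (put v T b) = empty_boxes lam T - {b}"
  by (auto simp: empty_boxes_def put_def)

lemma young_corner_up:
  assumes "young E" "corner E b" "y \<in> E" "le_box b y"
  shows "y = b"
proof -
  obtain r c r' c' where bv: "b = (r, c)" "y = (r', c')" by force
  have pos: "1 \<le> r" "1 \<le> c" "r \<le> r'" "c \<le> c'"
    using young_pos[OF assms(1), of r c] assms bv by (auto simp: corner_def le_box_def)
  have "(r', c) \<in> E" "(r, c') \<in> E" using assms(1,3) youngD[OF assms(1), of r' c'] bv pos by auto
  then show ?thesis using assms(2) bv pos by (auto simp: corner_def hook_def)
qed

text \<open>The new value is the smallest so far, so only filled boxes north-west of
  \<open>b\<close> could violate the order. Admissibility excludes them, and it also ensures that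
  all other boxes south-east of \<open>b\<close> are filled already.\<close>

lemma good_put:
  assumes lam: "partition lam" and g: "good lam N (Suc M) T" and M: "Suc M \<le> N" and b: "adm lam (Suc M) T b"
  shows "good lam N M (put (Suc M) T b)"
proof -
  let ?E = "empty_boxes lam T"
  note G = goodD[OF g]
  note E = young_empty_boxes[OF lam g]
  note b = b[unfolded adm_iff[OF lam]]
  have bD: "b \<in> diagram lam" using b by blast
  have below: "T x = {}" if "le_box x b" "x \<noteq> b" for x
  proof (rule ccontr)
    assume n: "T x \<noteq> {}"
    then have x: "x \<in> diagram lam" using G(1) by blast
    show False using b G(6)[OF x bD that(1) n] n x that by blast
  qed
  have above: "T y \<noteq> {}" if "y \<in> diagram lam" "le_box b y" "y \<noteq> b" for y
  proof
    assume "T y = {}"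
    then have "y \<in> ?E" using that by (simp add: empty_boxes_def)
    then show False using b young_corner_up[OF E, of b y] that G(6)[OF bD that(1,2)] \<open>T y = {}\<close> by blast
  qed
  have "card (?E - {b}) \<le> M"
  proof (cases "b \<in> ?E")
    case True
    then show ?thesis using G(8) young_finite[OF E] by simp
  next
    case False
    then show ?thesis using b bD by (auto simp: empty_boxes_def)
  qed
  moreover have "\<exists>!x. v \<in> put (Suc M) T b x" if "v \<in> {M+1..N}" for v
  proof (cases "v = Suc M")
    case True
    then show ?thesis using G(2)[of "Suc M"] by (intro ex1I[of _ b]) (auto simp: put_def split: if_splits)
  next
    case False
    then have "Suc M < v" "v \<le> N" using that by auto
    then obtain x where "v \<in> T x" using G(4)[of v] by blast
    then show ?thesis using False G(5) by (intro ex1I[of _ x]) (auto simp: put_def split: if_splits)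
  qed
  moreover have "put (Suc M) T b x \<subseteq> {M+1..N}" for x
  proof
    fix w assume "w \<in> put (Suc M) T b x"
    then have "w = Suc M \<or> w \<in> T x" by (auto simp: put_def split: if_splits)
    then show "w \<in> {M+1..N}" using G(2)[of w x] G(3)[of w x] M by auto
  qed
  moreover have "u < v" if "le_box x y" "x \<noteq> y" "u \<in> put (Suc M) T b x" "v \<in> put (Suc M) T b y" for x y u v
    using that G(7)[OF that(1,2), of u v] below[of x] G(2)[of v y] by (auto simp: put_def split: if_splits)
  moreover have "put (Suc M) T b y \<noteq> {}" if "x \<in> diagram lam" "y \<in> diagram lam" "le_box x y" "put (Suc M) T b x \<noteq> {}" for x y
    using G(6)[OF that(1-3)] above[OF that(2)] that(3,4) by (auto simp: put_def split: if_splits)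
  moreover have "put (Suc M) T b x = {}" if "x \<notin> diagram lam" for x
    using that G(1) bD by (auto simp: put_def)
  ultimately show ?thesis by (intro goodI; simp add: empty_boxes_put)
qed

section \<open>Truncations and completions of a tableau\<close>

definition trunc :: "filling \<Rightarrow> nat \<Rightarrow> filling" where
  "trunc F j = (\<lambda>b. F b \<inter> {j<..})"

definition Om :: "nat list \<Rightarrow> nat \<Rightarrow> filling \<Rightarrow> filling set" where
  "Om lam N T = {F. good lam N 0 F \<and> (\<forall>b. T b \<subseteq> F b)}"

lemma SVT_ext_eq_Om:
  assumes "partition lam" "good lam N M T"
  shows "SVT_ext lam N T = Om lam N T"
  using goodD(1)[OF assms(2)] by (auto simp: SVT_ext_def Om_def good_0_iff_SVT[OF assms(1)])

lemma trunc_eq: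
  assumes g: "good lam N M T" and F: "F \<in> Om lam N T"
  shows "trunc F M = T"
proof (intro ext set_eqI iffI)
  have F': "good lam N 0 F" using F by (simp add: Om_def)
  fix b v
  show "v \<in> T b \<Longrightarrow> v \<in> trunc F M b" using F goodD(2)[OF g] by (auto simp: Om_def trunc_def)
  assume "v \<in> trunc F M b"
  then have v: "v \<in> F b" "M < v" by (auto simp: trunc_def)
  then obtain b' where b': "v \<in> T b'" using goodD(4)[OF g] goodD(3)[OF F'] by blast
  then have "v \<in> F b'" using F by (auto simp: Om_def)
  then show "v \<in> T b" using goodD(5)[OF F' v(1)] b' by blast
qed

definition box_of :: "filling \<Rightarrow> nat \<Rightarrow> box" where
  "box_of F v = (THE b. v \<in> F b)"

lemma box_of_eq: "good lam N M F \<Longrightarrow> v \<in> F b \<Longrightarrow> box_of F v = b"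
  unfolding box_of_def using goodD(5) by blast

lemma mem_box_of: "good lam N M F \<Longrightarrow> M < v \<Longrightarrow> v \<le> N \<Longrightarrow> v \<in> F (box_of F v)"
  using goodD(4)[of lam N M F v] box_of_eq by metis

lemma good_0_ne:
  assumes "partition lam" "good lam N 0 F" "b \<in> diagram lam"
  shows "F b \<noteq> {}"
proof -
  have "finite (empty_boxes lam F)" using young_finite[OF young_empty_boxes[OF assms(1,2)]] .
  then have "empty_boxes lam F = {}" using goodD(8)[OF assms(2)] by simp
  then show ?thesis using assms(3) by (auto simp: empty_boxes_def)
qed

text \<open>A run of the algorithm can follow any given completion: placing each value where
  \<open>F\<close> has it is always admissible. With \<open>set_gen\<close> this shows that exactly
  the completions are reached.\<close>

lemma next_box:
  assumes lam: "partition lam" and g: "good lam N (Suc M) T" and M: "Suc M \<le> N" and F: "F \<in> Om lam N T"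
  shows "adm lam (Suc M) T (box_of F (Suc M))" "F \<in> Om lam N (put (Suc M) T (box_of F (Suc M)))"
proof -
  let ?E = "empty_boxes lam T"
  have gF: "good lam N 0 F" and TF: "T b \<subseteq> F b" for b using F by (auto simp: Om_def)
  note G = goodD[OF g] and GF = goodD[OF gF] and E = young_empty_boxes[OF lam g]
  define b where "b = box_of F (Suc M)"
  have bF: "Suc M \<in> F b" unfolding b_def using mem_box_of[OF gF, of "Suc M"] M by simp
  then have bD: "b \<in> diagram lam" using good_mem_diagram[OF gF] by blast
  have T: "T x = F x \<inter> {Suc M<..}" for x using trunc_eq[OF g F] by (auto simp: trunc_def fun_eq_iff)
  show "F \<in> Om lam N (put (Suc M) T (box_of F (Suc M)))"
    using F bF by (auto simp: Om_def put_def b_def)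
  have "adm lam (Suc M) T b"
  proof (cases "T b = {}")
    case True
    have "hook ?E b = {}"
    proof (rule ccontr)
      assume "hook ?E b \<noteq> {}"
      then obtain z where zh: "z \<in> hook ?E b" by blast
      then have z: "z \<in> ?E" "le_box b z" "z \<noteq> b" by (auto simp: hook_def le_box_def)
      then have "F z \<noteq> {}" using good_0_ne[OF lam gF] by (simp add: empty_boxes_def)
      then obtain v where "v \<in> F z" by blast
      then have "v \<in> T z" using GF(7)[OF z(2) z(3)[symmetric] bF] T by auto
      then show False using z by (simp add: empty_boxes_def)
    qed
    then show ?thesis unfolding adm_iff[OF lam] using True bD by (simp add: corner_def empty_boxes_def)
  next
    case False
    have "x = b" if "x \<in> diagram lam" "T x \<noteq> {}" "le_box x b" for x
    proof (rule ccontr)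
      assume n: "x \<noteq> b"
      obtain u where u: "u \<in> T x" using \<open>T x \<noteq> {}\<close> by blast
      then have "u < Suc M" using GF(7)[OF that(3) n] TF bF by blast
      then show False using G(2)[OF u] by simp
    qed
    moreover have "card ?E < Suc M"
    proof -
      \<comment> \<open>Every empty box will receive a value of its own, and this value is at most
        \<open>M\<close>, because \<open>Suc M\<close> goes to \<open>b\<close>, which is not
        empty.\<close>
      let ?f = "\<lambda>e. SOME v. v \<in> F e"
      have f: "?f e \<in> F e" if "e \<in> ?E" for e
        using good_0_ne[OF lam gF, of e] that by (auto simp: empty_boxes_def some_in_eq)
      have "F e \<subseteq> {1..M}" if "e \<in> ?E" for e
      proof
        fix v assume v: "v \<in> F e"
        have "T e = {}" using that by (simp add: empty_boxes_def)
        then have "v \<le> Suc M" using v T[of e] by auto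
        moreover have "v \<noteq> Suc M" using GF(5)[OF bF, of e] v False \<open>T e = {}\<close> by auto
        ultimately show "v \<in> {1..M}" using GF(2)[OF v] by auto
      qed
      then have "?f ` ?E \<subseteq> {1..M}" using f by blast
      moreover have "inj_on ?f ?E"
      proof (rule inj_onI)
        fix e e' assume "e \<in> ?E" "e' \<in> ?E" "?f e = ?f e'"
        then show "e = e'" using GF(5)[of "?f e" e e'] f[of e] f[of e'] by simp
      qed
      ultimately have "card ?E \<le> card {1..M}" by (intro card_inj_on_le[of ?f]) auto
      then show ?thesis by simp
    qed
    ultimately show ?thesis unfolding adm_iff[OF lam] using False bD by blast
  qed
  then show "adm lam (Suc M) T (box_of F (Suc M))" by (simp add: b_def)
qed

section \<open>The law of the generation algorithm\<close>

text \<open>\<open>gen\<close> is the generation algorithm with its two phases merged: at \<open>M = N\<close> all boxes are empty and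
  the box is found by the hook walk.\<close>

definition choice :: "nat list \<Rightarrow> nat \<Rightarrow> nat \<Rightarrow> filling \<Rightarrow> box pmf" where
  "choice lam N M T =
     (if M = N then Hook (empty_boxes lam T)
      else bind_pmf (bernoulli_pmf ((real M - real (card (empty_boxes lam T))) / real M)) (\<lambda>add.
        if add then pmf_of_set (NW (filled lam T)) else Hook (empty_boxes lam T)))"

primrec gen :: "nat list \<Rightarrow> nat \<Rightarrow> nat \<Rightarrow> filling \<Rightarrow> filling pmf" where
  "gen lam N 0 T = return_pmf T"
| "gen lam N (Suc M) T = bind_pmf (choice lam N (Suc M) T) (\<lambda>b. gen lam N M (put (Suc M) T b))"

text \<open>\<open>trunc F j\<close> is the state of the algorithm just before it places
  \<open>j\<close>. Thus the result alone tells whether \<open>j\<close> opened a box and, if not,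
  among how many corners its box was chosen.\<close>

definition fac :: "nat list \<Rightarrow> filling \<Rightarrow> nat \<Rightarrow> nat" where
  "fac lam F j = (if trunc F j (box_of F j) = {} then 1 else card (NW (filled lam (trunc F j))))"

definition wt :: "nat list \<Rightarrow> filling \<Rightarrow> nat \<Rightarrow> nat" where
  "wt lam F M = (\<Prod>j\<in>{1..M}. fac lam F j)"

lemma wt_Suc: "wt lam F (Suc M) = fac lam F (Suc M) * wt lam F M"
  by (simp add: wt_def atLeastAtMostSuc_conv)

lemma fac_corner: "T = trunc F (Suc M) \<Longrightarrow> T (box_of F (Suc M)) = {} \<Longrightarrow> fac lam F (Suc M) = 1"
  by (simp add: fac_def)

lemma fac_NW: "T = trunc F (Suc M) \<Longrightarrow> T (box_of F (Suc M)) \<noteq> {} \<Longrightarrow> fac lam F (Suc M) = card (NW (filled lam T))"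
  by (simp add: fac_def)

text \<open>The number of possible sets of times at which \<open>n\<close> boxes are opened; time \<open>N\<close> is not random.\<close>

definition zden :: "nat \<Rightarrow> nat \<Rightarrow> nat \<Rightarrow> nat" where
  "zden N M n = (if M = N then (M - 1) choose (n - 1) else M choose n)"

lemma young_bound:
  assumes "young E" "(r, c) \<in> E"
  shows "r \<le> card E \<and> c \<le> card E"
proof -
  have "{1..r} \<times> {c} \<subseteq> E" "{r} \<times> {1..c} \<subseteq> E"
    using youngD[OF assms] young_pos[OF assms] by auto
  then have "card ({1..r} \<times> {c}) \<le> card E" "card ({r} \<times> {1..c}) \<le> card E"
    using young_finite[OF assms(1)] by (blast intro: card_mono)+
  then show ?thesis by simp
qed

text \<open>The arithmetic of the induction step of \<open>pmf_gen\<close>: \<open>a / b\<close> is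
  the probability of the kind of move, \<open>x\<close> and \<open>y\<close> are the binomials
  before and after it, and \<open>Y\<close> and \<open>Y'\<close> the dimensions of the empty
  regions.\<close>

lemma ratio_aux:
  fixes a b :: real
  assumes "a * x = b * y" "b \<noteq> 0" "x \<noteq> 0" "y \<noteq> 0" "Y \<noteq> 0" "Y' \<noteq> 0"
  shows "a / b * Y' / Y * (1 / (Y' * y * w)) = 1 / (Y * x * w)"
proof -
  have "a / b = y / x" using assms by (simp add: field_simps)
  then show ?thesis using assms by simp
qed

lemma pmf_bind_single:
  assumes "\<And>b. b \<in> set_pmf p \<Longrightarrow> b \<noteq> b0 \<Longrightarrow> x \<notin> set_pmf (f b)"
  shows "pmf (bind_pmf p f) x = pmf p b0 * pmf (f b0) x"
proof -
  have "pmf (bind_pmf p f) x = measure_pmf.expectation p (\<lambda>b. pmf (f b) x)" by (simp add: pmf_bind)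
  also have "\<dots> = measure_pmf.expectation p (\<lambda>b. pmf (f b0) x * indicator {b0} b)"
    using assms by (intro integral_cong_AE) (auto simp: AE_measure_pmf_iff set_pmf_iff indicator_def)
  also have "\<dots> = pmf p b0 * pmf (f b0) x" by (simp add: measure_pmf_single)
  finally show ?thesis .
qed

lemma pmf_bernoulli_bind:
  assumes "0 \<le> p" "p \<le> 1"
  shows "pmf (bind_pmf (bernoulli_pmf p) f) x = p * pmf (f True) x + (1 - p) * pmf (f False) x"
  using assms by (simp add: pmf_bind)

lemma set_pmf_bernoulli_iff:
  assumes "0 \<le> p" "p \<le> 1"
  shows "True \<in> set_pmf (bernoulli_pmf p) \<longleftrightarrow> 0 < p" "False \<in> set_pmf (bernoulli_pmf p) \<longleftrightarrow> p < 1"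
  using assms by (auto simp: set_pmf_iff)

context
  fixes lam :: "nat list" and N :: nat
  assumes lam: "partition lam" and lam_ne: "lam \<noteq> []"
begin

lemma finite_empty_boxes: "finite (empty_boxes lam T)"
  using young_finite[OF young_diagram[OF lam]] by (simp add: empty_boxes_def)

lemma finite_NW: "finite (NW (filled lam T))"
  by (rule finite_subset[of _ "diagram lam"])
    (auto simp: NW_def filled_def young_finite[OF young_diagram[OF lam]])

lemma NW_ne: "filled lam T \<noteq> {} \<Longrightarrow> NW (filled lam T) \<noteq> {}"
proof -
  let ?m = "\<lambda>x :: box. fst x + snd x"
  assume "filled lam T \<noteq> {}"
  then obtain b where b: "b \<in> filled lam T" "\<And>x. x \<in> filled lam T \<Longrightarrow> ?m b \<le> ?m x"
    using ex_has_least_nat[of "\<lambda>x. x \<in> filled lam T" _ ?m] by blast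
  have "x = b" if "x \<in> filled lam T" "le_box x b" for x
    using b(2)[OF that(1)] that(2) by (auto simp: le_box_def prod_eq_iff)
  then have "b \<in> NW (filled lam T)" using b(1) by (simp add: NW_filled_iff[OF lam])
  then show ?thesis by blast
qed

text \<open>If a corner lies in row \<open>r\<close>, the \<open>r - 1\<close> boxes above it are
  empty, and likewise for the boxes to its left; but at most \<open>M\<close> boxes are
  empty.\<close>

lemma NW_subset:
  assumes g: "good lam N M T"
  shows "NW (filled lam T) \<subseteq> {1..Suc M} \<times> {1..Suc M}"
proof
  fix b assume b: "b \<in> NW (filled lam T)"
  obtain r c where rc: "b = (r, c)" by force
  note E = young_empty_boxes[OF lam g]
  have "(r, c) \<in> diagram lam" using b unfolding rc NW_filled_iff[OF lam] by (simp add: filled_def)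
  then have pos: "1 \<le> r" "1 \<le> c" using young_pos[OF young_diagram[OF lam], of r c] by auto
  show "b \<in> {1..Suc M} \<times> {1..Suc M}"
    using b pos young_bound[OF E, of "r - 1" c] young_bound[OF E, of r "c - 1"] goodD(8)[OF g]
    unfolding rc NW_iff[OF lam g pos] by auto
qed

lemma card_NW_bound:
  assumes "good lam N M T"
  shows "card (NW (filled lam T)) \<le> (Suc M)\<^sup>2"
  using card_mono[OF _ NW_subset[OF assms]] by (simp add: power2_eq_square)

lemma filled_ne: "good lam N M T \<Longrightarrow> M < N \<Longrightarrow> filled lam T \<noteq> {}"
proof -
  assume g: "good lam N M T" "M < N"
  obtain b where "N \<in> T b" using goodD(4)[OF g(1) g(2)] by auto
  then show ?thesis using good_mem_diagram[OF g(1), of N b] unfolding filled_def by blast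
qed

lemma good_top: "good lam N N T \<Longrightarrow> T b = {}"
  using goodD(2)[of lam N N T _ b] goodD(3)[of lam N N T _ b] by fastforce

lemma empty_boxes_top: "good lam N N T \<Longrightarrow> empty_boxes lam T = diagram lam"
  unfolding empty_boxes_def using good_top by blast

lemma set_choice:
  assumes g: "good lam N (Suc M) T" and M: "Suc M \<le> N" and b: "b \<in> set_pmf (choice lam N (Suc M) T)"
  shows "adm lam (Suc M) T b"
proof (cases "Suc M = N")
  case True
  then have "empty_boxes lam T \<noteq> {}" using g empty_boxes_top diagram_ne[OF lam lam_ne] by auto
  then show ?thesis using True b set_pmf_Hook[OF finite_empty_boxes] by (simp add: choice_def adm_def)
next
  case False
  let ?n = "card (empty_boxes lam T)" and ?p = "(real (Suc M) - real (card (empty_boxes lam T))) / real (Suc M)"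
  have n: "?n \<le> Suc M" using goodD(8)[OF g] .
  then have p: "0 \<le> ?p" "?p \<le> 1" by (auto simp: field_simps)
  obtain add where add: "add \<in> set_pmf (bernoulli_pmf ?p)"
    "b \<in> set_pmf (if add then pmf_of_set (NW (filled lam T)) else Hook (empty_boxes lam T))"
    using b False by (auto simp: choice_def simp del: set_pmf_bernoulli)
  show ?thesis
  proof (cases add)
    case True
    then have "?n < Suc M" using add set_pmf_bernoulli_iff(1)[OF p] n by (auto simp: field_simps)
    then show ?thesis
      using add True finite_NW NW_ne[OF filled_ne[OF g]] M False by (auto simp: adm_def)
  next
    case False
    then have "empty_boxes lam T \<noteq> {}" using add set_pmf_bernoulli_iff(2)[OF p] by auto
    then show ?thesis using False add set_pmf_Hook[OF finite_empty_boxes] by (simp add: adm_def)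
  qed
qed

lemma set_gen:
  "good lam N M T \<Longrightarrow> M \<le> N \<Longrightarrow> F \<in> set_pmf (gen lam N M T) \<Longrightarrow> F \<in> Om lam N T"
proof (induction M arbitrary: T)
  case (Suc M)
  then obtain b where b: "b \<in> set_pmf (choice lam N (Suc M) T)" "F \<in> set_pmf (gen lam N M (put (Suc M) T b))"
    by auto
  have "F \<in> Om lam N (put (Suc M) T b)"
    using Suc b good_put[OF lam Suc.prems(1,2) set_choice[OF Suc.prems(1,2) b(1)]] by simp
  then show ?case by (auto simp: Om_def put_def split: if_splits)
qed (simp add: Om_def)

text \<open>Overwriting by \<open>{M}\<close> is the same as inserting, because the hook walk
  returns an empty box. This presupposes that there is one, so the argument keeps track of which
  outcomes of the Bernoulli trial are possible.\<close>

lemma svgen_step_eq: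
  assumes g: "good lam N (Suc M) T" and M: "Suc M < N"
  shows "svgen_step lam (Suc M) T = map_pmf (put (Suc M) T) (choice lam N (Suc M) T)"
proof -
  let ?n = "card (empty_boxes lam T)" and ?p = "(real (Suc M) - real (card (empty_boxes lam T))) / real (Suc M)"
  have n: "?n \<le> Suc M" using goodD(8)[OF g] .
  then have p: "0 \<le> ?p" "?p \<le> 1" by (auto simp: field_simps)
  have "map_pmf (\<lambda>b. T(b := {Suc M})) (Hook (empty_boxes lam T)) = map_pmf (put (Suc M) T) (Hook (empty_boxes lam T))"
    if "False \<in> set_pmf (bernoulli_pmf ?p)"
  proof (rule map_pmf_cong[OF refl])
    fix b assume b: "b \<in> set_pmf (Hook (empty_boxes lam T))"
    have "empty_boxes lam T \<noteq> {}" using that set_pmf_bernoulli_iff(2)[OF p] by auto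
    then have "T b = {}" using set_pmf_Hook[OF finite_empty_boxes _ b] by (simp add: corner_def empty_boxes_def)
    then show "T(b := {Suc M}) = put (Suc M) T b" by (simp add: put_def)
  qed
  then show ?thesis
    using M unfolding svgen_step_def choice_def Let_def
    by (auto simp: map_bind_pmf filled_def put_def[abs_def] simp del: set_pmf_bernoulli intro!: bind_pmf_cong)
qed

lemma svgen_loop_eq_gen: "good lam N M T \<Longrightarrow> M < N \<Longrightarrow> svgen_loop lam M T = gen lam N M T"
proof (induction M arbitrary: T)
  case (Suc M)
  have "svgen_loop lam M (put (Suc M) T b) = gen lam N M (put (Suc M) T b)"
    if "b \<in> set_pmf (choice lam N (Suc M) T)" for b
    using Suc good_put[OF lam Suc.prems(1) _ set_choice[OF Suc.prems(1) _ that]] by simp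
  then show ?case
    using svgen_step_eq[OF Suc.prems] by (auto simp: bind_map_pmf intro!: bind_pmf_cong)
qed simp

lemma SVGen_eq_gen:
  assumes g: "good lam N k S" and k: "k \<le> N" and N: "card (diagram lam) \<le> N"
  shows "SVGen lam N k S = gen lam N k S"
proof (cases "k = N")
  case True
  have "finite (diagram lam)" "diagram lam \<noteq> {}"
    using young_finite[OF young_diagram[OF lam]] diagram_ne[OF lam lam_ne] by auto
  then have "0 < card (diagram lam)" by (simp add: card_gt_0_iff)
  then obtain M where M: "N = Suc M" using N by (cases N) auto
  have g': "good lam N (Suc M) S" using g True M by simp
  have "svgen_loop lam M (S(b := {N})) = gen lam N M (put (Suc M) S b)"
    if "b \<in> set_pmf (choice lam N (Suc M) S)" for b
    using svgen_loop_eq_gen[OF good_put[OF lam g' _ set_choice[OF g' _ that]]] M good_top[of S b] g True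
    by (simp add: put_def)
  then show ?thesis
    using True M empty_boxes_top[of S] g by (auto simp: SVGen_def choice_def intro!: bind_pmf_cong)
qed (use svgen_loop_eq_gen[OF g] k in \<open>simp add: SVGen_def\<close>)

lemma pmf_choice:
  assumes g: "good lam N (Suc M) T" and M: "Suc M \<le> N" and b: "adm lam (Suc M) T b"
  shows "pmf (choice lam N (Suc M) T) b = (if T b = {} 
     then (if Suc M = N then 1 else real (card (empty_boxes lam T)) / Suc M) * ydim (empty_boxes lam T - {b}) / ydim (empty_boxes lam T)
     else (real (Suc M) - card (empty_boxes lam T)) / Suc M / card (NW (filled lam T)))"
proof -
  let ?E = "empty_boxes lam T"
  let ?n = "card ?E" and ?p = "(real (Suc M) - real (card ?E)) / real (Suc M)"
  have n: "?n \<le> Suc M" using goodD(8)[OF g] .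
  then have p: "0 \<le> ?p" "?p \<le> 1" by (auto simp: field_simps)
  note E = young_empty_boxes[OF lam g]
  have c: "pmf (choice lam N (Suc M) T) b =
      ?p * pmf (pmf_of_set (NW (filled lam T))) b + (1 - ?p) * pmf (Hook ?E) b" if "Suc M \<noteq> N"
    using that pmf_bernoulli_bind[OF p, of _ b] by (simp add: choice_def)
  have NW: "pmf (pmf_of_set (NW (filled lam T))) b = indicator (NW (filled lam T)) b / card (NW (filled lam T))" if "Suc M < N"
    using that finite_NW NW_ne[OF filled_ne[OF g]] by simp
  show ?thesis
  proof (cases "T b = {}")
    case True
    then have co: "corner ?E b" and nb: "b \<notin> NW (filled lam T)"
      using b by (simp_all add: adm_iff[OF lam] NW_filled_iff[OF lam]) (simp add: filled_def)
    note H = pmf_Hook[OF E co]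
    show ?thesis
    proof (cases "Suc M = N")
      case True
      then show ?thesis using \<open>T b = {}\<close> H by (simp add: choice_def)
    next
      case False
      have "1 - ?p = real ?n / Suc M" by (simp add: field_simps)
      then show ?thesis using \<open>T b = {}\<close> False c NW nb M H by simp
    qed
  next
    case False
    then have nb: "b \<in> NW (filled lam T)" and nc: "\<not> corner ?E b"
      using b by (auto simp: adm_def corner_def empty_boxes_def)
    have "Suc M \<noteq> N" using False good_top g by metis
    moreover have "(1 - ?p) * pmf (Hook ?E) b = 0"
    proof (cases "?E = {}")
      case False
      then have "b \<notin> set_pmf (Hook ?E)" using nc set_pmf_Hook[OF finite_empty_boxes] by blast
      then show ?thesis by (simp add: set_pmf_iff)
    qed simp
    ultimately show ?thesis using False c NW M nb by simp
  qed
qed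

lemma Om_base: "good lam N 0 T \<Longrightarrow> F \<in> Om lam N T \<Longrightarrow> F = T"
  using trunc_eq[of lam N 0 T F] goodD(2)[of lam N 0 F] unfolding Om_def trunc_def fun_eq_iff by blast

lemma adm_card_pos:
  assumes "adm lam M T b" "T b = {}"
  shows "0 < card (empty_boxes lam T)" "card (empty_boxes lam T - {b}) = card (empty_boxes lam T) - 1"
  using assms finite_empty_boxes by (auto simp: adm_iff[OF lam] corner_def card_gt_0_iff)

text \<open>The box of every value is prescribed by \<open>F\<close>, so a single run leads to
  \<open>F\<close> and its probabilities multiply. With \<open>n\<close> empty boxes, opening one
  has probability \<open>n / M\<close> times a ratio of dimensions, and adding has probability
  \<open>(M - n) / M\<close> divided by the number of corners. By the absorption identities both
  fractions are quotients of consecutive binomials, hence everything but the corner counts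
  telescopes. The forced opening at \<open>M = N\<close> is absorbed by the special value of
  \<open>zden\<close>.\<close>

theorem pmf_gen:
  "good lam N M T \<Longrightarrow> M \<le> N \<Longrightarrow> F \<in> Om lam N T \<Longrightarrow>
   pmf (gen lam N M T) F =
     1 / (ydim (empty_boxes lam T) * zden N M (card (empty_boxes lam T)) * wt lam F M)"
proof (induction M arbitrary: T)
  case 0
  have "empty_boxes lam T = {}" using goodD(8)[OF 0(1)] finite_empty_boxes by simp
  then show ?case using Om_base[OF 0(1,3)] by (simp add: ydim_empty zden_def wt_def)
next
  case (Suc M)
  let ?b = "box_of F (Suc M)" and ?E = "empty_boxes lam T"
  let ?T = "put (Suc M) T ?b"
  let ?n = "card ?E"
  note g = Suc.prems(1)
  have gF: "good lam N 0 F" using Suc.prems(3) by (simp add: Om_def)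
  note nb = next_box[OF lam Suc.prems]
  have "F \<notin> set_pmf (gen lam N M (put (Suc M) T b))" if b: "b \<in> set_pmf (choice lam N (Suc M) T)" "b \<noteq> ?b" for b
  proof
    assume "F \<in> set_pmf (gen lam N M (put (Suc M) T b))"
    then have "F \<in> Om lam N (put (Suc M) T b)"
      using set_gen[OF good_put[OF lam Suc.prems(1,2) set_choice[OF Suc.prems(1,2) b(1)]]] Suc.prems(2) by simp
    then have "Suc M \<in> F b" by (auto simp: Om_def put_def split: if_splits)
    then show False using box_of_eq[OF gF] b(2) by simp
  qed
  then have "pmf (gen lam N (Suc M) T) F = pmf (choice lam N (Suc M) T) ?b * pmf (gen lam N M ?T) F"
    unfolding gen.simps by (rule pmf_bind_single)
  also have "pmf (gen lam N M ?T) F = 1 / (ydim (?E - {?b}) * zden N M (card (?E - {?b})) * wt lam F M)"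
    using Suc.IH[OF good_put[OF lam Suc.prems(1,2) nb(1)] _ nb(2)] Suc.prems(2) by (simp add: empty_boxes_put)
  also have "pmf (choice lam N (Suc M) T) ?b * \<dots> = 1 / (ydim ?E * zden N (Suc M) ?n * wt lam F (Suc M))"
  proof (cases "T ?b = {}")
    case True
    note n = adm_card_pos[OF nb(1) True]
    obtain n' where n': "?n = Suc n'" using n(1) by (cases ?n) auto
    have f: "fac lam F (Suc M) = 1" using fac_corner[OF trunc_eq[OF g Suc.prems(3), symmetric] True] .
    have "real (Suc n') * real (Suc M choose Suc n') = real (Suc M) * real (M choose n')"
      using Suc_times_binomial_eq[of M n'] by (metis mult.commute of_nat_mult)
    moreover have le: "n' \<le> M" using goodD(8)[OF g] n' by simp
    moreover have "real (Suc M choose Suc n') \<noteq> 0"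
      using le zero_less_binomial[of "Suc n'" "Suc M"] by linarith
    ultimately show ?thesis
      using True Suc.prems(2) n n' f ydim_pos[of ?E] ydim_pos[of "?E - {?b}"]
        ratio_aux[of "Suc n'" "Suc M choose Suc n'" "Suc M" "M choose n'" "ydim ?E" "ydim (?E - {?b})" "wt lam F M"]
      by (simp add: pmf_choice[OF Suc.prems(1,2) nb(1)] zden_def wt_Suc del: binomial_Suc_Suc of_nat_Suc) auto
  next
    case False
    have "Suc M \<noteq> N" using False good_top g by metis
    moreover have f: "fac lam F (Suc M) = card (NW (filled lam T))"
      using fac_NW[OF trunc_eq[OF g Suc.prems(3), symmetric] False] .
    moreover have E: "?E - {?b} = ?E" using False by (auto simp: empty_boxes_def)
    moreover have n: "?n \<le> M" using nb(1) False by (auto simp: adm_iff[OF lam])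
    have "(Suc M - ?n) * (Suc M choose ?n) = Suc M * (M choose ?n)"
      using binomial_absorb_comp[of "Suc M" ?n] by simp
    then have "real (Suc M - ?n) * real (Suc M choose ?n) = real (Suc M) * real (M choose ?n)"
      by (metis of_nat_mult)
    then have "(real (Suc M) - real ?n) * real (Suc M choose ?n) = real (Suc M) * real (M choose ?n)"
      using n by (simp add: of_nat_diff)
    moreover have "real (Suc M choose ?n) \<noteq> 0" "real (M choose ?n) \<noteq> 0" using n by auto
    ultimately show ?thesis
      using False Suc.prems(2) ydim_pos[of ?E]
        ratio_aux[of "real (Suc M) - ?n" "Suc M choose ?n" "Suc M" "M choose ?n" "ydim ?E" "ydim ?E"
          "real (card (NW (filled lam T))) * wt lam F M"]
      by (simp add: pmf_choice[OF Suc.prems(1,2) nb(1)] zden_def wt_Suc mult.assoc mult.left_commute[of "real (card (NW _))"]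
          del: binomial_Suc_Suc of_nat_Suc)
  qed
  finally show ?case .
qed

end

section \<open>The Metropolis chain\<close>

lemma pmf_bind_finite:
  assumes "finite A" "set_pmf p \<subseteq> A"
  shows "pmf (bind_pmf p f) x = (\<Sum>a\<in>A. pmf p a * pmf (f a) x)"
  unfolding pmf_bind using assms
  by (subst integral_measure_pmf[of A]) (auto simp: mult.commute)

context
  fixes \<Omega> :: "'s set" and p :: "'s \<Rightarrow> real"
  assumes fin: "finite \<Omega>" and pos: "\<And>x. x \<in> \<Omega> \<Longrightarrow> 0 < p x" and total: "(\<Sum>x\<in>\<Omega>. p x) = 1"
begin

definition metro :: "'s \<Rightarrow> 's \<Rightarrow> real" where
  "metro x y = (if y \<noteq> x then p y * min 1 (p x / p y) else 1 - (\<Sum>z\<in>\<Omega> - {x}. p z * min 1 (p x / p z)))"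

lemma metro_off: "y \<in> \<Omega> \<Longrightarrow> p y * min 1 (p x / p y) = min (p x) (p y)"
  using pos[of y] by (auto simp: min_def field_simps)

lemma metro_rows: "x \<in> \<Omega> \<Longrightarrow> (\<Sum>y\<in>\<Omega>. metro x y) = 1"
  using fin by (subst sum.remove[of _ x]) (auto simp: metro_def intro!: sum.cong)

lemma metro_sym: "x \<in> \<Omega> \<Longrightarrow> y \<in> \<Omega> \<Longrightarrow> metro x y = metro y x"
  by (auto simp: metro_def metro_off min.commute)

text \<open>Off the diagonal the entry is \<open>min (p x) (p y)\<close>. On the diagonal at least
  \<open>p x\<close> is left, as the moves away from \<open>x\<close> have probability at most that
  of proposing another state.\<close>

lemma metro_minor:
  assumes "x \<in> \<Omega>" "y \<in> \<Omega>" "\<And>z. z \<in> \<Omega> \<Longrightarrow> e \<le> p z"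
  shows "e \<le> metro x y"
proof (cases "x = y")
  case True
  have "(\<Sum>z\<in>\<Omega> - {x}. p z * min 1 (p x / p z)) \<le> (\<Sum>z\<in>\<Omega> - {x}. p z)"
    by (intro sum_mono) (auto simp: metro_off)
  also have "\<dots> = 1 - p x" using total fin assms(1) by (simp add: sum_diff1)
  finally show ?thesis using True assms(3)[OF assms(1)] by (simp add: metro_def)
next
  case False
  then show ?thesis using assms by (auto simp: metro_def metro_off)
qed

end

text \<open>The state \<open>None\<close> accepts any proposal.\<close>

definition kernel :: "nat list \<Rightarrow> nat \<Rightarrow> nat \<Rightarrow> filling \<Rightarrow> filling option \<Rightarrow> filling option pmf" where
  "kernel lam N k S x = bind_pmf (gen lam N k S) (\<lambda>F.
     map_pmf (\<lambda>u. if u < wt lam F k then Some F else x)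
       (pmf_of_set {0..<(case x of None \<Rightarrow> 1 | Some T \<Rightarrow> wt lam T k)}))"

primrec chain :: "nat list \<Rightarrow> nat \<Rightarrow> nat \<Rightarrow> filling \<Rightarrow> nat \<Rightarrow> filling option \<Rightarrow> filling option pmf" where
  "chain lam N k S 0 x = return_pmf x"
| "chain lam N k S (Suc t) x = bind_pmf (kernel lam N k S x) (chain lam N k S t)"

lemma chain_add: "chain lam N k S (s + t) x = bind_pmf (chain lam N k S s x) (chain lam N k S t)"
  by (induction s arbitrary: x) (auto simp: bind_return_pmf bind_assoc_pmf intro!: bind_pmf_cong)

section \<open>Weights and numbers of completions\<close>

context
  fixes lam :: "nat list" and N :: nat
  assumes lam: "partition lam" and lam_ne: "lam \<noteq> []"
begin

text \<open>Of the \<open>M\<close> values still to come, one opens each empty box and contributes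
  the factor 1. Only the others count corners, each time at most \<open>(k + 1) ^ 2\<close> of
  them.\<close>

lemma wt_bounds:
  "good lam N M T \<Longrightarrow> M \<le> N \<Longrightarrow> F \<in> Om lam N T \<Longrightarrow> M \<le> k \<Longrightarrow>
    1 \<le> wt lam F M \<and> wt lam F M \<le> ((Suc k)\<^sup>2) ^ (M - card (empty_boxes lam T))"
proof (induction M arbitrary: T)
  case (Suc M)
  let ?b = "box_of F (Suc M)" and ?E = "empty_boxes lam T"
  let ?B = "(Suc k)\<^sup>2"
  note nb = next_box[OF lam Suc.prems(1-3)]
  have IH: "1 \<le> wt lam F M \<and> wt lam F M \<le> ?B ^ (M - card (?E - {?b}))"
    using Suc.IH[OF good_put[OF lam Suc.prems(1,2) nb(1)] _ nb(2)] Suc.prems by (simp add: empty_boxes_put)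
  show ?case
  proof (cases "T ?b = {}")
    case True
    then show ?thesis
      using IH adm_card_pos[OF lam lam_ne nb(1) True] fac_corner[OF trunc_eq[OF Suc.prems(1,3), symmetric] True]
      by (simp add: wt_Suc)
  next
    case False
    have E: "?E - {?b} = ?E" using False by (auto simp: empty_boxes_def)
    have n: "card ?E \<le> M" "?b \<in> NW (filled lam T)"
      using nb(1) False by (auto simp: adm_def corner_def empty_boxes_def)
    have f: "fac lam F (Suc M) = card (NW (filled lam T))"
      using fac_NW[OF trunc_eq[OF Suc.prems(1,3), symmetric] False] .
    have "card (NW (filled lam T)) \<le> (Suc (Suc M))\<^sup>2" by (rule card_NW_bound[OF lam lam_ne Suc.prems(1)])
    also have "\<dots> \<le> ?B" using Suc.prems(4) by (intro power_mono) auto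
    finally have "card (NW (filled lam T)) * wt lam F M \<le> ?B * ?B ^ (M - card ?E)"
      using IH E by (intro mult_le_mono) auto
    moreover have "0 < card (NW (filled lam T))"
      using n(2) finite_NW[OF lam lam_ne] by (auto simp: card_gt_0_iff)
    ultimately show ?thesis using IH n(1) by (simp add: wt_Suc f Suc_diff_le)
  qed
qed (simp add: wt_def)

lemma finite_Om: "finite (Om lam N T)"
proof (rule finite_subset)
  show "Om lam N T \<subseteq> {f. \<forall>b. (b \<in> diagram lam \<longrightarrow> f b \<in> Pow {1..N}) \<and> (b \<notin> diagram lam \<longrightarrow> f b = {})}"
    unfolding Om_def good_def by fastforce
  show "finite {f. \<forall>b. (b \<in> diagram lam \<longrightarrow> f b \<in> Pow {1..N}) \<and> (b \<notin> diagram lam \<longrightarrow> f b = ({} :: nat set))}"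
    using young_finite[OF young_diagram[OF lam]] by (intro finite_set_of_finite_funs) auto
qed

lemma adm_cong: "empty_boxes lam T = empty_boxes lam T' \<Longrightarrow> filled lam T = filled lam T' \<and> adm lam M T b = adm lam M T' b"
proof -
  assume e: "empty_boxes lam T = empty_boxes lam T'"
  have "filled lam T = diagram lam - empty_boxes lam T" for T
    by (auto simp: filled_def empty_boxes_def)
  then show ?thesis using e by (simp add: adm_def)
qed

lemma Om_put_subset: "Om lam N (put v T b) \<subseteq> Om lam N T"
  by (auto simp: Om_def put_def split: if_splits)

lemma Om_put_disjoint: "b \<noteq> b' \<Longrightarrow> Om lam N (put v T b) \<inter> Om lam N (put v T b') = {}"
proof -
  assume ne: "b \<noteq> b'"
  have "b = b'" if "F \<in> Om lam N (put v T b)" "F \<in> Om lam N (put v T b')" for F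
  proof -
    have "v \<in> put v T b b" "v \<in> put v T b' b'" by (auto simp: put_def)
    then have "v \<in> F b" "v \<in> F b'" and g: "good lam N 0 F" using that unfolding Om_def by blast+
    then show ?thesis using goodD(5)[OF g] by blast
  qed
  then show ?thesis using ne by blast
qed

text \<open>The weight of \<open>F\<close> only depends on which boxes are nonempty at which time, so all ways to
  place the added values while keeping these times give distinct tableaux.\<close>

lemma wt_le_card_Om:
  "good lam N M T \<Longrightarrow> good lam N M T' \<Longrightarrow> M \<le> N \<Longrightarrow> empty_boxes lam T = empty_boxes lam T' \<Longrightarrow>
    F \<in> Om lam N T \<Longrightarrow> wt lam F M \<le> card (Om lam N T')"
proof (induction M arbitrary: T T')
  case 0
  then have "T' \<in> Om lam N T'" by (simp add: Om_def)
  then show ?case using finite_Om by (simp add: wt_def Suc_le_eq card_gt_0_iff) blast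
next
  case (Suc M)
  let ?b = "box_of F (Suc M)" and ?E = "empty_boxes lam T"
  note nb = next_box[OF lam Suc.prems(1,3,5)]
  \<comment> \<open>The second filling \<open>T'\<close> allows this: after a corner other than the
    one used by \<open>F\<close>, the fillings differ but the empty boxes do not, and the weight of
    \<open>F\<close> can still be compared.\<close>
  have IH: "wt lam F M \<le> card (Om lam N (put (Suc M) T' b))"
    if "adm lam (Suc M) T b" "?E - {b} = ?E - {?b}" for b
    using Suc.IH[OF good_put[OF lam Suc.prems(1,3) nb(1)] good_put[OF lam Suc.prems(2,3)] _ _ nb(2), of b]
      adm_cong[OF Suc.prems(4)] that Suc.prems(3,4) by (simp add: empty_boxes_put)
  show ?case
  proof (cases "T ?b = {}")
    case True
    have "wt lam F (Suc M) = wt lam F M"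
      using fac_corner[OF trunc_eq[OF Suc.prems(1,5), symmetric] True] by (simp add: wt_Suc)
    also have "\<dots> \<le> card (Om lam N (put (Suc M) T' ?b))" using IH nb(1) by simp
    also have "\<dots> \<le> card (Om lam N T')" by (intro card_mono finite_Om Om_put_subset)
    finally show ?thesis .
  next
    case False
    let ?W = "NW (filled lam T)"
    have n: "card ?E < Suc M" using nb(1) False by (auto simp: adm_def corner_def empty_boxes_def)
    have "wt lam F M \<le> card (Om lam N (put (Suc M) T' b))" if b: "b \<in> ?W" for b
    proof (rule IH)
      show "adm lam (Suc M) T b" using b n by (simp add: adm_def)
      have "b \<in> filled lam T" using b by (simp add: NW_filled_iff[OF lam])
      then show "?E - {b} = ?E - {?b}" using False by (auto simp: filled_def empty_boxes_def)
    qed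
    then have "card ?W * wt lam F M \<le> (\<Sum>b\<in>?W. card (Om lam N (put (Suc M) T' b)))"
      using sum_mono[of ?W "\<lambda>_. wt lam F M"] by simp
    also have "\<dots> = card (\<Union>b\<in>?W. Om lam N (put (Suc M) T' b))"
      using finite_NW[OF lam lam_ne] finite_Om Om_put_disjoint by (intro card_UN_disjoint[symmetric]) blast+
    also have "\<dots> \<le> card (Om lam N T')"
      using Om_put_subset by (intro card_mono finite_Om) blast
    finally show ?thesis
      using fac_NW[OF trunc_eq[OF Suc.prems(1,5), symmetric] False] by (simp add: wt_Suc)
  qed
qed

section \<open>Proposal probabilities and the Metropolis kernel\<close>

context
  fixes k :: nat and S :: filling
  assumes S: "good lam N k S" and kN: "k \<le> N" and size: "card (diagram lam) \<le> N"
begin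

abbreviation (input) "\<Omega> \<equiv> Om lam N S"
abbreviation (input) "w F \<equiv> wt lam F k"
abbreviation (input) "nE \<equiv> card (empty_boxes lam S)"
abbreviation (input) "Z \<equiv> ydim (empty_boxes lam S) * real (zden N k nE)"

lemma pmf_gen_S: "F \<in> \<Omega> \<Longrightarrow> pmf (gen lam N k S) F = 1 / (Z * w F)"
  using pmf_gen[OF lam lam_ne S kN] by simp

lemma w_pos: "F \<in> \<Omega> \<Longrightarrow> 1 \<le> w F"
  using wt_bounds[OF S kN _ order_refl] by simp

lemma set_gen_S: "set_pmf (gen lam N k S) \<subseteq> \<Omega>"
  using set_gen[OF lam lam_ne S kN] by blast

lemma sum_pmf_gen: "(\<Sum>F\<in>\<Omega>. pmf (gen lam N k S) F) = 1"
  by (rule sum_pmf_eq_1[OF finite_Om set_gen_S])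

text \<open>Existence of a completion comes for free: the algorithm always returns something, and
  what it returns is a completion.\<close>

lemma Om_ne: "\<Omega> \<noteq> {}"
  using sum_pmf_gen by auto

lemma Z_pos: "0 < Z"
proof (rule ccontr)
  assume "\<not> 0 < Z"
  then have "Z = 0" using ydim_pos[of "empty_boxes lam S"] by (simp add: zero_less_mult_iff)
  \<comment> \<open>Division by 0 yields 0, so all probabilities would vanish.\<close>
  then have "(\<Sum>F\<in>\<Omega>. pmf (gen lam N k S) F) = 0" using pmf_gen_S by (intro sum.neutral) auto
  then show False using sum_pmf_gen by simp
qed

lemma gen_pos: "F \<in> \<Omega> \<Longrightarrow> 0 < pmf (gen lam N k S) F"
  using pmf_gen_S Z_pos w_pos by fastforce

text \<open>The probabilities \<open>1 / (Z * w F)\<close> sum to 1, and none exceeds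
  \<open>1 / Z\<close>.\<close>

lemma Z_le_card: "Z \<le> card \<Omega>"
proof -
  have "1 = (\<Sum>F\<in>\<Omega>. 1 / (Z * w F))" using sum_pmf_gen pmf_gen_S by simp
  also have "\<dots> \<le> (\<Sum>F\<in>\<Omega>. 1 / Z)"
  proof (rule sum_mono)
    fix F assume "F \<in> \<Omega>"
    then have "1 \<le> w F" by (rule w_pos)
    moreover have "1 / (z * real v) \<le> 1 / z" if "0 < z" "1 \<le> v" for z v using that by (simp add: field_simps)
    ultimately show "1 / (Z * w F) \<le> 1 / Z" using Z_pos by blast
  qed
  also have "\<dots> = card \<Omega> / Z" by simp
  finally show ?thesis using Z_pos by (simp add: field_simps)
qed

lemma nE_le: "nE \<le> k"
  using goodD(8)[OF S] .

text \<open>There are at most \<open>fact nE\<close> orders and at most \<open>k choose nE\<close>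
  sets of times for opening the boxes; the product of these two numbers is a falling
  factorial.\<close>

lemma Z_le_power: "Z \<le> real k ^ nE"
proof -
  have "zden N k nE \<le> k choose nE"
  proof (cases "k = N")
    case True
    have "diagram lam \<noteq> {}" using diagram_ne[OF lam lam_ne] by auto
    then have "0 < nE" using True empty_boxes_top[OF lam lam_ne, of N S] S young_finite[OF young_diagram[OF lam]]
      by (simp add: card_gt_0_iff)
    then obtain a b where "k = Suc a" "nE = Suc b" using nE_le by (cases k; cases nE) auto
    then show ?thesis using True by (simp add: zden_def)
  qed (simp add: zden_def)
  then have "Z \<le> fact nE * real (k choose nE)"
    using ydim_le_fact[of "empty_boxes lam S"] ydim_pos[of "empty_boxes lam S"] by (intro mult_mono) auto
  also have "\<dots> = real (fact nE * (k choose nE))" by simp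
  also have "\<dots> \<le> real (k ^ nE)"
    using binomial_fact_pow[of k nE] by (subst of_nat_le_iff) (simp add: mult.commute)
  finally show ?thesis by simp
qed

lemma pmf_gen_lower:
  assumes F: "F \<in> \<Omega>" and C: "nE \<le> C \<or> k - nE \<le> C"
  shows "1 / real (Suc k) ^ (2 * C) / card \<Omega> \<le> pmf (gen lam N k S) F"
proof -
  \<comment> \<open>The exponent is dictated by the case of bounded \<open>k - nE\<close>, where
    \<open>w F\<close> has at most \<open>C\<close> nontrivial factors, each bounded by a square. In
    the other case \<open>C\<close> itself would do.\<close>
  let ?B = "real (Suc k) ^ (2 * C)"
  have wp: "0 < real (w F)" using w_pos[OF F] by simp
  have c: "0 < real (card \<Omega>)" using finite_Om F by (auto simp: card_gt_0_iff)
  have "Z * w F \<le> ?B * card \<Omega>"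
    using C
  proof
    assume "nE \<le> C"
    have "Z \<le> real k ^ nE" by (rule Z_le_power)
    also have "\<dots> \<le> real (Suc k) ^ nE" by (intro power_mono) auto
    also have "\<dots> \<le> ?B" using \<open>nE \<le> C\<close> by (intro power_increasing) auto
    finally have "Z \<le> ?B" .
    moreover have "w F \<le> card \<Omega>" using wt_le_card_Om[OF S S kN refl F] .
    ultimately show ?thesis using Z_pos by (intro mult_mono) auto
  next
    assume "k - nE \<le> C"
    have "w F \<le> ((Suc k)\<^sup>2) ^ (k - nE)" using wt_bounds[OF S kN F order_refl] by simp
    also have "\<dots> \<le> ((Suc k)\<^sup>2) ^ C" using \<open>k - nE \<le> C\<close> by (intro power_increasing) auto
    finally have "real (w F) \<le> real (((Suc k)\<^sup>2) ^ C)" by (rule of_nat_mono)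
    then have "real (w F) \<le> ?B" by (simp add: power_mult)
    then have "Z * w F \<le> card \<Omega> * ?B" using Z_le_card Z_pos wp by (intro mult_mono) auto
    then show ?thesis by (simp add: mult.commute)
  qed
  moreover have "1 / b / d \<le> 1 / y" if "0 < y" "0 < b" "0 < d" "y \<le> b * d" for y b d :: real
    using that by (simp add: field_simps)
  moreover have "0 < ?B" by simp
  ultimately show ?thesis unfolding pmf_gen_S[OF F] using mult_pos_pos[OF Z_pos wp] c by blast
qed

lemma MC_eq_metro: "MC_SVT lam N k S = metro \<Omega> (pmf (gen lam N k S))"
  by (intro ext)
    (simp add: MC_SVT_def metro_def[OF finite_Om gen_pos sum_pmf_gen] metropolis_off_def P_SVG_def
      SVGen_eq_gen[OF lam lam_ne S kN size] SVT_ext_eq_Om[OF lam S])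

lemmas MC_rows = metro_rows[OF finite_Om gen_pos sum_pmf_gen, folded MC_eq_metro]
lemmas MC_sym = metro_sym[OF finite_Om gen_pos sum_pmf_gen, folded MC_eq_metro]

lemma MC_minor:
  assumes "nE \<le> C \<or> k - nE \<le> C" "T \<in> \<Omega>" "F \<in> \<Omega>"
  shows "1 / real (Suc k) ^ (2 * C) / card \<Omega> \<le> MC_SVT lam N k S T F"
  unfolding MC_eq_metro
  by (rule metro_minor[OF finite_Om gen_pos sum_pmf_gen assms(2,3)]) (assumption, erule pmf_gen_lower, rule assms(1))

lemma mixing:
  assumes "nE \<le> C \<or> k - nE \<le> C" "0 < \<epsilon>"
  shows "\<exists>t. mix_dist \<Omega> (MC_SVT lam N k S) t \<le> \<epsilon>"
    "real (t_mix \<Omega> (MC_SVT lam N k S) \<epsilon>) \<le> real (Suc k) ^ (2 * C) * (1 / \<epsilon>) + 1"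
  using t_mix_bound[of \<Omega> "MC_SVT lam N k S" "1 / real (Suc k) ^ (2 * C)",
      OF finite_Om Om_ne MC_rows MC_sym MC_minor[OF assms(1)] _ assms(2)] by simp_all

lemma set_kernel: "set_pmf (kernel lam N k S x) \<subseteq> insert x (Some ` \<Omega>)"
  using set_gen_S by (auto simp: kernel_def split: if_splits)

text \<open>In the quotient of two proposal probabilities \<open>Z\<close> cancels, which turns the
  Metropolis ratio into a quotient of two integers. The diagonal entry then follows because rows sum
  to 1.\<close>

lemma pmf_kernel:
  assumes T: "T \<in> \<Omega>" and F: "F \<in> \<Omega>"
  shows "pmf (kernel lam N k S (Some T)) (Some F) = MC_SVT lam N k S T F"
proof -
  let ?p = "pmf (gen lam N k S)"
  have wT: "0 < w T" using w_pos[OF T] by simp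
  have off: "pmf (kernel lam N k S (Some T)) (Some F) = ?p F * min 1 (?p T / ?p F)" if F: "F \<in> \<Omega>" "F \<noteq> T" for F
  proof -
    let ?U = "pmf_of_set {0..<w T}"
    have U: "{0..<w T} \<noteq> {}" "finite {0..<w T}" using wT by auto
    have "pmf (kernel lam N k S (Some T)) (Some F) =
        ?p F * pmf (map_pmf (\<lambda>u. if u < w F then Some F else Some T) ?U) (Some F)"
      unfolding kernel_def option.case using F(2)
      by (intro pmf_bind_single) auto
    also have "pmf (map_pmf (\<lambda>u. if u < w F then Some F else Some T) ?U) (Some F) = measure ?U {u. u < w F}"
      unfolding pmf_map using F(2) by (intro arg_cong2[where f = measure]) auto
    also have "\<dots> = card ({0..<w T} \<inter> {u. u < w F}) / w T"
      using U by (simp add: measure_pmf_of_set)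
    also have "{0..<w T} \<inter> {u. u < w F} = {0..<min (w T) (w F)}" by auto
    also have "real (card {0..<min (w T) (w F)}) / w T = min 1 (?p T / ?p F)"
    proof -
      have wF: "0 < w F" using w_pos[OF F(1)] by simp
      have "(1 / (z * a)) / (1 / (z * b)) = b / a" if "0 < z" for z a b :: real using that by simp
      then have "?p T / ?p F = w F / w T" using Z_pos by (simp only: pmf_gen_S T F(1))
      moreover have "real (card {0..<min a b}) / real a = min 1 (b / a)" if "0 < a" for a b :: nat
        using that by (auto simp: min_def field_simps)
      ultimately show ?thesis using wT by (simp only:)
    qed
    finally show ?thesis .
  qed
  show ?thesis
  proof (cases "F = T")
    case False
    then show ?thesis using off[OF F] unfolding MC_eq_metro by (simp add: metro_def[OF finite_Om gen_pos sum_pmf_gen])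
  next
    case True
    have "(\<Sum>x\<in>Some ` \<Omega>. pmf (kernel lam N k S (Some T)) x) = 1"
      using set_kernel[of "Some T"] T finite_Om by (intro sum_pmf_eq_1) auto
    then have "(\<Sum>F\<in>\<Omega>. pmf (kernel lam N k S (Some T)) (Some F)) = 1"
      by (simp add: sum.reindex)
    then have "pmf (kernel lam N k S (Some T)) (Some T) = 1 - (\<Sum>F\<in>\<Omega> - {T}. pmf (kernel lam N k S (Some T)) (Some F))"
      using finite_Om T by (simp add: sum.remove[of _ T])
    also have "(\<Sum>F\<in>\<Omega> - {T}. pmf (kernel lam N k S (Some T)) (Some F)) = (\<Sum>F\<in>\<Omega> - {T}. ?p F * min 1 (?p T / ?p F))"
      using off by (intro sum.cong) auto
    finally show ?thesis
      using True unfolding MC_eq_metro by (simp add: metro_def[OF finite_Om gen_pos sum_pmf_gen])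
  qed
qed

lemma pmf_chain:
  "T \<in> \<Omega> \<Longrightarrow> F \<in> \<Omega> \<Longrightarrow> pmf (chain lam N k S t (Some T)) (Some F) = mat_pow \<Omega> (MC_SVT lam N k S) t T F"
proof (induction t arbitrary: T)
  case (Suc t)
  have "pmf (chain lam N k S (Suc t) (Some T)) (Some F) =
      (\<Sum>x\<in>Some ` \<Omega>. pmf (kernel lam N k S (Some T)) x * pmf (chain lam N k S t x) (Some F))"
    using set_kernel[of "Some T"] Suc.prems(1) finite_Om unfolding chain.simps
    by (intro pmf_bind_finite) auto
  also have "\<dots> = (\<Sum>G\<in>\<Omega>. MC_SVT lam N k S T G * mat_pow \<Omega> (MC_SVT lam N k S) t G F)"
    using Suc by (auto simp: sum.reindex pmf_kernel intro!: sum.cong)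
  finally show ?case by simp
qed simp

lemma set_chain_Some: "T \<in> \<Omega> \<Longrightarrow> set_pmf (chain lam N k S t (Some T)) \<subseteq> Some ` \<Omega>"
proof (induction t arbitrary: T)
  case (Suc t)
  then have "set_pmf (kernel lam N k S (Some T)) \<subseteq> Some ` \<Omega>" using set_kernel[of "Some T"] by auto
  then show ?case using Suc.IH by auto
qed auto

text \<open>From a tableau of minimal weight every proposal is accepted, just as from \<open>None\<close>. So the program
  need not construct an initial tableau.\<close>

lemma kernel_None: "\<exists>T\<in>\<Omega>. \<forall>t. chain lam N k S (Suc t) None = chain lam N k S (Suc t) (Some T)"
proof -
  obtain T where T: "T \<in> \<Omega>" "\<And>F. F \<in> \<Omega> \<Longrightarrow> w T \<le> w F"
    using ex_has_least_nat[of "\<lambda>F. F \<in> \<Omega>" _ "\<lambda>F. w F"] Om_ne by blast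
  have "kernel lam N k S x = map_pmf Some (gen lam N k S)"
    if x: "\<And>F. F \<in> \<Omega> \<Longrightarrow> (case x of None \<Rightarrow> 1 | Some T \<Rightarrow> w T) \<le> w F"
      "0 < (case x of None \<Rightarrow> 1 | Some T \<Rightarrow> w T)" for x
  proof -
    let ?U = "pmf_of_set {0..<(case x of None \<Rightarrow> 1 | Some T \<Rightarrow> w T)}"
    have U: "set_pmf ?U = {0..<(case x of None \<Rightarrow> 1 | Some T \<Rightarrow> w T)}" using x(2) by (intro set_pmf_of_set) auto
    have "map_pmf (\<lambda>u. if u < w F then Some F else x) ?U = return_pmf (Some F)" if "F \<in> \<Omega>" for F
    proof -
      have "map_pmf (\<lambda>u. if u < w F then Some F else x) ?U = map_pmf (\<lambda>_. Some F) ?U"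
        using x(1)[OF that] U by (intro map_pmf_cong) auto
      then show ?thesis by simp
    qed
    then show ?thesis unfolding kernel_def map_pmf_def using set_gen_S
      by (intro bind_pmf_cong) (auto simp: map_pmf_def)
  qed
  note * = this
  have "kernel lam N k S None = map_pmf Some (gen lam N k S)" by (rule *) (use w_pos in auto)
  moreover have "kernel lam N k S (Some T) = map_pmf Some (gen lam N k S)" by (rule *) (use T w_pos[OF T(1)] in auto)
  ultimately show ?thesis using T(1) by (intro bexI[of _ T]) simp_all
qed

end
end

section \<open>Timed loops, frame conditions and the scan of a square\<close>

lemma implements_le: "implements c m n p R \<Longrightarrow> n \<le> n' \<Longrightarrow> implements c m n' p R"
  by (rule implements_conseq)

abbreviation det :: "prog \<Rightarrow> mem \<Rightarrow> nat \<Rightarrow> (mem \<Rightarrow> bool) \<Rightarrow> bool" where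
  "det c m n Q \<equiv> implements c m n (return_pmf ()) (\<lambda>_. Q)"

lemma det_Seq:
  assumes "det c1 m n1 Q" "\<And>m'. Q m' \<Longrightarrow> implements c2 m' n2 p R"
  shows "implements (Seq c1 c2) m (n1 + n2 + 1) p R"
  using implements_Seq[OF assms(1), of c2 n2 "\<lambda>_. p" R] assms(2) by (simp add: bind_return_pmf)

lemma implements_Seq_det:
  assumes "implements c1 m n1 p R" "\<And>a m'. a \<in> set_pmf p \<Longrightarrow> R a m' \<Longrightarrow> implements c2 m' n2 (return_pmf (f a)) R'"
  shows "implements (Seq c1 c2) m (n1 + n2 + 1) (map_pmf f p) R'"
  using implements_Seq[OF assms] by (simp add: map_pmf_def)

lemma implements_Assign_Seq:
  assumes "implements c (m(map (val m) es := val m e)) n p R"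
  shows "implements (Seq (Assign es e) c) m (n + 2) p R"
  using det_Seq[OF implements_Assign[where R = "\<lambda>_ m'. m' = m(map (val m) es := val m e)" and a = "()"], of m es e c n p R] assms
  by simp

lemma implements_Assign_Seq_le:
  assumes "implements c m' n p R" "m' = m(map (val m) es := val m e)" "n + 2 \<le> n'"
  shows "implements (Seq (Assign es e) c) m n' p R"
  unfolding assms(2)[symmetric]
  by (rule implements_le[OF implements_Assign_Seq assms(3)]) (use assms(1,2) in simp)

lemma implements_Assign_Seq_minus:
  assumes "implements c (m(map (val m) es := val m e)) (n - 2) p R" "2 \<le> n"
  shows "implements (Seq (Assign es e) c) m n p R"
  using implements_Assign_Seq_le[OF assms(1) refl] assms(2) by simp

lemma implements_Assign_le:
  "R a (m(map (val m) es := val m e)) \<Longrightarrow> 1 \<le> n \<Longrightarrow> implements (Assign es e) m n (return_pmf a) R"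
  by (rule implements_le[OF implements_Assign])

lemma implements_Halt_le: "R a m \<Longrightarrow> implements Halt m n (return_pmf a) R"
  by (rule implements_le[OF implements_Halt]) simp_all

lemma implements_If:
  assumes "val m e1 < val m e2 \<Longrightarrow> implements c1 m (n - 1) p R" "\<not> val m e1 < val m e2 \<Longrightarrow> implements c2 m (n - 1) p R" "1 \<le> n"
  shows "implements (IfLess e1 e2 c1 c2) m n p R"
  using implements_IfLess[of m e1 e2 c1 "n - 1" p R c2] assms by simp

text \<open>\<open>q i\<close> is the law of the iterations from \<open>i\<close> on; leaving it to
  the caller admits any function with the right recursion, such as \<open>gen\<close> or
  \<open>chain\<close>. Besides the body, an iteration costs one step for the test and one for
  discarding \<open>Halt\<close>.\<close>

lemma implements_for:
  assumes step: "\<And>i a m. i < n \<Longrightarrow> J i a m \<Longrightarrow> val m e1 < val m e2 \<and> implements c m t (p i a) (J (Suc i))"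
    and stop: "\<And>a m. J n a m \<Longrightarrow> \<not> val m e1 < val m e2"
    and q: "\<And>i a. i < n \<Longrightarrow> q i a = bind_pmf (p i a) (q (Suc i))" "\<And>a. q n a = return_pmf a"
    and J: "J i a m" "i \<le> n"
  shows "implements (WhileLess e1 e2 c) m ((n - i) * (t + 2) + 1) (q i a) (J n)"
  using J
proof (induction "n - i" arbitrary: i a m)
  case 0
  then show ?case using implements_WhileLess_done[of m e1 e2 "J n" a c] stop[of a m] q(2) by simp
next
  case (Suc d)
  then have i: "i < n" by simp
  have "implements (WhileLess e1 e2 c) m (t + ((n - Suc i) * (t + 2) + 1) + 2) (bind_pmf (p i a) (q (Suc i))) (J n)"
  proof (rule implements_WhileLess_iterate)
    show "val m e1 < val m e2" "implements c m t (p i a) (J (Suc i))" using step[OF i Suc.prems(1)] by auto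
    fix a' m' assume "J (Suc i) a' m'"
    then show "implements (WhileLess e1 e2 c) m' ((n - Suc i) * (t + 2) + 1) (q (Suc i) a') (J n)"
      using Suc.hyps(2) i by (intro Suc.hyps(1)) auto
  qed
  moreover have "t + ((n - Suc i) * (t + 2) + 1) + 2 = (n - i) * (t + 2) + 1"
    using i by (cases "n - i") (auto simp: Suc_diff_Suc[symmetric])
  ultimately show ?case using q(1)[OF i] by simp
qed

lemma det_for:
  assumes "\<And>i m. i < n \<Longrightarrow> J i m \<Longrightarrow> val m e1 < val m e2 \<and> det c m t (J (Suc i))"
    and "\<And>m. J n m \<Longrightarrow> \<not> val m e1 < val m e2" "J 0 m"
  shows "det (WhileLess e1 e2 c) m (n * (t + 2) + 1) (J n)"
  using implements_for[where J = "\<lambda>i (_::unit). J i" and p = "\<lambda>_ _. return_pmf ()" and q = "\<lambda>_ _. return_pmf ()" and i = 0,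
      of n e1 e2 c t] assms
  by (simp add: bind_return_pmf)

text \<open>The first entry of an address names the array, so frame conditions are sets of array
  names.\<close>

definition agree :: "nat set \<Rightarrow> mem \<Rightarrow> mem \<Rightarrow> bool" where
  "agree H m m' \<longleftrightarrow> (\<forall>a as. a \<notin> H \<longrightarrow> m' (a # as) = m (a # as))"

lemma agreeD: "agree H m m' \<Longrightarrow> a \<notin> H \<Longrightarrow> m' (a # as) = m (a # as)"
  by (simp add: agree_def)

lemma agree_refl [simp]: "agree H m m"
  by (simp add: agree_def)

lemma agree_upd: "agree H m m' \<Longrightarrow> a \<in> H \<Longrightarrow> agree H m (m'(a # as := x))"
  by (auto simp: agree_def)

lemma agree_trans: "agree H m m' \<Longrightarrow> agree H' m' m'' \<Longrightarrow> agree (H \<union> H') m m''"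
  by (auto simp: agree_def)

lemma agree_mono: "agree H m m' \<Longrightarrow> H \<subseteq> H' \<Longrightarrow> agree H' m m'"
  by (auto simp: agree_def)

abbreviation (input) "V i \<equiv> Cell [Const i]"

definition grid_cell :: "prog \<Rightarrow> prog" where
  "grid_cell c = Seq c (Assign [Const 13] (Plus (V 13) (Const 1)))"

definition grid_row :: "prog \<Rightarrow> prog" where
  "grid_row c = Seq (Assign [Const 13] (Const 1))
     (Seq (WhileLess (V 13) (Plus (V 0) (Const 2)) (grid_cell c)) (Assign [Const 12] (Plus (V 12) (Const 1))))"

text \<open>The same square is scanned whatever the shape of \<open>\<lambda>\<close>, so that the
  time depends on \<open>k\<close> only.\<close>

definition grid :: "prog \<Rightarrow> prog" where
  "grid c = Seq (Assign [Const 12] (Const 1)) (WhileLess (V 12) (Plus (V 0) (Const 2)) (grid_row c))"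

definition grid_time :: "nat \<Rightarrow> nat \<Rightarrow> nat" where
  "grid_time k t = Suc k * (Suc k * (t + 4) + 7) + 3"

definition boxes :: "nat \<Rightarrow> box set" where
  "boxes k = {1..Suc k} \<times> {1..Suc k}"

text \<open>\<open>P\<close> is the set of boxes already visited; invariants are stated for such
  sets rather than for positions in reading order. The body may change everything but the bound
  \<open>[0]\<close> and the two counters.\<close>

lemma det_grid:
  assumes body: "\<And>P r c m. r \<in> {1..Suc k} \<Longrightarrow> c \<in> {1..Suc k} \<Longrightarrow> (r, c) \<notin> P \<Longrightarrow> J P m \<Longrightarrow>
      m [12] = r \<Longrightarrow> m [13] = c \<Longrightarrow> det b m t (\<lambda>m'. J (insert (r, c) P) m' \<and> agree (- {0, 12, 13}) m m')"
    and frame: "\<And>P m m'. J P m \<Longrightarrow> agree {12, 13} m m' \<Longrightarrow> J P m'"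
    and k: "m [0] = k" and J: "J {} m"
  shows "det (grid b) m (grid_time k t) (\<lambda>m'. J (boxes k) m')"
proof -
  define proc where "proc i j = {1..i} \<times> {1..Suc k} \<union> {Suc i} \<times> {1..j}" for i j :: nat
  define I where "I i j m \<longleftrightarrow> J (proc i j) m \<and> m [0] = k \<and> m [12] = Suc i \<and> m [13] = Suc j" for i j m
  have proc_Suc: "proc i (Suc j) = insert (Suc i, Suc j) (proc i j)" for i j
    by (auto simp: proc_def le_Suc_eq)
  have proc_next: "proc (Suc i) 0 = proc i (Suc k)" for i
    by (auto simp: proc_def le_Suc_eq)
  let ?e2 = "Plus (V 0) (Const 2)" and ?Q = "\<lambda>i m'. J (proc i 0) m' \<and> m' [0] = k \<and> m' [12] = Suc i"
  have cell: "det (grid_cell b) m (t + 2) (I i (Suc j))"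
    if "i < Suc k" "j < Suc k" "I i j m" for i j m
  proof -
    have I: "J (proc i j) m" "m [0] = k" "m [12] = Suc i" "m [13] = Suc j" using that(3) by (auto simp: I_def)
    have "(Suc i, Suc j) \<notin> proc i j" by (auto simp: proc_def)
    then have d: "det b m t (\<lambda>m'. J (insert (Suc i, Suc j) (proc i j)) m' \<and> agree (- {0, 12, 13}) m m')"
      using body[of "Suc i" "Suc j"] that(1,2) I by simp
    have "det (grid_cell b) m (t + 1 + 1) (I i (Suc j))"
      unfolding grid_cell_def
    proof (rule det_Seq[OF d])
      fix m' assume m': "J (insert (Suc i, Suc j) (proc i j)) m' \<and> agree (- {0, 12, 13}) m m'"
      note ag = agreeD[OF conjunct2[OF m']]
      have "I i (Suc j) (m'([13] := m' [13] + 1))"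
        using frame[OF conjunct1[OF m'], of "m'([13] := m' [13] + 1)"] I ag[of 0 "[]"] ag[of 12 "[]"] ag[of 13 "[]"]
        by (simp add: I_def proc_Suc agree_upd)
      then show "det (Assign [Const 13] (Plus (V 13) (Const 1))) m' 1 (I i (Suc j))"
        by (intro implements_Assign) simp
    qed
    then show ?thesis by simp
  qed
  have inner: "det (WhileLess (V 13) ?e2 (grid_cell b)) m
      (Suc k * (t + 4) + 1) (I i (Suc k))" if "i < Suc k" "I i 0 m" for i m
  proof -
    have "det (WhileLess (V 13) ?e2 (grid_cell b)) m
      (Suc k * ((t + 2) + 2) + 1) (I i (Suc k))"
    proof (rule det_for)
      fix j m' assume j: "j < Suc k" "I i j m'"
      have "val m' (V 13) < val m' ?e2" using j by (auto simp: I_def)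
      then show "val m' (V 13) < val m' ?e2 \<and>
          det (grid_cell b) m' (t + 2) (I i (Suc j))"
        using cell[OF that(1) j] by blast
    qed (use that in \<open>auto simp: I_def\<close>)
    then show ?thesis by (simp only: add.assoc) simp
  qed
  have row: "det (grid_row b) m (Suc k * (t + 4) + 5)
      (?Q (Suc i))"
    if "i < Suc k" "J (proc i 0) m" "m [0] = k" "m [12] = Suc i" for i m
  proof -
    let ?m = "m([13] := 1)"
    have I0: "I i 0 ?m" using frame[OF that(2), of ?m] that by (simp add: I_def agree_upd)
    have "det (Seq (WhileLess (V 13) ?e2 (grid_cell b))
           (Assign [Const 12] (Plus (V 12) (Const 1)))) ?m (Suc k * (t + 4) + 1 + 1 + 1)
        (?Q (Suc i))"
    proof (rule det_Seq[OF inner[OF that(1) I0]])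
      fix m' assume m': "I i (Suc k) m'"
      then show "det (Assign [Const 12] (Plus (V 12) (Const 1))) m' 1
          (?Q (Suc i))"
        using frame[of "proc i (Suc k)" m' "m'([12] := Suc (Suc i))"]
        by (intro implements_Assign) (simp add: I_def agree_upd proc_next)
    qed
    then show ?thesis unfolding grid_row_def by (rule implements_Assign_Seq_le) simp_all
  qed
  let ?m = "m([12] := 1)"
  have "det (WhileLess (V 12) ?e2 (grid_row b)) ?m (Suc k * ((Suc k * (t + 4) + 5) + 2) + 1)
      (?Q (Suc k))"
  proof (rule det_for[where J = "?Q"])
    fix i m' assume i: "i < Suc k" "J (proc i 0) m' \<and> m' [0] = k \<and> m' [12] = Suc i"
    have "val m' (V 12) < val m' ?e2" using i by auto
    then show "val m' (V 12) < val m' ?e2 \<and> det (grid_row b) m' (Suc k * (t + 4) + 5)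
      (?Q (Suc i))"
      using row i by blast
  next
    have "proc 0 0 = {}" by (simp add: proc_def)
    then show "J (proc 0 0) ?m \<and> ?m [0] = k \<and> ?m [12] = Suc 0" using frame[OF J, of ?m] k by (simp add: agree_upd)
  qed auto
  then have "det (grid b) m (Suc k * ((Suc k * (t + 4) + 5) + 2) + 1 + 2)
      (?Q (Suc k))"
    unfolding grid_def by (intro implements_Assign_Seq) simp
  moreover have "proc (Suc k) 0 = boxes k" by (simp add: proc_def boxes_def)
  ultimately show ?thesis
    by (elim implements_conseq) (auto simp: grid_time_def algebra_simps)
qed

section \<open>A program for the generation algorithm\<close>

lemma implements_det:
  assumes "det c m n Q" "\<And>m'. Q m' \<Longrightarrow> R a m'"
  shows "implements c m n (return_pmf a) R"
proof -
  obtain D where D: "map_pmf fst D = return_pmf ()" "\<forall>(x, m')\<in>set_pmf D. Q m'" "halts_within c m n (map_pmf snd D)"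
    using assms(1) unfolding implements_def by blast
  have "map_pmf fst (map_pmf (\<lambda>x. (a, snd x)) D) = return_pmf a"
    "map_pmf snd (map_pmf (\<lambda>x. (a, snd x)) D) = map_pmf snd D"
    by (simp_all add: pmf.map_comp comp_def)
  moreover have "\<forall>(b, m')\<in>set_pmf (map_pmf (\<lambda>x. (a, snd x)) D). R b m'" using D(2) assms(2) by auto
  ultimately show ?thesis using D(3) unfolding implements_def by metis
qed

text \<open>
  Scalars of the programs below: cells \<open>[10]\<close> and \<open>[11]\<close> hold the number of listed boxes and this number
  times the weight, \<open>[12]\<close> and \<open>[13]\<close> the row and column of the scan, \<open>[14]\<close> a random number, \<open>[15]\<close> and
  \<open>[16]\<close> the row and column of the chosen box, \<open>[17]\<close> the weight of the proposal, \<open>[18]\<close> the value to be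
  placed, \<open>[19]\<close> the weight of the current state, \<open>[20]\<close> the index (0 or 1) of its buffer, \<open>[21]\<close> the
  doubled numerator of the bias, \<open>[22]\<close> and \<open>[23, j]\<close> loop counters. Arrays: \<open>[30, r, c]\<close> flags the empty
  boxes of the proposal, \<open>[31, i]\<close> and \<open>[32, i]\<close> list boxes, and \<open>[33, i, v]\<close> and \<open>[34, i, v]\<close> are the row
  and column of \<open>v\<close> in buffer \<open>i\<close>.

  Boxes are selected by penalties: a box is listed iff the value of a given expression is 0. Sums of
  penalties express conjunctions.
\<close>

definition list_box :: prog where
  "list_box = Seq (Assign [Const 31, V 10] (V 12)) (Seq (Assign [Const 32, V 10] (V 13))
    (Seq (Assign [Const 10] (Plus (V 10) (Const 1))) (Assign [Const 11] (Plus (V 11) (V 17)))))"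

definition scan :: "expr \<Rightarrow> prog" where
  "scan pen = Seq (Assign [Const 10] (Const 0)) (Seq (Assign [Const 11] (Const 0))
     (grid (IfLess pen (Const 1)
       list_box
       Halt)))"

definition scan_time :: "nat \<Rightarrow> nat" where
  "scan_time k = grid_time k 8 + 4"

text \<open>Each box is listed exactly once, so a uniform index selects a uniform box.\<close>

definition scanned :: "mem \<Rightarrow> box set \<Rightarrow> bool" where
  "scanned m S \<longleftrightarrow> m [10] = card S \<and> bij_betw (\<lambda>i. (m [31, i], m [32, i])) {0..<card S} S"

lemma bij_betw_snoc:
  assumes "bij_betw f {0..<n} S" "x \<notin> S" "g n = x" "\<And>i. i < n \<Longrightarrow> g i = f i"
  shows "bij_betw g {0..<Suc n} (insert x S)"
proof -
  have "bij_betw g {0..<n} S" using assms(1,4) by (subst bij_betw_cong[of _ _ f]) auto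
  moreover have "bij_betw g {n} {x}" using assms(3) by simp
  ultimately have "bij_betw g ({0..<n} \<union> {n}) (S \<union> {x})"
    using assms(2) by (intro bij_betw_combine) auto
  moreover have "{0..<n} \<union> {n} = {0..<Suc n}" "S \<union> {x} = insert x S" by auto
  ultimately show ?thesis by simp
qed

abbreviation "scan_heads \<equiv> {10, 11, 12, 13, 31, 32 :: nat}"

text \<open>Adding \<open>[17]\<close> once per listed box replaces a multiplication; for the list
  of north-west corners, \<open>[11]\<close> is then the updated weight.\<close>

lemma det_scan:
  assumes k: "m [0] = k"
    and pen: "\<And>m' r c. agree scan_heads m m' \<Longrightarrow> r \<in> {1..Suc k} \<Longrightarrow> c \<in> {1..Suc k} \<Longrightarrow> m' [12] = r \<Longrightarrow>
      m' [13] = c \<Longrightarrow> val m' pen < 1 \<longleftrightarrow> (r, c) \<in> G"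
    and G: "G \<subseteq> boxes k"
  shows "det (scan pen) m (scan_time k)
    (\<lambda>m'. scanned m' G \<and> m' [11] = card G * m [17] \<and> agree scan_heads m m')"
proof -
  define J where "J P m' \<longleftrightarrow> agree scan_heads m m' \<and> scanned m' (P \<inter> G) \<and> m' [11] = card (P \<inter> G) * m [17] \<and> finite P" for P m'
  let ?m = "m([10] := 0, [11] := 0)"
  have "det (grid (IfLess pen (Const 1)
       list_box
       Halt)) ?m (grid_time k 8) (J (boxes k))"
  proof (rule det_grid)
    fix P r c m'
    assume rc: "r \<in> {1..Suc k}" "c \<in> {1..Suc k}" "(r, c) \<notin> P" and J: "J P m'" and m': "m' [12] = r" "m' [13] = c"
    let ?n = "card (P \<inter> G)"
    let ?m' = "m'([31, ?n] := r, [32, ?n] := c, [10] := Suc ?n, [11] := m' [11] + m' [17])"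
    have ag: "agree scan_heads m m'" and n: "m' [10] = ?n" and fin: "finite P" using J by (auto simp: J_def scanned_def)
    have hit: "J (insert (r, c) P) ?m'" if "(r, c) \<in> G"
    proof -
      have i: "insert (r, c) P \<inter> G = insert (r, c) (P \<inter> G)" using that by auto
      have c: "card (insert (r, c) (P \<inter> G)) = Suc ?n" using rc(3) fin by simp
      have "bij_betw (\<lambda>i. (?m' [31, i], ?m' [32, i])) {0..<Suc ?n} (insert (r, c) (P \<inter> G))"
        using J rc(3) by (intro bij_betw_snoc[of "\<lambda>i. (m' [31, i], m' [32, i])"]) (auto simp: J_def scanned_def)
      moreover have "m' [17] = m [17]" by (rule agreeD[OF ag]) simp
      ultimately show ?thesis
        unfolding J_def scanned_def i c using J ag fin by (auto simp: J_def agree_upd)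
    qed
    have miss: "J (insert (r, c) P) m'" if "(r, c) \<notin> G"
    proof -
      have "insert (r, c) P \<inter> G = P \<inter> G" using that by auto
      then show ?thesis using J by (simp add: J_def)
    qed
    have v: "val m' pen < 1 \<longleftrightarrow> (r, c) \<in> G" using pen[OF ag rc(1,2) m'] .
    show "det (IfLess pen (Const 1)
       list_box
       Halt) m' 8 (\<lambda>m''. J (insert (r, c) P) m'' \<and> agree (- {0, 12, 13}) m' m'')"
    proof (rule implements_If)
      assume "val m' pen < val m' (Const 1)"
      then have "J (insert (r, c) P) ?m'" using v hit by simp
      moreover have "agree (- {0, 12, 13}) m' ?m'" by (simp add: agree_upd)
      ultimately show "det list_box
         m' (8 - 1) (\<lambda>m''. J (insert (r, c) P) m'' \<and> agree (- {0, 12, 13}) m' m'')"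
        unfolding list_box_def using n m' by (intro implements_Assign_Seq_minus implements_Assign_le) simp_all
    next
      assume "\<not> val m' pen < val m' (Const 1)"
      then show "det Halt m' (8 - 1) (\<lambda>m''. J (insert (r, c) P) m'' \<and> agree (- {0, 12, 13}) m' m'')"
        using v miss by (intro implements_Halt_le) simp
    qed simp
  next
    fix P m' m'' assume J: "J P m'" and a: "agree {12, 13} m' m''"
    then have "agree scan_heads m m''" using agree_mono[OF agree_trans[of scan_heads m m' "{12, 13}" m'']]
      by (auto simp: J_def)
    then show "J P m''" using J agreeD[OF a] by (simp add: J_def scanned_def)
  next
    show "J {} ?m" by (simp add: J_def scanned_def agree_upd bij_betw_def)
    show "?m [0] = k" using k by simp
  qed
  then have "det (scan pen) m (scan_time k) (J (boxes k))"
    unfolding scan_def by (intro implements_Assign_Seq_minus) (simp_all add: scan_time_def)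
  moreover have "boxes k \<inter> G = G" using G by auto
  ultimately show ?thesis by (elim implements_conseq) (auto simp: J_def)
qed

section \<open>Drawing a box and the hook walk\<close>

definition pick :: prog where
  "pick = Seq (Random [Const 14] (V 10))
     (Seq (Assign [Const 15] (Cell [Const 31, V 14])) (Assign [Const 16] (Cell [Const 32, V 14])))"

definition at_box :: "box \<Rightarrow> mem \<Rightarrow> bool" where
  "at_box b m \<longleftrightarrow> m [15] = fst b \<and> m [16] = snd b"

lemma implements_pick:
  assumes S: "scanned m S" and fin: "finite S" "S \<noteq> {}"
  shows "implements pick m 5 (pmf_of_set S) (\<lambda>b m'. at_box b m' \<and> agree {14, 15, 16} m m')"
proof -
  let ?f = "\<lambda>i. (m [31, i], m [32, i])"
  have pos: "0 < card S" using fin by (simp add: card_gt_0_iff)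
  have "implements pick m (1 + 3 + 1) (map_pmf ?f (pmf_of_set {0..<val m (V 10)}))
      (\<lambda>b m'. at_box b m' \<and> agree {14, 15, 16} m m')"
    unfolding pick_def
  proof (rule implements_Seq_det)
    show "implements (Random [Const 14] (V 10)) m 1 (pmf_of_set {0..<val m (V 10)}) (\<lambda>u m'. m' = m([14] := u))"
      using S pos by (intro implements_Random) (auto simp: scanned_def)
    fix u m' assume "m' = m([14] := u)"
    then show "implements (Seq (Assign [Const 15] (Cell [Const 31, V 14])) (Assign [Const 16] (Cell [Const 32, V 14])))
        m' 3 (return_pmf (?f u)) (\<lambda>b m'. at_box b m' \<and> agree {14, 15, 16} m m')"
      by (intro implements_Assign_Seq_minus implements_Assign_le) (simp_all add: at_box_def agree_upd)
  qed
  moreover have "map_pmf ?f (pmf_of_set {0..<card S}) = pmf_of_set S"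
    using S pos by (intro map_pmf_of_set_bij_betw) (auto simp: scanned_def)
  ultimately show ?thesis using S by (simp add: scanned_def)
qed

definition flags :: "nat \<Rightarrow> box set \<Rightarrow> mem \<Rightarrow> bool" where
  "flags k E m \<longleftrightarrow> (\<forall>r\<in>{1..Suc k}. \<forall>c\<in>{1..Suc k}. m [30, r, c] = (if (r, c) \<in> E then 1 else 0))"

text \<open>The last but one summand is the minimum of \<open>r - r0\<close> and \<open>c - c0\<close>, in the form \<open>x - (x - y)\<close>.\<close>

definition penHook :: expr where
  "penHook = Plus (Minus (Const 1) (Cell [Const 30, V 12, V 13]))
     (Plus (Minus (V 15) (V 12)) (Plus (Minus (V 16) (V 13))
       (Plus (Minus (Minus (V 12) (V 15)) (Minus (Minus (V 12) (V 15)) (Minus (V 13) (V 16))))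
         (Minus (Const 1) (Minus (Plus (V 12) (V 13)) (Plus (V 15) (V 16)))))))"

definition hook_loop :: prog where
  "hook_loop = WhileLess (Const 0) (V 10) (Seq pick (scan penHook))"

definition hook_time :: "nat \<Rightarrow> nat" where
  "hook_time k = (2 * Suc k + 1) * (scan_time k + 8) + 1"

abbreviation "hook_heads \<equiv> {10, 11, 12, 13, 14, 15, 16, 31, 32 :: nat}"

context
  fixes k :: nat and E :: "box set" and m :: mem
  assumes k: "m [0] = k" and E: "E \<subseteq> boxes k" and fl: "flags k E m"
begin

lemma penHook_correct:
  assumes "agree hook_heads m m'" "at_box b m'" "r \<in> {1..Suc k}" "c \<in> {1..Suc k}" "m' [12] = r" "m' [13] = c"
  shows "val m' penHook < 1 \<longleftrightarrow> (r, c) \<in> hook E b"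
proof -
  have "m' [30, r, c] = (if (r, c) \<in> E then 1 else 0)"
    using fl assms(3,4) agreeD[OF assms(1), of 30 "[r, c]"] by (simp add: flags_def)
  then show ?thesis using assms(2,5,6) by (auto simp: penHook_def hook_def at_box_def)
qed

lemma finite_hook_domain: "finite E"
  using E finite_subset by (auto simp: boxes_def)

lemma hook_round:
  assumes a: "agree hook_heads m m'" and S: "scanned m' S" "S \<subseteq> E" "S \<noteq> {}"
  shows "implements (Seq pick (scan penHook)) m' (scan_time k + 6) (pmf_of_set S)
    (\<lambda>b m''. at_box b m'' \<and> scanned m'' (hook E b) \<and> agree hook_heads m m'')"
proof -
  have fin: "finite S" using S(2) finite_hook_domain finite_subset by blast
  have "implements (Seq pick (scan penHook)) m' (5 + scan_time k + 1) (map_pmf (\<lambda>b. b) (pmf_of_set S))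
    (\<lambda>b m''. at_box b m'' \<and> scanned m'' (hook E b) \<and> agree hook_heads m m'')"
  proof (rule implements_Seq_det[OF implements_pick[OF S(1) fin S(3)]])
    fix b m1 assume m1: "at_box b m1 \<and> agree {14, 15, 16} m' m1"
    have a1: "agree hook_heads m m1" using agree_mono[OF agree_trans[OF a conjunct2[OF m1]]] by auto
    have *: "agree hook_heads m m2 \<and> at_box b m2" if "agree scan_heads m1 m2" for m2
      using agree_mono[OF agree_trans[OF a1 that], of hook_heads] agreeD[OF that] m1 by (auto simp: at_box_def)
    have "det (scan penHook) m1 (scan_time k)
      (\<lambda>m'. scanned m' (hook E b) \<and> m' [11] = card (hook E b) * m1 [17] \<and> agree scan_heads m1 m')"
    proof (rule det_scan)
      show "m1 [0] = k" using agreeD[OF a1] k by simp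
      show "hook E b \<subseteq> boxes k" using E by (auto simp: hook_def)
    qed (use penHook_correct * in blast)
    then show "implements (scan penHook) m1 (scan_time k) (return_pmf b)
        (\<lambda>b m''. at_box b m'' \<and> scanned m'' (hook E b) \<and> agree hook_heads m m'')"
      by (rule implements_det) (use * in blast)
  qed
  then show ?thesis by (simp add: add.commute)
qed

text \<open>\<open>d\<close> bounds the number of remaining rounds: each move increases the sum of
  the coordinates, which cannot exceed \<open>2 * Suc k\<close> inside the square.\<close>

lemma implements_hook_loop:
  "agree hook_heads m m' \<Longrightarrow> b \<in> E \<Longrightarrow> at_box b m' \<Longrightarrow> scanned m' (hook E b) \<Longrightarrow> 2 * Suc k \<le> fst b + snd b + d \<Longrightarrow>
    implements hook_loop m' (d * (scan_time k + 8) + 1) (hook_walk E b) (\<lambda>b' m''. at_box b' m'' \<and> agree hook_heads m m'')"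
proof (induction d arbitrary: b m')
  case (Suc d)
  show ?case
  proof (cases "hook E b = {}")
    case True
    then have "hook_walk E b = return_pmf b" by (simp add: hook_walk.simps[of E])
    moreover have "implements hook_loop m' 1 (return_pmf b) (\<lambda>b' m''. at_box b' m'' \<and> agree hook_heads m m'')"
      unfolding hook_loop_def using Suc.prems True by (intro implements_WhileLess_done) (auto simp: scanned_def)
    ultimately show ?thesis by (auto intro: implements_le)
  next
    case False
    have fh: "finite (hook E b)" by (rule finite_hook[OF finite_hook_domain])
    have w: "hook_walk E b = bind_pmf (pmf_of_set (hook E b)) (hook_walk E)"
      using False finite_hook_domain by (simp add: hook_walk.simps[of E])
    have "implements hook_loop m' ((scan_time k + 6) + (d * (scan_time k + 8) + 1) + 2)
        (bind_pmf (pmf_of_set (hook E b)) (hook_walk E)) (\<lambda>b' m''. at_box b' m'' \<and> agree hook_heads m m'')"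
      unfolding hook_loop_def
    proof (rule implements_WhileLess_iterate)
      show "val m' (Const 0) < val m' (V 10)"
        using Suc.prems(4) False fh by (simp add: scanned_def card_gt_0_iff)
      show "implements (Seq pick (scan penHook)) m' (scan_time k + 6) (pmf_of_set (hook E b))
          (\<lambda>b m''. at_box b m'' \<and> scanned m'' (hook E b) \<and> agree hook_heads m m'')"
        by (rule hook_round[OF Suc.prems(1,4) _ False]) (auto simp: hook_def)
      fix b' m1 assume b': "b' \<in> set_pmf (pmf_of_set (hook E b))"
        and m1: "at_box b' m1 \<and> scanned m1 (hook E b') \<and> agree hook_heads m m1"
      have "b' \<in> hook E b" using b' fh False by simp
      then have "b' \<in> E" "2 * Suc k \<le> fst b' + snd b' + d" using Suc.prems(5) by (auto simp: hook_def)
      then show "implements (WhileLess (Const 0) (V 10) (Seq pick (scan penHook))) m1 (d * (scan_time k + 8) + 1)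
          (hook_walk E b') (\<lambda>b' m''. at_box b' m'' \<and> agree hook_heads m m'')"
        using m1 by (intro Suc.IH[unfolded hook_loop_def]) auto
    qed
    then show ?thesis unfolding w by (rule implements_le) simp
  qed
next
  case 0
  have "hook E b = {}"
    using 0(5) E by (force simp: hook_def boxes_def)
  then have "hook_walk E b = return_pmf b" by (simp add: hook_walk.simps[of E])
  moreover have "implements hook_loop m' 1 (return_pmf b) (\<lambda>b' m''. at_box b' m'' \<and> agree hook_heads m m'')"
    unfolding hook_loop_def using 0 \<open>hook E b = {}\<close> by (intro implements_WhileLess_done) (auto simp: scanned_def)
  ultimately show ?case by simp
qed

text \<open>The uniform starting box costs no extra code: it is drawn by a round of the same loop in
  which all of \<open>E\<close> is listed in place of a hook.\<close>

lemma implements_Hook: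
  assumes a: "agree hook_heads m m'" and S: "scanned m' E" "E \<noteq> {}"
  shows "implements hook_loop m' (hook_time k) (Hook E) (\<lambda>b m''. at_box b m'' \<and> agree hook_heads m m'')"
proof -
  have "implements hook_loop m' ((scan_time k + 6) + (2 * Suc k * (scan_time k + 8) + 1) + 2)
      (bind_pmf (pmf_of_set E) (hook_walk E)) (\<lambda>b' m''. at_box b' m'' \<and> agree hook_heads m m'')"
    unfolding hook_loop_def
  proof (rule implements_WhileLess_iterate)
    show "val m' (Const 0) < val m' (V 10)"
      using S finite_hook_domain by (simp add: scanned_def card_gt_0_iff)
    show "implements (Seq pick (scan penHook)) m' (scan_time k + 6) (pmf_of_set E)
        (\<lambda>b m''. at_box b m'' \<and> scanned m'' (hook E b) \<and> agree hook_heads m m'')"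
      by (rule hook_round[OF a S(1) _ S(2)]) simp
    fix b' m1 assume b': "b' \<in> set_pmf (pmf_of_set E)"
      and m1: "at_box b' m1 \<and> scanned m1 (hook E b') \<and> agree hook_heads m m1"
    then show "implements (WhileLess (Const 0) (V 10) (Seq pick (scan penHook))) m1 (2 * Suc k * (scan_time k + 8) + 1)
        (hook_walk E b') (\<lambda>b' m''. at_box b' m'' \<and> agree hook_heads m m'')"
      using finite_hook_domain S(2) by (intro implements_hook_loop[unfolded hook_loop_def]) auto
  qed
  moreover have "(scan_time k + 6) + (2 * Suc k * (scan_time k + 8) + 1) + 2 = hook_time k"
    by (simp add: hook_time_def algebra_simps)
  ultimately show ?thesis by (simp add: Hook_def)
qed

end

section \<open>Programs for one proposal and one step of the chain\<close>

definition penAll :: expr where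
  "penAll = Minus (Const 1) (Cell [Const 30, V 12, V 13])"

text \<open>Truncated subtraction of \<open>2 - r\<close> and \<open>2 - c\<close> disables the tests of row 0 and column 0.\<close>

definition penNW :: expr where
  "penNW = Plus (Minus (V 13) (Cell [Const 4, V 12])) (Plus (Cell [Const 30, V 12, V 13])
     (Plus (Minus (Minus (Const 1) (Cell [Const 30, Minus (V 12) (Const 1), V 13])) (Minus (Const 2) (V 12)))
           (Minus (Minus (Const 1) (Cell [Const 30, V 12, Minus (V 13) (Const 1)])) (Minus (Const 2) (V 13)))))"

text \<open>When \<open>N\<close> itself is to be placed, the number drawn is replaced by
  \<open>N\<close>. It then fails the test in \<open>branch\<close> however many boxes are empty, so
  that the hook walk is taken.\<close>

definition draw :: prog where
  "draw = IfLess (V 18) (V 1) (Random [Const 14] (V 18)) (Assign [Const 14] (V 18))"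

definition branch :: prog where
  "branch = IfLess (V 14) (Minus (V 18) (V 10))
     (Seq (scan penNW) (Seq (Assign [Const 17] (V 11)) pick)) hook_loop"

definition record_box :: prog where
  "record_box = Seq (Assign [Const 30, V 15, V 16] (Const 0))
     (Seq (Assign [Const 33, Minus (Const 1) (V 20), V 18] (V 15))
       (Seq (Assign [Const 34, Minus (Const 1) (V 20), V 18] (V 16))
         (Assign [Const 18] (Minus (V 18) (Const 1)))))"

definition step_prog :: prog where
  "step_prog = Seq (scan penAll) (Seq draw (Seq branch record_box))"

definition step_time :: "nat \<Rightarrow> nat" where
  "step_time k = scan_time k + hook_time k + 13"

text \<open>The input reads 0 for the length of a row beyond the last, so the penalty of column
  \<open>c\<close> over the row length also excludes the boxes below the diagram.\<close>

definition init_prog :: prog where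
  "init_prog = grid (Assign [Const 30, V 12, V 13] (Minus (Const 1)
     (Plus (Minus (V 13) (Cell [Const 4, V 12])) (Cell [Const 5, V 12, V 13]))))"

definition gen_prog :: prog where
  "gen_prog = Seq init_prog (Seq (Assign [Const 17] (Const 1)) (Seq (Assign [Const 18] (V 0))
     (WhileLess (Const 0) (V 18) step_prog)))"

definition gen_time :: "nat \<Rightarrow> nat" where
  "gen_time k = grid_time k 1 + k * (step_time k + 2) + 6"

definition iter_prog :: prog where
  "iter_prog = Seq gen_prog (Seq (Random [Const 14] (V 19))
     (IfLess (V 14) (V 17) (Seq (Assign [Const 20] (Minus (Const 1) (V 20))) (Assign [Const 19] (V 17))) Halt))"

definition iter_time :: "nat \<Rightarrow> nat" where
  "iter_time k = gen_time k + 7"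

lemma map_pmf_less_uniform:
  assumes "j \<le> M" "0 < M"
  shows "map_pmf (\<lambda>u. u < j) (pmf_of_set {0..<M}) = bernoulli_pmf (real j / real M)"
proof (rule pmf_eqI)
  fix x :: bool
  have p: "0 \<le> real j / real M" "real j / real M \<le> 1" using assms by auto
  have ne: "{0..<M} \<noteq> {}" using assms by simp
  have "pmf (map_pmf (\<lambda>u. u < j) (pmf_of_set {0..<M})) x =
      real (card ({0..<M} \<inter> (\<lambda>u. u < j) -` {x})) / real M"
    using ne unfolding pmf_map by (subst measure_pmf_of_set) auto
  also have "{0..<M} \<inter> (\<lambda>u. u < j) -` {x} = (if x then {0..<j} else {j..<M})"
    by (cases x; rule set_eqI; use assms(1) in simp; linarith)
  also have "real (card \<dots>) / real M = pmf (bernoulli_pmf (real j / real M)) x"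
    using p assms by (cases x) (simp_all add: of_nat_diff diff_divide_distrib)
  finally show "pmf (map_pmf (\<lambda>u. u < j) (pmf_of_set {0..<M})) x = pmf (bernoulli_pmf (real j / real M)) x" .
qed

text \<open>The machine has no Bernoulli trials. As the parameter has denominator \<open>M\<close>,
  a uniform number below \<open>M\<close> decides exactly.\<close>

lemma choice_alt:
  assumes "card (empty_boxes lam T) \<le> M" "0 < M"
  shows "choice lam N M T = bind_pmf (if M = N then return_pmf M else pmf_of_set {0..<M})
    (\<lambda>u. if u < M - card (empty_boxes lam T) then pmf_of_set (NW (filled lam T)) else Hook (empty_boxes lam T))"
proof -
  let ?j = "M - card (empty_boxes lam T)"
  have "bind_pmf (pmf_of_set {0..<M}) (\<lambda>u. if u < ?j then pmf_of_set (NW (filled lam T)) else Hook (empty_boxes lam T)) =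
      bind_pmf (map_pmf (\<lambda>u. u < ?j) (pmf_of_set {0..<M}))
        (\<lambda>add. if add then pmf_of_set (NW (filled lam T)) else Hook (empty_boxes lam T))"
    by (simp add: bind_map_pmf)
  moreover have "\<not> N < N - card (empty_boxes lam T)" by linarith
  ultimately show ?thesis
    using assms by (auto simp add: choice_def bind_return_pmf map_pmf_less_uniform of_nat_diff)
qed

section \<open>Memory invariants and their preservation\<close>

definition inp :: "nat list \<Rightarrow> nat \<Rightarrow> nat \<Rightarrow> filling \<Rightarrow> nat \<Rightarrow> nat \<Rightarrow> mem \<Rightarrow> bool" where
  "inp lam N k S a b g \<longleftrightarrow> (\<forall>h\<in>{0, 1, 4, 5, 6}. \<forall>as. g (h # as) = input_mem lam N k S a b (h # as))"

text \<open>The loop counters below \<open>C\<close> belong to the loops nested inside and may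
  change; those from \<open>C\<close> on belong to the enclosing loops.\<close>

definition keep :: "nat \<Rightarrow> mem \<Rightarrow> mem \<Rightarrow> bool" where
  "keep C g m \<longleftrightarrow> (\<forall>h as. h \<le> 6 \<or> h = 21 \<longrightarrow> m (h # as) = g (h # as)) \<and> (\<forall>j\<ge>C. m [23, j] = g [23, j])"

definition boxes_in :: "filling \<Rightarrow> nat \<Rightarrow> nat \<Rightarrow> nat \<Rightarrow> mem \<Rightarrow> bool" where
  "boxes_in T M k i m \<longleftrightarrow> (\<forall>v\<in>{M<..k}. v \<in> T (m [33, i, v], m [34, i, v]))"

definition state :: "nat list \<Rightarrow> nat \<Rightarrow> nat \<Rightarrow> mem \<Rightarrow> filling option \<Rightarrow> mem \<Rightarrow> bool" where
  "state lam k C g x m \<longleftrightarrow> keep C g m \<and> (m [20] = 0 \<or> m [20] = 1) \<and>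
     (case x of None \<Rightarrow> m [19] = 1 | Some F \<Rightarrow> m [19] = wt lam F k \<and> boxes_in F 0 k (m [20]) m)"

definition gen_state :: "nat list \<Rightarrow> nat \<Rightarrow> mem \<Rightarrow> filling option \<Rightarrow> nat \<Rightarrow> filling \<Rightarrow> mem \<Rightarrow> bool" where
  "gen_state lam k g x M T m \<longleftrightarrow> state lam k 0 g x m \<and> m [18] = M \<and> flags k (empty_boxes lam T) m \<and>
     m [17] = (\<Prod>j\<in>{M<..k}. fac lam T j) \<and> boxes_in T M k (1 - m [20]) m"

lemma state_agree:
  assumes "state lam k C g x m" "agree H m m'" "H \<inter> ({0..6} \<union> {19, 20, 21, 23, 33, 34}) = {}"
  shows "state lam k C g x m'"
proof -
  have e: "m' (h # as) = m (h # as)" if "h \<le> 6 \<or> h \<in> {19, 20, 21, 23, 33, 34}" for h as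
  proof (rule agreeD[OF assms(2)])
    have "h \<in> {0..6} \<union> {19, 20, 21, 23, 33, 34}" using that by auto
    then show "h \<notin> H" using assms(3) by blast
  qed
  show ?thesis
    using assms(1) by (auto simp: state_def keep_def boxes_in_def e split: option.splits)
qed

text \<open>The factor of \<open>j\<close> depends only on the values from \<open>j\<close> on. So
  the product accumulated in \<open>[17]\<close> stays valid while smaller values are placed, and in
  the end it is the whole weight.\<close>

lemma fac_cong:
  assumes "good lam N M T" "good lam N M' T'" "\<And>b. T b \<inter> {j..} = T' b \<inter> {j..}" "M < j" "M' < j" "j \<le> N"
  shows "fac lam T j = fac lam T' j"
proof -
  have "trunc F j b = (F b \<inter> {j..}) \<inter> {j<..}" for F b by (auto simp: trunc_def)
  then have t: "trunc T j b = trunc T' j b" for b by (simp only: assms(3))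
  have "j \<in> T (box_of T j)" using mem_box_of[OF assms(1,4,6)] .
  then have "j \<in> T (box_of T j) \<inter> {j..}" by simp
  then have "j \<in> T' (box_of T j)" unfolding assms(3) by simp
  then have "box_of T' j = box_of T j" using box_of_eq[OF assms(2)] by blast
  moreover have "trunc T j = trunc T' j" using t by (rule ext)
  ultimately show ?thesis by (simp add: fac_def)
qed

context
  fixes lam :: "nat list" and N k :: nat and S :: filling and ia ib :: nat and g :: mem
  assumes lam: "partition lam" and lam_ne: "lam \<noteq> []" and kN: "k \<le> N"
    and g: "inp lam N k S ia ib g"
begin

lemma state_input: "state lam k C g x m \<Longrightarrow> h \<in> {0, 1, 4, 5, 6} \<Longrightarrow> m (h # as) = input_mem lam N k S ia ib (h # as)"
  using g by (auto simp: state_def keep_def inp_def)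

lemma state_k: "state lam k C g x m \<Longrightarrow> m [0] = k"
  using state_input[of C x m 0 "[]"] by (simp add: input_mem_def)

lemma state_N: "state lam k C g x m \<Longrightarrow> m [1] = N"
  using state_input[of C x m 1 "[]"] by (simp add: input_mem_def)

lemma state_diagram:
  "state lam k C g x m \<Longrightarrow> 1 \<le> r \<Longrightarrow> 1 \<le> c \<Longrightarrow> (r, c) \<in> diagram lam \<longleftrightarrow> c \<le> m [4, r]"
  using state_input[of C x m 4 "[r]"] by (auto simp: input_mem_def diagram_def)

context
  fixes M :: nat and T :: filling and x :: "filling option" and m :: mem
  assumes T: "good lam N (Suc M) T" and M: "Suc M \<le> k" and st: "gen_state lam k g x (Suc M) T m"
begin

lemma gen_stateD: "state lam k 0 g x m" "m [18] = Suc M" "flags k (empty_boxes lam T) m"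
    "m [17] = (\<Prod>j\<in>{Suc M<..k}. fac lam T j)" "boxes_in T (Suc M) k (1 - m [20]) m"
  using st by (auto simp: gen_state_def)

lemma empty_boxes_subset: "empty_boxes lam T \<subseteq> boxes k"
proof
  fix x assume x: "x \<in> empty_boxes lam T"
  note E = young_empty_boxes[OF lam T]
  obtain r c where rc: "x = (r, c)" by force
  show "x \<in> boxes k"
    using young_bound[OF E, of r c] young_pos[OF E, of r c] x rc goodD(8)[OF T] M by (auto simp: boxes_def)
qed

lemma NW_subset_boxes: "NW (filled lam T) \<subseteq> boxes k"
  using NW_subset[OF lam lam_ne T] M unfolding boxes_def by force

lemma flag_agree:
  assumes "agree H m m'" "30 \<notin> H" "1 \<le> r" "r \<le> Suc k" "1 \<le> c" "c \<le> Suc k"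
  shows "m' [30, r, c] = (if (r, c) \<in> empty_boxes lam T then 1 else 0)"
  using gen_stateD(3) agreeD[OF assms(1,2)] assms by (simp add: flags_def)

lemma scan_penAll:
  "det (scan penAll) m (scan_time k) (\<lambda>m'. scanned m' (empty_boxes lam T) \<and> agree scan_heads m m')"
proof -
  have "det (scan penAll) m (scan_time k) (\<lambda>m'. scanned m' (empty_boxes lam T) \<and>
      m' [11] = card (empty_boxes lam T) * m [17] \<and> agree scan_heads m m')"
  proof (rule det_scan)
    show "m [0] = k" "empty_boxes lam T \<subseteq> boxes k" using state_k[OF gen_stateD(1)] empty_boxes_subset by auto
    fix m' r c assume "agree scan_heads m m'" "r \<in> {1..Suc k}" "c \<in> {1..Suc k}" "m' [12] = r" "m' [13] = c"
    then show "val m' penAll < 1 \<longleftrightarrow> (r, c) \<in> empty_boxes lam T"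
      using flag_agree[of scan_heads m' r c] by (simp add: penAll_def)
  qed
  then show ?thesis by (rule implements_conseq) auto
qed

lemma scan_penNW:
  assumes ag: "agree hook_heads m m1"
  shows "det (scan penNW) m1 (scan_time k) (\<lambda>m'. scanned m' (NW (filled lam T)) \<and>
      m' [11] = card (NW (filled lam T)) * m [17] \<and> agree hook_heads m m')"
proof -
  have "det (scan penNW) m1 (scan_time k) (\<lambda>m'. scanned m' (NW (filled lam T)) \<and>
      m' [11] = card (NW (filled lam T)) * m1 [17] \<and> agree scan_heads m1 m')"
  proof (rule det_scan)
    show "NW (filled lam T) \<subseteq> boxes k" by (rule NW_subset_boxes)
    have "state lam k 0 g x m1" by (rule state_agree[OF gen_stateD(1) ag]) auto
    then show "m1 [0] = k" by (rule state_k)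
    fix m' r c assume a1: "agree scan_heads m1 m'" and rc: "r \<in> {1..Suc k}" "c \<in> {1..Suc k}" and m': "m' [12] = r" "m' [13] = c"
    have a2: "agree hook_heads m m'" using agree_mono[OF agree_trans[OF ag a1]] by auto
    have "state lam k 0 g x m'" by (rule state_agree[OF gen_stateD(1) a2]) auto
    then have d: "(r, c) \<in> diagram lam \<longleftrightarrow> c \<le> m' [4, r]" using state_diagram rc by simp
    note f = flag_agree[OF a2, simplified]
    have "m' [30, r, c] = (if (r, c) \<in> empty_boxes lam T then 1 else 0)" using f rc by simp
    moreover have "r \<noteq> 1 \<Longrightarrow> m' [30, r - 1, c] = (if (r - 1, c) \<in> empty_boxes lam T then 1 else 0)"
      using f[of "r - 1" c] rc by fastforce
    moreover have "c \<noteq> 1 \<Longrightarrow> m' [30, r, c - 1] = (if (r, c - 1) \<in> empty_boxes lam T then 1 else 0)"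
      using f[of r "c - 1"] rc by fastforce
    ultimately show "val m' penNW < 1 \<longleftrightarrow> (r, c) \<in> NW (filled lam T)"
      using rc d by (cases "r = 1"; cases "c = 1") (auto simp: NW_iff[OF lam T] penNW_def m')
  qed
  then show ?thesis
    using agree_mono[OF agree_trans[OF ag], of scan_heads _ hook_heads] agreeD[OF ag, of 17 "[]"]
    by (elim implements_conseq) auto
qed

lemma M_le_N: "Suc M \<le> N"
  using M kN by simp

lemma implements_branch:
  assumes ag: "agree hook_heads m m1" and sc: "scanned m1 (empty_boxes lam T)" and u: "m1 [14] = u"
    and u': "u \<in> set_pmf (if Suc M = N then return_pmf (Suc M) else pmf_of_set {0..<Suc M})"
  shows "implements branch m1 (hook_time k + 1)
    (if u < Suc M - card (empty_boxes lam T) then pmf_of_set (NW (filled lam T)) else Hook (empty_boxes lam T))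
    (\<lambda>b m'. at_box b m' \<and> m' [17] = m [17] * (if T b = {} then 1 else card (NW (filled lam T))) \<and>
      agree (insert 17 hook_heads) m m')"
proof -
  let ?E = "empty_boxes lam T" and ?W = "NW (filled lam T)"
  let ?R = "\<lambda>b m'. at_box b m' \<and> m' [17] = m [17] * (if T b = {} then 1 else card ?W) \<and> agree (insert 17 hook_heads) m m'"
  have v: "m1 [18] = Suc M" "m1 [10] = card ?E"
    using agreeD[OF ag, of 18 "[]"] gen_stateD(2) sc by (simp_all add: scanned_def)
  show ?thesis
  proof (cases "u < Suc M - card ?E")
    case True
    then have "u \<noteq> Suc M" by linarith
    then have "Suc M \<noteq> N" using u' by auto
    then have "filled lam T \<noteq> {}" using filled_ne[OF lam lam_ne T] M_le_N by simp
    then have W: "finite ?W" "?W \<noteq> {}" using finite_NW[OF lam lam_ne] NW_ne[OF lam lam_ne] by auto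
    have "implements (Seq (scan penNW) (Seq (Assign [Const 17] (V 11)) pick)) m1 (scan_time k + 7 + 1) (pmf_of_set ?W) ?R"
    proof (rule det_Seq[OF scan_penNW[OF ag]])
      fix m2 assume m2: "scanned m2 ?W \<and> m2 [11] = card ?W * m [17] \<and> agree hook_heads m m2"
      let ?m = "m2([17] := m2 [11])"
      have am: "agree (insert 17 hook_heads) m ?m"
        using m2 by (intro agree_upd) (auto intro: agree_mono)
      have "scanned ?m ?W" using m2 by (simp add: scanned_def)
      from implements_pick[OF this W]
      have "implements pick ?m 5 (pmf_of_set ?W) ?R"
      proof (rule implements_conseq)
        fix b m' assume b: "b \<in> set_pmf (pmf_of_set ?W)" and m': "at_box b m' \<and> agree {14, 15, 16} ?m m'"
        have "b \<in> ?W" using b W by simp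
        then have "T b \<noteq> {}" by (simp add: NW_filled_iff[OF lam]) (simp add: filled_def)
        moreover have "agree (insert 17 hook_heads) m m'"
          using agree_mono[OF agree_trans[OF am conjunct2[OF m']], of "insert 17 hook_heads"] by simp
        moreover have "m' [17] = card ?W * m [17]" using agreeD[OF conjunct2[OF m'], of 17 "[]"] m2 by simp
        ultimately show "?R b m'" using m' by simp
      qed simp
      then show "implements (Seq (Assign [Const 17] (V 11)) pick) m2 7 (pmf_of_set ?W) ?R"
        by (intro implements_Assign_Seq_minus) simp_all
    qed
    then have "implements (Seq (scan penNW) (Seq (Assign [Const 17] (V 11)) pick)) m1 (hook_time k) (pmf_of_set ?W) ?R"
      by (rule implements_le) (simp add: hook_time_def)
    then show ?thesis
      unfolding branch_def using True u v by (intro implements_If) simp_all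
  next
    case False
    \<comment> \<open>The hook walk is never started without an empty box: when \<open>N\<close> is
      placed all boxes of the nonempty diagram are empty, and afterwards every number below
      \<open>Suc M\<close> would pass the test if no box were.\<close>
    have E: "?E \<noteq> {}"
    proof (cases "Suc M = N")
      case True
      then show ?thesis using empty_boxes_top[OF lam lam_ne, of N T] T diagram_ne[OF lam lam_ne] by auto
    next
      case Fa: False
      then have "u < Suc M" using u' by auto
      then show ?thesis using False by auto
    qed
    have "implements hook_loop m1 (hook_time k) (Hook ?E) ?R"
      using implements_Hook[OF state_k[OF gen_stateD(1)] empty_boxes_subset gen_stateD(3) ag sc E]
    proof (rule implements_conseq)
      fix b m' assume b: "b \<in> set_pmf (Hook ?E)" and m': "at_box b m' \<and> agree hook_heads m m'"
      have "T b = {}" using set_pmf_Hook[OF finite_empty_boxes[OF lam lam_ne] E b] by (simp add: corner_def empty_boxes_def)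
      moreover have "agree (insert 17 hook_heads) m m'" by (rule agree_mono[OF conjunct2[OF m']]) auto
      ultimately show "?R b m'" using m' agreeD[OF conjunct2[OF m'], of 17 "[]"] by simp
    qed simp
    then show ?thesis
      unfolding branch_def using False u v by (intro implements_If) simp_all
  qed
qed

lemma gen_state_put:
  assumes b: "adm lam (Suc M) T b" and at: "at_box b m2" and ag: "agree (insert 17 hook_heads) m m2"
    and W: "m2 [17] = m [17] * (if T b = {} then 1 else card (NW (filled lam T)))"
  shows "gen_state lam k g x M (put (Suc M) T b)
    (m2([30, fst b, snd b] := 0, [33, 1 - m2 [20], Suc M] := fst b, [34, 1 - m2 [20], Suc M] := snd b, [18] := M))"
    (is "gen_state lam k g x M ?T ?m")
proof -
  have gT: "good lam N M ?T" by (rule good_put[OF lam T M_le_N b])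
  have st2: "state lam k 0 g x m2" by (rule state_agree[OF gen_stateD(1) ag]) auto
  then have cur: "m2 [20] = 0 \<or> m2 [20] = 1" by (simp add: state_def)
  have cur_m: "m2 [20] = m [20]" using agreeD[OF ag, of 20 "[]"] by simp
  have "state lam k 0 g x ?m"
    using st2 cur by (auto simp: state_def keep_def boxes_in_def split: option.splits)
  moreover have "flags k (empty_boxes lam ?T) ?m"
    unfolding flags_def
  proof (intro ballI)
    fix r c assume rc: "r \<in> {1..Suc k}" "c \<in> {1..Suc k}"
    have "m2 [30, r, c] = (if (r, c) \<in> empty_boxes lam T then 1 else 0)"
      using flag_agree[OF ag, of r c] rc by simp
    then show "?m [30, r, c] = (if (r, c) \<in> empty_boxes lam ?T then 1 else 0)"
      by (cases b) (auto simp: empty_boxes_put)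
  qed
  moreover have "?m [17] = (\<Prod>j\<in>{M<..k}. fac lam ?T j)"
  proof -
    have tr: "trunc ?T (Suc M) = T"
    proof
      fix y show "trunc ?T (Suc M) y = T y"
        using goodD(2)[OF T, of _ y] by (auto simp: trunc_def put_def)
    qed
    have bo: "box_of ?T (Suc M) = b" by (rule box_of_eq[OF gT]) (simp add: put_def)
    have f1: "fac lam ?T (Suc M) = (if T b = {} then 1 else card (NW (filled lam T)))"
      by (simp add: fac_def tr bo)
    have f2: "fac lam ?T j = fac lam T j" if "j \<in> {Suc M<..k}" for j
    proof (rule fac_cong[OF gT T])
      fix y show "?T y \<inter> {j..} = T y \<inter> {j..}" using that by (auto simp: put_def)
    qed (use that kN in auto)
    have "{M<..k} = insert (Suc M) {Suc M<..k}" using M by auto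
    then have "(\<Prod>j\<in>{M<..k}. fac lam ?T j) = fac lam ?T (Suc M) * (\<Prod>j\<in>{Suc M<..k}. fac lam T j)"
      using f2 by simp
    then show ?thesis using W gen_stateD(4) f1 by simp
  qed
  moreover have "boxes_in ?T M k (1 - ?m [20]) ?m"
    unfolding boxes_in_def
  proof
    fix v assume v: "v \<in> {M<..k}"
    show "v \<in> ?T (?m [33, 1 - ?m [20], v], ?m [34, 1 - ?m [20], v])"
    proof (cases "v = Suc M")
      case True
      then show ?thesis by (simp add: put_def)
    next
      case False
      then have "v \<in> T (m [33, 1 - m [20], v], m [34, 1 - m [20], v])" using gen_stateD(5) v by (auto simp: boxes_in_def)
      then have "v \<in> T (m2 [33, 1 - m2 [20], v], m2 [34, 1 - m2 [20], v])"
        using agreeD[OF ag, of 33] agreeD[OF ag, of 34] cur_m by simp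
      then show ?thesis using False by (auto simp: put_def)
    qed
  qed
  ultimately show ?thesis by (simp add: gen_state_def)
qed

lemma implements_step:
  "implements step_prog m (step_time k) (map_pmf (put (Suc M) T) (choice lam N (Suc M) T))
    (\<lambda>T' m'. good lam N M T' \<and> gen_state lam k g x M T' m')"
proof -
  let ?E = "empty_boxes lam T"
  let ?p = "if Suc M = N then return_pmf (Suc M) else pmf_of_set {0..<Suc M}"
  let ?q = "\<lambda>u. if u < Suc M - card ?E then pmf_of_set (NW (filled lam T)) else Hook ?E"
  let ?R = "\<lambda>T' m'. good lam N M T' \<and> gen_state lam k g x M T' m'"
  have ch: "choice lam N (Suc M) T = bind_pmf ?p ?q"
    using choice_alt[OF goodD(8)[OF T]] by simp
  have "implements step_prog m (scan_time k + (2 + (hook_time k + 1 + 7 + 1) + 1) + 1)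
      (bind_pmf ?p (\<lambda>u. map_pmf (put (Suc M) T) (?q u))) ?R"
    unfolding step_prog_def
  proof (rule det_Seq[OF scan_penAll])
    fix m1 assume m1: "scanned m1 ?E \<and> agree scan_heads m m1"
    have v: "m1 [18] = Suc M" "m1 [1] = N"
      using agreeD[OF conjunct2[OF m1], of 18 "[]"] agreeD[OF conjunct2[OF m1], of 1 "[]"] gen_stateD(2) state_N[OF gen_stateD(1)] by simp_all
    show "implements (Seq draw (Seq branch record_box)) m1 (2 + (hook_time k + 1 + 7 + 1) + 1)
        (bind_pmf ?p (\<lambda>u. map_pmf (put (Suc M) T) (?q u))) ?R"
    proof (rule implements_Seq)
      show "implements draw m1 2 ?p (\<lambda>u m2. m2 = m1([14] := u))"
      proof (cases "Suc M = N")
        case True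
        then show ?thesis unfolding draw_def using v
          by (intro implements_If) (auto intro!: implements_Assign_le)
      next
        case False
        have "implements (Random [Const 14] (V 18)) m1 1 (pmf_of_set {0..<val m1 (V 18)}) (\<lambda>u m2. m2 = m1([14] := u))"
          using v by (intro implements_Random) simp_all
        then show ?thesis unfolding draw_def using v False M_le_N
          by (intro implements_If) simp_all
      qed
      fix u m2 assume u: "u \<in> set_pmf ?p" and m2: "m2 = m1([14] := u)"
      have ag: "agree hook_heads m m2" unfolding m2
        by (rule agree_upd[OF agree_mono[OF conjunct2[OF m1]]]) auto
      have sc: "scanned m2 ?E" using m1 by (simp add: m2 scanned_def)
      have u14: "m2 [14] = u" by (simp add: m2)
      show "implements (Seq branch record_box) m2 (hook_time k + 1 + 7 + 1) (map_pmf (put (Suc M) T) (?q u)) ?R"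
      proof (rule implements_Seq_det[OF implements_branch[OF ag sc u14 u]])
        fix b m3
        assume b: "b \<in> set_pmf (?q u)"
          and m3: "at_box b m3 \<and> m3 [17] = m [17] * (if T b = {} then 1 else card (NW (filled lam T))) \<and>
            agree (insert 17 hook_heads) m m3"
        have "b \<in> set_pmf (choice lam N (Suc M) T)" unfolding ch set_bind_pmf using u b by (rule UN_I)
        then have adm: "adm lam (Suc M) T b" by (rule set_choice[OF lam lam_ne T M_le_N])
        have R: "?R (put (Suc M) T b)
          (m3([30, fst b, snd b] := 0, [33, 1 - m3 [20], Suc M] := fst b, [34, 1 - m3 [20], Suc M] := snd b, [18] := M))"
          using gen_state_put[OF adm] m3 good_put[OF lam T M_le_N adm] by blast
        have "m3 [18] = Suc M" using m3 gen_stateD(2) agreeD[of "insert 17 hook_heads" m m3 18 "[]"] by simp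
        then show "implements record_box m3 7 (return_pmf (put (Suc M) T b)) ?R"
          unfolding record_box_def using m3 R
          by (intro implements_Assign_Seq_minus implements_Assign_le) (simp_all add: at_box_def)
      qed
    qed
  qed
  moreover have "bind_pmf ?p (\<lambda>u. map_pmf (put (Suc M) T) (?q u)) = map_pmf (put (Suc M) T) (choice lam N (Suc M) T)"
    unfolding ch by (simp only: map_bind_pmf)
  moreover have "scan_time k + (2 + (hook_time k + 1 + 7 + 1) + 1) + 1 = step_time k"
    by (simp add: step_time_def)
  ultimately show ?thesis by (simp only:)
qed

end
end

section \<open>A program for the chain\<close>

text \<open>\<open>C\<close> nested loops of \<open>k + 1\<close> rounds each run the innermost
  program \<open>(k + 1) ^ C\<close> times without computing this power; \<open>C\<close> is a
  constant of the program.\<close>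

primrec rep :: "nat \<Rightarrow> prog \<Rightarrow> prog" where
  "rep 0 p = p"
| "rep (Suc C) p = Seq (Assign [Const 23, Const C] (Const 0))
     (WhileLess (Cell [Const 23, Const C]) (Plus (V 0) (Const 1))
       (Seq (rep C p) (Assign [Const 23, Const C] (Plus (Cell [Const 23, Const C]) (Const 1)))))"

primrec rep_time :: "nat \<Rightarrow> nat \<Rightarrow> nat" where
  "rep_time k 0 = iter_time k"
| "rep_time k (Suc C) = Suc k * (rep_time k C + 4) + 3"

text \<open>The cells \<open>[6, r, c, v]\<close> still hold \<open>S\<close>, so only the values up
  to \<open>k\<close> have to be entered, in time independent of the size of
  \<open>S\<close>.\<close>

definition out_prog :: prog where
  "out_prog = Seq (Assign [Const 22] (Const 1)) (WhileLess (V 22) (Plus (V 0) (Const 1))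
     (Seq (Assign [Const 6, Cell [Const 33, V 20, V 22], Cell [Const 34, V 20, V 22], V 22] (Const 1))
       (Assign [Const 22] (Plus (V 22) (Const 1)))))"

text \<open>Each doubling of \<open>a\<close> pays for \<open>(k + 1) ^ C\<close> steps of the chain, which halve its distance from
  the uniform distribution.\<close>

definition main_prog :: "nat \<Rightarrow> prog" where
  "main_prog C = Seq (Assign [Const 21] (V 2)) (Seq (Assign [Const 19] (Const 1))
     (Seq (WhileLess (V 21) (V 3) (Seq (Assign [Const 21] (Plus (V 21) (V 21))) (rep C iter_prog))) out_prog))"

definition main_time :: "nat \<Rightarrow> nat \<Rightarrow> nat \<Rightarrow> nat" where
  "main_time k C n = n * (rep_time k C + 4) + 5 * k + 9"

lemma state_counter:
  assumes "keep C g m \<Longrightarrow> keep C' g' (m([23, j] := i))" "state lam k C g x m"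
  shows "state lam k C' g' x (m([23, j] := i))"
  using assms by (auto simp: state_def boxes_in_def split: option.splits)

text \<open>The reference memory \<open>g\<close> is updated along with the counter. Inside the loop
  its current value thus becomes something to be kept, and the induction over the nesting depth goes
  through.\<close>

lemma keep_open: "keep (Suc C) g m \<Longrightarrow> keep C (g([23, C] := i)) (m([23, C] := i))"
  by (auto simp: keep_def)

lemma keep_incr: "keep C (g([23, C] := i)) m \<Longrightarrow> keep C (g([23, C] := j)) (m([23, C] := j))"
  by (auto simp: keep_def)

lemma state_close: "state lam k C (g([23, C] := i)) x m \<Longrightarrow> state lam k (Suc C) g x m"
  by (auto simp: state_def keep_def)

context
  fixes lam :: "nat list" and N k :: nat and S :: filling and ia ib :: nat
  assumes lam: "partition lam" and lam_ne: "lam \<noteq> []" and kN: "k \<le> N" and S: "good lam N k S"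
begin

lemma implements_init:
  assumes g: "inp lam N k S ia ib g" and st: "state lam k C g x m"
  shows "det init_prog m (grid_time k 1) (\<lambda>m'. flags k (empty_boxes lam S) m' \<and> agree {12, 13, 30} m m')"
proof -
  define J where "J P m' \<longleftrightarrow> agree {12, 13, 30} m m' \<and>
    (\<forall>r c. (r, c) \<in> P \<longrightarrow> m' [30, r, c] = (if (r, c) \<in> empty_boxes lam S then 1 else 0))" for P m'
  note inpg = state_input[OF lam lam_ne kN g] and dia = state_diagram[OF lam lam_ne kN g]
  have "det init_prog m (grid_time k 1) (J (boxes k))"
    unfolding init_prog_def
  proof (rule det_grid)
    show "m [0] = k" by (rule state_k[OF lam lam_ne kN g st])
    show "J {} m" by (simp add: J_def)
    fix P :: "box set" and m' m'' assume J: "J P m'" and a: "agree {12, 13} m' m''"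
    have "agree {12, 13, 30} m m''"
      by (rule agree_mono[OF agree_trans[OF _ a, of "{12, 13, 30}"]]) (use J in \<open>auto simp: J_def\<close>)
    then show "J P m''" using J agreeD[OF a, of 30] by (simp add: J_def)
  next
    fix P r c m' assume rc: "r \<in> {1..Suc k}" "c \<in> {1..Suc k}" and J: "J P m'" and m': "m' [12] = r" "m' [13] = c"
    have ag: "agree {12, 13, 30} m m'" using J by (simp add: J_def)
    have st': "state lam k C g x m'" by (rule state_agree[OF st ag]) auto
    have "finite (S (r, c))" using goodD(3)[OF S, of _ "(r, c)"] finite_subset[of "S (r, c)" "{..N}"] by auto
    moreover have "m' [5, r, c] = card (S (r, c))" using inpg[OF st', of 5 "[r, c]"] by (simp add: input_mem_def)
    ultimately have "(r, c) \<in> empty_boxes lam S \<longleftrightarrow> c \<le> m' [4, r] \<and> m' [5, r, c] = 0"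
      using dia[OF st', of r c] rc by (simp add: empty_boxes_def)
    then have "1 - ((c - m' [4, r]) + m' [5, r, c]) = (if (r, c) \<in> empty_boxes lam S then 1 else 0)"
      by auto
    moreover have "agree {12, 13, 30} m (m'([30, r, c] := v))" for v
      by (rule agree_upd[OF ag]) simp
    ultimately show "det (Assign [Const 30, V 12, V 13] (Minus (Const 1)
        (Plus (Minus (V 13) (Cell [Const 4, V 12])) (Cell [Const 5, V 12, V 13])))) m' 1
        (\<lambda>m''. J (insert (r, c) P) m'' \<and> agree (- {0, 12, 13}) m' m'')"
      using J by (intro implements_Assign) (auto simp: J_def m' agree_upd)
  qed
  then show ?thesis by (rule implements_conseq) (auto simp: J_def flags_def boxes_def)
qed

lemma implements_gen:
  assumes g: "inp lam N k S ia ib g" and st: "state lam k 0 g x m"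
  shows "implements gen_prog m (gen_time k) (gen lam N k S)
    (\<lambda>F m'. state lam k 0 g x m' \<and> m' [17] = wt lam F k \<and> boxes_in F 0 k (1 - m' [20]) m')"
proof -
  let ?R = "\<lambda>F m'. state lam k 0 g x m' \<and> m' [17] = wt lam F k \<and> boxes_in F 0 k (1 - m' [20]) m'"
  \<comment> \<open>\<open>i\<close> counts the values already placed, whereas \<open>gen\<close>
    recurses on the values left, hence \<open>k - i\<close>.\<close>
  let ?J = "\<lambda>i T m. good lam N (k - i) T \<and> gen_state lam k g x (k - i) T m"
  have "implements gen_prog m (grid_time k 1 + (k * (step_time k + 2) + 1 + 2 + 2) + 1) (gen lam N k S) ?R"
    unfolding gen_prog_def
  proof (rule det_Seq[OF implements_init[OF g st]])
    fix m1 assume m1: "flags k (empty_boxes lam S) m1 \<and> agree {12, 13, 30} m m1"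
    have st1: "state lam k 0 g x m1" by (rule state_agree[OF st conjunct2[OF m1]]) auto
    let ?m = "m1([17] := 1, [18] := k)"
    have "state lam k 0 g x ?m"
      by (rule state_agree[OF st1, of "{17, 18}"]) (auto intro!: agree_upd)
    then have gen_stateD: "gen_state lam k g x k S ?m"
      using m1 by (simp add: gen_state_def flags_def boxes_in_def)
    have k1: "m1 [0] = k" by (rule state_k[OF lam lam_ne kN g st1])
    have "implements (WhileLess (Const 0) (V 18) step_prog) ?m ((k - 0) * (step_time k + 2) + 1)
        ((\<lambda>i T. gen lam N (k - i) T) 0 S) (?J k)"
    proof (rule implements_for[where J = ?J and n = k and q = "\<lambda>i T. gen lam N (k - i) T"
          and p = "\<lambda>i T. map_pmf (put (k - i) T) (choice lam N (k - i) T)"])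
      fix i T m' assume i: "i < k" and J: "?J i T m'"
      then obtain M where M: "k - i = Suc M" "k - Suc i = M" by (metis Suc_diff_Suc)
      have "m' [18] = Suc M" using J M by (simp add: gen_state_def)
      moreover have "implements step_prog m' (step_time k) (map_pmf (put (Suc M) T) (choice lam N (Suc M) T))
          (\<lambda>T' m'. good lam N M T' \<and> gen_state lam k g x M T' m')"
        by (rule implements_step[OF lam lam_ne kN g]) (use J M in auto)
      ultimately show "val m' (Const 0) < val m' (V 18) \<and>
          implements step_prog m' (step_time k) (map_pmf (put (k - i) T) (choice lam N (k - i) T)) (?J (Suc i))"
        using M by simp
    next
      fix T m' assume "?J k T m'"
      then show "\<not> val m' (Const 0) < val m' (V 18)" by (simp add: gen_state_def)
    next
      fix i T assume "i < k"
      then obtain M where M: "k - i = Suc M" "k - Suc i = M" by (metis Suc_diff_Suc)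
      then show "gen lam N (k - i) T = bind_pmf (map_pmf (put (k - i) T) (choice lam N (k - i) T)) (gen lam N (k - Suc i))"
        by (simp add: bind_map_pmf)
    qed (use S gen_stateD in auto)
    then have "implements (WhileLess (Const 0) (V 18) step_prog) ?m (k * (step_time k + 2) + 1) (gen lam N k S) (?J k)"
      by (simp only: diff_zero)
    then have "implements (WhileLess (Const 0) (V 18) step_prog) ?m (k * (step_time k + 2) + 1) (gen lam N k S) ?R"
    proof (rule implements_conseq)
      fix F m' assume "?J k F m'"
      moreover have "{0<..k} = {1..k}" by auto
      ultimately show "?R F m'" by (simp add: gen_state_def wt_def)
    qed simp_all
    then show "implements (Seq (Assign [Const 17] (Const 1)) (Seq (Assign [Const 18] (V 0)) (WhileLess (Const 0) (V 18) step_prog)))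
        m1 (k * (step_time k + 2) + 1 + 2 + 2) (gen lam N k S) ?R"
      using k1 by (intro implements_Assign_Seq) simp
  qed
  then show ?thesis by (rule implements_le) (simp add: gen_time_def)
qed

lemma implements_iter:
  assumes g: "inp lam N k S ia ib g" and st: "state lam k 0 g x m" and x: "x \<in> insert None (Some ` Om lam N S)"
  shows "implements iter_prog m (iter_time k) (kernel lam N k S x) (\<lambda>y m'. state lam k 0 g y m')"
proof -
  let ?w = "case x of None \<Rightarrow> 1 | Some T \<Rightarrow> wt lam T k"
  have w: "0 < ?w" using x wt_bounds[OF lam lam_ne S kN _ order_refl] by (fastforce split: option.splits)
  have "implements iter_prog m (gen_time k + (1 + 4 + 1) + 1) (kernel lam N k S x) (\<lambda>y m'. state lam k 0 g y m')"
    unfolding iter_prog_def kernel_def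
  proof (rule implements_Seq[OF implements_gen[OF g st]])
    fix F m1 assume m1: "state lam k 0 g x m1 \<and> m1 [17] = wt lam F k \<and> boxes_in F 0 k (1 - m1 [20]) m1"
    have w1: "m1 [19] = ?w" using m1 by (auto simp: state_def split: option.splits)
    show "implements (Seq (Random [Const 14] (V 19))
       (IfLess (V 14) (V 17) (Seq (Assign [Const 20] (Minus (Const 1) (V 20))) (Assign [Const 19] (V 17))) Halt))
       m1 (1 + 4 + 1) (map_pmf (\<lambda>u. if u < wt lam F k then Some F else x) (pmf_of_set {0..<?w}))
       (\<lambda>y m'. state lam k 0 g y m')"
    proof (rule implements_Seq_det)
      have "implements (Random [Const 14] (V 19)) m1 1 (pmf_of_set {0..<val m1 (V 19)}) (\<lambda>u m'. m' = m1([14] := u))"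
        using w w1 by (intro implements_Random) simp_all
      then show "implements (Random [Const 14] (V 19)) m1 1 (pmf_of_set {0..<?w}) (\<lambda>u m'. m' = m1([14] := u))"
        using w1 by simp
      fix u m2 assume m2: "m2 = m1([14] := u)"
      show "implements (IfLess (V 14) (V 17) (Seq (Assign [Const 20] (Minus (Const 1) (V 20))) (Assign [Const 19] (V 17))) Halt)
          m2 4 (return_pmf (if u < wt lam F k then Some F else x)) (\<lambda>y m'. state lam k 0 g y m')"
      proof (rule implements_If)
        assume "val m2 (V 14) < val m2 (V 17)"
        then have u: "u < wt lam F k" using m1 m2 by simp
        have "state lam k 0 g (Some F) (m2([20] := 1 - m2 [20], [19] := m2 [17]))"
          using m1 unfolding m2 by (auto simp: state_def keep_def boxes_in_def)
        then show "implements (Seq (Assign [Const 20] (Minus (Const 1) (V 20))) (Assign [Const 19] (V 17))) m2 (4 - 1)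
            (return_pmf (if u < wt lam F k then Some F else x)) (\<lambda>y m'. state lam k 0 g y m')"
          using u by (intro implements_Assign_Seq_minus implements_Assign_le) simp_all
      next
        assume "\<not> val m2 (V 14) < val m2 (V 17)"
        then have u: "\<not> u < wt lam F k" using m1 m2 by simp
        have "state lam k 0 g x m2"
          by (rule state_agree[of _ _ _ _ _ m1 "{14}"]) (use m1 in \<open>auto simp: m2 intro!: agree_upd\<close>)
        then show "implements Halt m2 (4 - 1)
            (return_pmf (if u < wt lam F k then Some F else x)) (\<lambda>y m'. state lam k 0 g y m')"
          using u by (intro implements_Halt_le) simp
      qed simp
    qed
  qed
  then show ?thesis by (rule implements_le) (simp add: iter_time_def)
qed

lemma set_chain_S:
  "x \<in> insert None (Some ` Om lam N S) \<Longrightarrow> y \<in> set_pmf (chain lam N k S t x) \<Longrightarrow> y \<in> insert None (Some ` Om lam N S)"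
proof (induction t arbitrary: x)
  case (Suc t)
  then obtain z where z: "z \<in> set_pmf (kernel lam N k S x)" "y \<in> set_pmf (chain lam N k S t z)" by auto
  have "z \<in> insert x (Some ` Om lam N S)"
    using z(1) set_gen[OF lam lam_ne S kN] by (auto simp: kernel_def split: if_splits)
  then show ?case using Suc z by blast
qed simp

lemma implements_rep:
  "inp lam N k S ia ib g \<Longrightarrow> state lam k C g x m \<Longrightarrow> x \<in> insert None (Some ` Om lam N S) \<Longrightarrow>
   implements (rep C iter_prog) m (rep_time k C) (chain lam N k S (Suc k ^ C) x) (\<lambda>y m'. state lam k C g y m')"
proof (induction C arbitrary: g x m)
  case 0
  have "chain lam N k S (Suc k ^ 0) x = kernel lam N k S x"
    by (simp add: chain.simps(1)[abs_def] bind_return_pmf')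
  then show ?case using implements_iter[OF 0] by simp
next
  case (Suc C)
  let ?O = "insert None (Some ` Om lam N S)"
  let ?g = "\<lambda>i. g([23, C] := i)"
  let ?J = "\<lambda>i y m'. state lam k C (?g i) y m' \<and> y \<in> ?O"
  let ?X = "Suc k ^ C"
  let ?body = "Seq (rep C iter_prog) (Assign [Const 23, Const C] (Plus (Cell [Const 23, Const C]) (Const 1)))" and ?loop = "WhileLess (Cell [Const 23, Const C]) (Plus (V 0) (Const 1)) (Seq (rep C iter_prog) (Assign [Const 23, Const C] (Plus (Cell [Const 23, Const C]) (Const 1))))"
  have inpg: "inp lam N k S ia ib (?g i)" for i using Suc.prems(1) by (simp add: inp_def)
  have J0: "?J 0 x (m([23, C] := 0))"
    using state_counter[OF keep_open Suc.prems(2)] Suc.prems(3) by blast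
  have "implements ?loop
      (m([23, C] := 0)) ((Suc k - 0) * ((rep_time k C + 2) + 2) + 1)
      ((\<lambda>i. chain lam N k S ((Suc k - i) * ?X)) 0 x) (?J (Suc k))"
  proof (rule implements_for[where J = ?J and n = "Suc k" and q = "\<lambda>i. chain lam N k S ((Suc k - i) * ?X)"
        and p = "\<lambda>_. chain lam N k S ?X"])
    fix i y m' assume i: "i < Suc k" and J: "?J i y m'"
    have "m' [0] = k" by (rule state_k[OF lam lam_ne kN inpg conjunct1[OF J]])
    moreover have "m' [23, C] = i" using J by (auto simp: state_def keep_def)
    moreover have "implements ?body
        m' (rep_time k C + 1 + 1) (map_pmf (\<lambda>y. y) (chain lam N k S ?X y)) (?J (Suc i))"
    proof (rule implements_Seq_det)
      show "implements (rep C iter_prog) m' (rep_time k C) (chain lam N k S ?X y) (\<lambda>y m'. state lam k C (?g i) y m')"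
        using Suc.IH[OF inpg conjunct1[OF J] conjunct2[OF J]] .
      fix z m'' assume z: "z \<in> set_pmf (chain lam N k S ?X y)" and m'': "state lam k C (?g i) z m''"
      have "z \<in> ?O" by (rule set_chain_S[OF conjunct2[OF J] z])
      moreover have "m'' [23, C] = i" using m'' by (auto simp: state_def keep_def)
      moreover have "state lam k C (?g (Suc i)) z (m''([23, C] := Suc i))"
        by (rule state_counter[OF keep_incr m''])
      ultimately show "implements (Assign [Const 23, Const C] (Plus (Cell [Const 23, Const C]) (Const 1))) m'' 1
          (return_pmf z) (?J (Suc i))"
        by (intro implements_Assign) simp
    qed
    ultimately show "val m' (Cell [Const 23, Const C]) < val m' (Plus (V 0) (Const 1)) \<and>
        implements ?body
        m' (rep_time k C + 2) (chain lam N k S ?X y) (?J (Suc i))"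
      using i by simp
  next
    fix y m' assume J: "?J (Suc k) y m'"
    have "m' [0] = k" by (rule state_k[OF lam lam_ne kN inpg conjunct1[OF J]])
    moreover have "m' [23, C] = Suc k" using J by (auto simp: state_def keep_def)
    ultimately show "\<not> val m' (Cell [Const 23, Const C]) < val m' (Plus (V 0) (Const 1))" by simp
  next
    fix i y assume i: "i < Suc k"
    have "(Suc k - i) * ?X = ?X + (Suc k - Suc i) * ?X" using i by (simp add: Suc_diff_le)
    then show "chain lam N k S ((Suc k - i) * ?X) y = bind_pmf (chain lam N k S ?X y) (chain lam N k S ((Suc k - Suc i) * ?X))"
      by (simp only: chain_add)
  next
    fix y show "chain lam N k S ((Suc k - Suc k) * ?X) y = return_pmf y" by simp
  qed (use J0 in auto)
  then have "implements ?loop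
      (m([23, C] := 0)) (Suc k * (rep_time k C + 4) + 1)
      (chain lam N k S (Suc k ^ Suc C) x) (?J (Suc k))"
    by (simp only: diff_zero power_Suc add.assoc) simp
  then have "implements ?loop
      (m([23, C] := 0)) (Suc k * (rep_time k C + 4) + 1)
      (chain lam N k S (Suc k ^ Suc C) x) (\<lambda>y m'. state lam k (Suc C) g y m')"
  proof (rule implements_conseq)
    fix y m' assume "?J (Suc k) y m'"
    then show "state lam k (Suc C) g y m'"
      using state_close by blast
  qed simp_all
  then show ?case by (simp only: rep.simps rep_time.simps) (rule implements_Assign_Seq_minus; simp)
qed

end

lemma implements_outputs:
  assumes "implements c (input_mem lam N k S a b) n p (\<lambda>y m. f y = output_filling m)"
  shows "outputs_within c lam N k S a b n (map_pmf f p)"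
proof -
  obtain D where D: "map_pmf fst D = p" "\<forall>(y, m)\<in>set_pmf D. f y = output_filling m"
    "halts_within c (input_mem lam N k S a b) n (map_pmf snd D)"
    using assms unfolding implements_def by blast
  have "map_pmf f p = map_pmf output_filling (map_pmf snd D)"
    unfolding D(1)[symmetric] pmf.map_comp using D(2) by (intro map_pmf_cong) auto
  then show ?thesis using D(3) unfolding outputs_within_def by blast
qed

section \<open>Writing the result and counting the rounds\<close>

context
  fixes lam :: "nat list" and N k :: nat and S :: filling and a b :: nat
  assumes lam: "partition lam" and lam_ne: "lam \<noteq> []" and kN: "k \<le> N" and S: "good lam N k S"
    and size: "card (diagram lam) \<le> N"
begin

lemma implements_out:
  assumes g: "inp lam N k S a b g" and st: "state lam k C g (Some F) m" and F: "F \<in> Om lam N S"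
  shows "det out_prog m (5 * k + 3) (\<lambda>m'. output_filling m' = F)"
proof -
  let ?box = "\<lambda>v. (m [33, m [20], v], m [34, m [20], v])"
  define J where "J i m' \<longleftrightarrow> agree {6, 22} m m' \<and> m' [22] = Suc i \<and>
    (\<forall>r c v. m' [6, r, c, v] = (if v \<in> S (r, c) \<or> v \<in> {1..i} \<and> (r, c) = ?box v then 1 else 0))" for i m'
  have k: "m [0] = k" by (rule state_k[OF lam lam_ne kN g st])
  have "m [6, r, c, v] = (if v \<in> S (r, c) then 1 else 0)" for r c v
    using state_input[OF lam lam_ne kN g st, of 6 "[r, c, v]"] by (simp add: input_mem_def)
  then have J0: "J 0 (m([22] := 1))" by (simp add: J_def agree_upd)
  have "det (WhileLess (V 22) (Plus (V 0) (Const 1))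
     (Seq (Assign [Const 6, Cell [Const 33, V 20, V 22], Cell [Const 34, V 20, V 22], V 22] (Const 1))
       (Assign [Const 22] (Plus (V 22) (Const 1))))) (m([22] := 1)) (k * (3 + 2) + 1) (J k)"
  proof (rule det_for)
    fix i m' assume i: "i < k" and J: "J i m'"
    note ag = agreeD[OF conjunct1[OF J[unfolded J_def]]]
    have c: "m' [0] = k" "m' [22] = Suc i" "m' [20] = m [20]" "m' [33, m [20], v] = m [33, m [20], v]"
        "m' [34, m [20], v] = m [34, m [20], v]" for v
      using ag[of 0] ag[of 20] ag[of 33] ag[of 34] k J by (simp_all add: J_def)
    let ?m = "m'([6, fst (?box (Suc i)), snd (?box (Suc i)), Suc i] := 1, [22] := Suc (Suc i))"
    have "agree {6, 22} m ?m" using J by (intro agree_upd) (simp_all add: J_def)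
    then have "J (Suc i) ?m" using J by (auto simp: J_def le_Suc_eq)
    then show "val m' (V 22) < val m' (Plus (V 0) (Const 1)) \<and>
      det (Seq (Assign [Const 6, Cell [Const 33, V 20, V 22], Cell [Const 34, V 20, V 22], V 22] (Const 1))
       (Assign [Const 22] (Plus (V 22) (Const 1)))) m' 3 (J (Suc i))"
      using c i by (intro conjI implements_Assign_Seq_minus implements_Assign_le) simp_all
  next
    fix m' assume J: "J k m'"
    have "m' [0] = k" using agreeD[OF conjunct1[OF J[unfolded J_def]], of 0 "[]"] k by simp
    then show "\<not> val m' (V 22) < val m' (Plus (V 0) (Const 1))" using J by (simp add: J_def)
  qed (rule J0)
  then have "det out_prog m (5 * k + 3) (J k)"
    unfolding out_prog_def by (intro implements_Assign_Seq_minus) (simp_all add: mult.commute)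
  then show ?thesis
  proof (rule implements_conseq)
    fix m' assume J: "J k m'"
    have gF: "good lam N 0 F" and SF: "S y \<subseteq> F y" for y using F unfolding Om_def by blast+
    have bx: "v \<in> F (?box v)" if "v \<in> {1..k}" for v
      using st that by (auto simp: state_def boxes_in_def)
    have "v \<in> F (r, c) \<longleftrightarrow> v \<in> S (r, c) \<or> v \<in> {1..k} \<and> (r, c) = ?box v" for r c v
    proof
      assume v: "v \<in> F (r, c)"
      show "v \<in> S (r, c) \<or> v \<in> {1..k} \<and> (r, c) = ?box v"
      proof (cases "k < v")
        case True
        then have "v \<in> trunc F k (r, c)" using v by (simp add: trunc_def)
        then show ?thesis using trunc_eq[OF S F] by simp
      next
        case False
        then have vk: "v \<in> {1..k}" using goodD(2)[OF gF v] by auto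
        then show ?thesis using goodD(5)[OF gF v bx[OF vk]] by blast
      qed
    next
      assume "v \<in> S (r, c) \<or> v \<in> {1..k} \<and> (r, c) = ?box v"
      then show "v \<in> F (r, c)" using SF[of "(r, c)"] bx[of v] by auto
    qed
    then show "output_filling m' = F"
      using J by (intro ext set_eqI) (auto simp: output_filling_def J_def)
  qed simp
qed

text \<open>\<open>n\<close> is the number of doublings that bring \<open>a\<close> up to
  \<open>b\<close>. Its minimality will bound the time by the logarithm of \<open>b / a\<close>; and
  \<open>n\<close> is positive because of \<open>a < b\<close>, which guarantees a step of the chain
  and hence that the state \<open>None\<close> has been left.\<close>

lemma outputs_main:
  assumes ab: "0 < a" "a < b"
  shows "\<exists>n. 1 \<le> n \<and> b \<le> 2 ^ n * a \<and> 2 ^ (n - 1) * a < b \<and>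
    outputs_within (main_prog C) lam N k S a b (main_time k C n) (map_pmf the (chain lam N k S (n * Suc k ^ C) None))"
proof -
  let ?P = "\<lambda>n. b \<le> 2 ^ n * a"
  define n where "n = (LEAST n. ?P n)"
  have "b < 2 ^ b" by simp
  also have "(2::nat) ^ b \<le> 2 ^ b * a" using ab by simp
  finally have ex: "?P b" by simp
  have n: "?P n" unfolding n_def by (rule LeastI[of ?P, OF ex])
  have below: "2 ^ i * a < b" if "i < n" for i
    using not_less_Least[OF that[unfolded n_def]] by simp
  have n1: "1 \<le> n" using n ab by (cases n) auto
  let ?start = "input_mem lam N k S a b"
  let ?O = "insert None (Some ` Om lam N S)"
  let ?g = "\<lambda>i. ?start([21] := 2 ^ i * a)"
  let ?X = "Suc k ^ C"
  let ?J = "\<lambda>i y m'. state lam k C (?g i) y m' \<and> y \<in> ?O"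
  let ?m = "?start([21] := a, [19] := 1)"
  let ?loop = "WhileLess (V 21) (V 3) (Seq (Assign [Const 21] (Plus (V 21) (V 21))) (rep C iter_prog))"
  have inpg: "inp lam N k S a b (?g i)" for i by (auto simp: inp_def)
  have m20: "?start [20] = 0" "?start [2] = a" "?start [3] = b" by (simp_all add: input_mem_def)
  have J0: "?J 0 None ?m" using m20 by (simp add: state_def keep_def)
  have "implements ?loop ?m
      ((n - 0) * ((rep_time k C + 2) + 2) + 1) (chain lam N k S ((n - 0) * ?X) None) (?J n)"
  proof (rule implements_for[where J = ?J and n = n and q = "\<lambda>i. chain lam N k S ((n - i) * ?X)"
        and p = "\<lambda>_. chain lam N k S ?X"])
    fix i y m' assume i: "i < n" and J: "?J i y m'"
    have c: "m' [21] = 2 ^ i * a" "m' [3] = b" using J m20(3) by (simp_all add: state_def keep_def)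
    have "state lam k C (?g (Suc i)) y (m'([21] := 2 ^ Suc i * a))"
      using conjunct1[OF J] by (auto simp: state_def keep_def boxes_in_def split: option.splits)
    from implements_rep[OF lam lam_ne kN S inpg this conjunct2[OF J]]
    have "implements (rep C iter_prog) (m'([21] := 2 ^ Suc i * a)) (rep_time k C) (chain lam N k S ?X y) (?J (Suc i))"
      by (rule implements_conseq) (use set_chain_S[OF lam lam_ne kN S conjunct2[OF J]] in auto)
    then show "val m' (V 21) < val m' (V 3) \<and>
        implements (Seq (Assign [Const 21] (Plus (V 21) (V 21))) (rep C iter_prog)) m' (rep_time k C + 2)
          (chain lam N k S ?X y) (?J (Suc i))"
      using c below[OF i] by (intro conjI implements_Assign_Seq) (simp_all add: mult.assoc mult_2[symmetric])
  next
    fix y m' assume J: "?J n y m'"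
    have "m' [21] = 2 ^ n * a" "m' [3] = b" using J m20(3) by (simp_all add: state_def keep_def)
    then show "\<not> val m' (V 21) < val m' (V 3)" using n by simp
  next
    fix i y assume i: "i < n"
    have "(n - i) * ?X = ?X + (n - Suc i) * ?X" using i by (cases "n - i") (auto simp: Suc_diff_Suc[symmetric])
    then show "chain lam N k S ((n - i) * ?X) y = bind_pmf (chain lam N k S ?X y) (chain lam N k S ((n - Suc i) * ?X))"
      by (simp only: chain_add)
  next
    fix y show "chain lam N k S ((n - n) * ?X) y = return_pmf y" by simp
  qed (use J0 in auto)
  then have loop: "implements ?loop ?m
      (n * (rep_time k C + 4) + 1) (chain lam N k S (n * ?X) None) (\<lambda>y m'. ?J n y m')"
    by (simp only: diff_zero add.assoc) simp
  obtain T where T: "T \<in> Om lam N S" "\<And>t. chain lam N k S (Suc t) None = chain lam N k S (Suc t) (Some T)"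
    using kernel_None[OF lam lam_ne S kN size] by blast
  obtain t where t: "n * ?X = Suc t" using n1 by (cases "n * ?X") auto
  have "implements (Seq ?loop out_prog)
      ?m (n * (rep_time k C + 4) + 1 + (5 * k + 3) + 1) (map_pmf (\<lambda>y. y) (chain lam N k S (n * ?X) None))
      (\<lambda>y m'. the y = output_filling m')"
  proof (rule implements_Seq_det[OF loop])
    fix y m' assume y: "y \<in> set_pmf (chain lam N k S (n * ?X) None)" and J: "?J n y m'"
    have "y \<in> Some ` Om lam N S"
      using y set_chain_Some[OF lam lam_ne S kN size T(1), of "Suc t"] unfolding t T(2) by blast
    then obtain F where F: "y = Some F" "F \<in> Om lam N S" by blast
    have st: "state lam k C (?g n) (Some F) m'" using conjunct1[OF J] unfolding F(1) .
    show "implements out_prog m' (5 * k + 3) (return_pmf y) (\<lambda>y m'. the y = output_filling m')"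
      by (rule implements_det[OF implements_out[OF inpg st F(2)]]) (simp add: F(1))
  qed
  then have "implements (Seq ?loop out_prog)
      ?m (5 + (n * (rep_time k C + 4) + 5 * k)) (chain lam N k S (n * ?X) None) (\<lambda>y m'. the y = output_filling m')"
    by (simp add: add.commute add.left_commute)
  then have "implements (main_prog C) ?start (main_time k C n) (chain lam N k S (n * ?X) None) (\<lambda>y m'. the y = output_filling m')"
    unfolding main_prog_def using m20(2)
    by (intro implements_Assign_Seq_minus) (simp_all add: main_time_def)
  then have "outputs_within (main_prog C) lam N k S a b (main_time k C n) (map_pmf the (chain lam N k S (n * ?X) None))"
    by (rule implements_outputs)
  then show ?thesis using n n1 below[of "n - 1"] by (intro exI[of _ n]) simp
qed

lemma chain_None_output:
  "\<exists>x\<in>Om lam N S. \<forall>t. set_pmf (map_pmf the (chain lam N k S (Suc t) None)) \<subseteq> Om lam N S \<and>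
    (\<forall>y\<in>Om lam N S. pmf (map_pmf the (chain lam N k S (Suc t) None)) y =
      mat_pow (Om lam N S) (MC_SVT lam N k S) (Suc t) x y)"
proof -
  obtain T where T: "T \<in> Om lam N S" "\<And>t. chain lam N k S (Suc t) None = chain lam N k S (Suc t) (Some T)"
    using kernel_None[OF lam lam_ne S kN size] by blast
  have "pmf (map_pmf the (chain lam N k S (Suc t) None)) y = mat_pow (Om lam N S) (MC_SVT lam N k S) (Suc t) T y"
    if y: "y \<in> Om lam N S" for t y
  proof -
    let ?q = "chain lam N k S (Suc t) (Some T)"
    have "map_pmf Some (map_pmf the ?q) = map_pmf (\<lambda>y. y) ?q"
      unfolding pmf.map_comp using set_chain_Some[OF lam lam_ne S kN size T(1), of "Suc t"]
      by (intro map_pmf_cong) auto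
    then have "pmf (map_pmf the ?q) y = pmf ?q (Some y)"
      using pmf_map_inj'[of Some "map_pmf the ?q" y] by simp
    then show ?thesis unfolding T(2) pmf_chain[OF lam lam_ne S kN size T(1) y] .
  qed
  moreover have "set_pmf (map_pmf the (chain lam N k S (Suc t) None)) \<subseteq> Om lam N S" for t
    unfolding T(2) using set_chain_Some[OF lam lam_ne S kN size T(1), of "Suc t"] by auto
  ultimately show ?thesis using T(1) by blast
qed

end

section \<open>Polynomial bounds\<close>

lemma polynomial3_prod:
  fixes p q r :: "real poly"
  shows "polynomial3 (\<lambda>x y z. poly p x * poly q y * poly r z)"
proof -
  define D where "D = max (degree p) (max (degree q) (degree r))"
  have e: "poly f x = (\<Sum>i\<le>D. coeff f i * x ^ i)" if "degree f \<le> D" for f :: "real poly" and x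
    unfolding poly_altdef using that by (intro sum.mono_neutral_left) (auto simp: coeff_eq_0)
  have "poly p x * poly q y * poly r z =
      (\<Sum>i\<le>D. \<Sum>j\<le>D. \<Sum>l\<le>D. (coeff p i * coeff q j * coeff r l) * x ^ i * y ^ j * z ^ l)" for x y z
  proof -
    have "poly p x * poly q y * poly r z =
        (\<Sum>i\<le>D. coeff p i * x ^ i) * (\<Sum>j\<le>D. coeff q j * y ^ j) * (\<Sum>l\<le>D. coeff r l * z ^ l)"
      using e[of p x] e[of q y] e[of r z] by (simp add: D_def)
    then show ?thesis
      by (simp add: sum_product sum_distrib_left sum_distrib_right mult_ac) (rule sum.swap)
  qed
  then show ?thesis
    unfolding polynomial3_def by (intro exI[of _ D] exI[of _ "\<lambda>i j l. coeff p i * coeff q j * coeff r l"]) blast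
qed

text \<open>With \<open>Suc k\<close> in place of \<open>k\<close> all powers are at least 1, so
  exponents may be raised to a common one in sums.\<close>

definition poly_bounded :: "(nat \<Rightarrow> nat) \<Rightarrow> bool" where
  "poly_bounded f \<longleftrightarrow> (\<exists>A D. \<forall>k. f k \<le> A * Suc k ^ D)"

lemma poly_bounded_const: "poly_bounded (\<lambda>_. A)"
  unfolding poly_bounded_def by (rule exI[of _ A], rule exI[of _ 0]) simp

lemma poly_bounded_id: "poly_bounded (\<lambda>k. k)"
  unfolding poly_bounded_def by (rule exI[of _ 1], rule exI[of _ 1]) simp

lemma poly_bounded_add:
  assumes "poly_bounded f" "poly_bounded g"
  shows "poly_bounded (\<lambda>k. f k + g k)"
proof -
  obtain A D B E where AB: "\<And>k. f k \<le> A * Suc k ^ D" "\<And>k. g k \<le> B * Suc k ^ E"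
    using assms unfolding poly_bounded_def by blast
  have "f k + g k \<le> (A + B) * Suc k ^ (D + E)" for k
  proof -
    have "A * Suc k ^ D \<le> A * Suc k ^ (D + E)" "B * Suc k ^ E \<le> B * Suc k ^ (D + E)"
      by (intro mult_le_mono2 power_increasing; simp)+
    then show ?thesis unfolding add_mult_distrib using AB[of k] by linarith
  qed
  then show ?thesis unfolding poly_bounded_def by blast
qed

lemma poly_bounded_mult:
  assumes "poly_bounded f" "poly_bounded g"
  shows "poly_bounded (\<lambda>k. f k * g k)"
proof -
  obtain A D B E where AB: "\<And>k. f k \<le> A * Suc k ^ D" "\<And>k. g k \<le> B * Suc k ^ E"
    using assms unfolding poly_bounded_def by blast
  have "f k * g k \<le> (A * B) * Suc k ^ (D + E)" for k
    using mult_le_mono[OF AB[of k]] by (simp add: power_add mult_ac)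
  then show ?thesis unfolding poly_bounded_def by blast
qed

lemmas poly_bounded_intros = poly_bounded_const poly_bounded_id poly_bounded_add poly_bounded_mult

lemma poly_bounded_Suc: "poly_bounded f \<Longrightarrow> poly_bounded (\<lambda>k. Suc (f k))"
  using poly_bounded_add[of f "\<lambda>_. 1"] poly_bounded_const[of 1] by simp

lemma poly_bounded_rep_time: "poly_bounded (\<lambda>k. rep_time k C)"
proof (induction C)
  case 0
  show ?case
    unfolding rep_time.simps iter_time_def gen_time_def step_time_def hook_time_def scan_time_def grid_time_def
    by (intro poly_bounded_intros poly_bounded_Suc)
next
  case (Suc C)
  then show ?case unfolding rep_time.simps by (intro poly_bounded_intros poly_bounded_Suc)
qed

lemma main_time_bound: "\<exists>A D. \<forall>k n. 1 \<le> n \<longrightarrow> main_time k C n \<le> n * (A * Suc k ^ D)"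
proof -
  have "poly_bounded (\<lambda>k. rep_time k C + 5 * k + 13)"
    by (intro poly_bounded_intros poly_bounded_rep_time)
  then obtain A D where AD: "\<And>k. rep_time k C + 5 * k + 13 \<le> A * Suc k ^ D" unfolding poly_bounded_def by blast
  have "main_time k C n \<le> n * (A * Suc k ^ D)" if "1 \<le> n" for k n
  proof -
    have "5 * k + 9 \<le> n * (5 * k + 9)" using that by simp
    then have "main_time k C n \<le> n * (rep_time k C + 4) + n * (5 * k + 9)" by (simp add: main_time_def)
    also have "\<dots> = n * (rep_time k C + 5 * k + 13)" by (simp add: algebra_simps)
    also have "\<dots> \<le> n * (A * Suc k ^ D)" using AD by (rule mult_le_mono2)
    finally show ?thesis .
  qed
  then show ?thesis by blast
qed

section \<open>From the bounds to the two families\<close>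

lemma SVT_triplesD:
  assumes "(lam, N, S) \<in> SVT_triples" "pretableau lam N k S"
  shows "partition lam" "lam \<noteq> []" "good lam N k S" "k \<le> N" "card (diagram lam) \<le> N"
    "SVT_ext lam N S = Om lam N S"
proof -
  show lam: "partition lam" and "lam \<noteq> []" "card (diagram lam) \<le> N" using assms(1) by (auto simp: SVT_triples_def)
  show "k \<le> N" using assms(2) by (simp add: pretableau_def)
  show g: "good lam N k S" by (rule pretableau_good[OF lam assms(2)])
  show "SVT_ext lam N S = Om lam N S" by (rule SVT_ext_eq_Om[OF lam g])
qed

lemma rapidly_mixing_family:
  assumes sub: "\<F> \<subseteq> SVT_triples"
    and C: "\<And>lam N S k. (lam, N, S) \<in> \<F> \<Longrightarrow> pretableau lam N k S \<Longrightarrow>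
      card (empty_boxes lam S) \<le> C \<or> k - card (empty_boxes lam S) \<le> C"
  shows "rapidly_mixing \<F>"
  unfolding rapidly_mixing_def
proof (intro exI conjI)
  \<comment> \<open>This is \<open>(1 + x) * (1 + z) ^ (2 * C)\<close>. The factor
    \<open>1 + x\<close> absorbs the rounding in \<open>mixing\<close>, since
    \<open>(1 + k) ^ (2 * C)\<close> is at least 1.\<close>
  let ?p = "\<lambda>x y z. poly [:1, 1:] x * poly 1 y * poly ([:1, 1:] ^ (2 * C)) z :: real"
  show "polynomial3 ?p" by (rule polynomial3_prod)
  show "\<forall>(lam, N, S)\<in>\<F>. \<forall>k. pretableau lam N k S \<longrightarrow> (\<forall>\<epsilon>>0.
        (\<exists>t. mix_dist (SVT_ext lam N S) (MC_SVT lam N k S) t \<le> \<epsilon>) \<and>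
        real (t_mix (SVT_ext lam N S) (MC_SVT lam N k S) \<epsilon>)
          \<le> ?p (1 / \<epsilon>) (real (card (empty_boxes lam S))) (real k))"
  proof (clarify)
    fix lam N S k and \<epsilon> :: real
    assume F: "(lam, N, S) \<in> \<F>" and p: "pretableau lam N k S" and e: "0 < \<epsilon>"
    note D = SVT_triplesD[OF subsetD[OF sub F] p]
    note mix = mixing[OF D(1-5) C[OF F p] e]
    have "1 \<le> real (Suc k) ^ (2 * C)" by (rule one_le_power) simp
    then have "real (Suc k) ^ (2 * C) * (1 / \<epsilon>) + 1 \<le> ?p (1 / \<epsilon>) (real (card (empty_boxes lam S))) (real k)"
      by (simp add: algebra_simps)
    then show "(\<exists>t. mix_dist (SVT_ext lam N S) (MC_SVT lam N k S) t \<le> \<epsilon>) \<and>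
        real (t_mix (SVT_ext lam N S) (MC_SVT lam N k S) \<epsilon>)
          \<le> ?p (1 / \<epsilon>) (real (card (empty_boxes lam S))) (real k)"
      using mix(1) order_trans[OF mix(2)] unfolding D(6) by blast
  qed
qed

lemma simulates_chain_main:
  assumes sub: "\<F> \<subseteq> SVT_triples"
  shows "simulates_chain (main_prog C) \<F>"
  unfolding simulates_chain_def Let_def
proof (clarify)
  fix lam N S k and a b :: nat
  assume F: "(lam, N, S) \<in> \<F>" and p: "pretableau lam N k S" and ab: "0 < a" "a < b"
  note D = SVT_triplesD[OF subsetD[OF sub F] p]
  obtain n where n: "1 \<le> n" "outputs_within (main_prog C) lam N k S a b (main_time k C n)
      (map_pmf the (chain lam N k S (n * Suc k ^ C) None))"
    using outputs_main[OF D(1,2,4,3,5) ab] by blast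
  obtain t where t: "n * Suc k ^ C = Suc t" using n(1) by (cases "n * Suc k ^ C") auto
  show "\<exists>n \<Gamma>. outputs_within (main_prog C) lam N k S a b n \<Gamma> \<and>
    (\<exists>x\<in>SVT_ext lam N S. \<exists>t. \<forall>y\<in>SVT_ext lam N S. pmf \<Gamma> y = mat_pow (SVT_ext lam N S) (MC_SVT lam N k S) t x y)"
    using n(2) chain_None_output[OF D(1,2,4,3,5)] unfolding t D(6) by blast
qed

text \<open>With parameter \<open>2 * C\<close> a round has as many steps as the inverse of the
  minorization constant \<open>\<beta>\<close>. It multiplies the distance bound by
  \<open>(1 - \<beta>) ^ (1 / \<beta>)\<close>, which is at most \<open>1 / exp 1\<close> and so
  below \<open>1 / 2\<close>; hence the bound drops at least as fast as the doublings catch up with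
  \<open>b\<close>.\<close>

lemma is_FPAUS_main:
  assumes sub: "\<F> \<subseteq> SVT_triples"
    and C: "\<And>lam N S k. (lam, N, S) \<in> \<F> \<Longrightarrow> pretableau lam N k S \<Longrightarrow>
      card (empty_boxes lam S) \<le> C \<or> k - card (empty_boxes lam S) \<le> C"
  shows "is_FPAUS (main_prog (2 * C)) \<F>"
proof -
  obtain A D where AD: "\<And>k n. 1 \<le> n \<Longrightarrow> main_time k (2 * C) n \<le> n * (A * Suc k ^ D)"
    using main_time_bound[of "2 * C"] by blast
  \<comment> \<open>The last factor is \<open>1 + 2 * ln (1 / \<delta>)\<close>, a bound for
    \<open>n\<close>: minimality gives \<open>2 ^ (n - 1) < 1 / \<delta>\<close>, and
    \<open>ln 2\<close> is at least \<open>1 / 2\<close>.\<close>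
  let ?p = "\<lambda>x y z. poly (smult (real A) ([:1, 1:] ^ D)) x * poly 1 y * poly [:1, 2:] z :: real"
  show ?thesis
    unfolding is_FPAUS_def
  proof (intro exI conjI)
    show "polynomial3 ?p" by (rule polynomial3_prod)
    show "\<forall>(lam, N, S)\<in>\<F>. \<forall>k. pretableau lam N k S \<longrightarrow> (\<forall>a b. 0 < a \<longrightarrow> a < b \<longrightarrow>
        (let \<delta> = real a / real b; \<Omega> = SVT_ext lam N S in
         \<exists>n \<Gamma>. real n \<le> ?p (real k) (real (card (empty_boxes lam S))) (ln (1 / \<delta>)) \<and>
           outputs_within (main_prog (2 * C)) lam N k S a b n \<Gamma> \<and>
           set_pmf \<Gamma> \<subseteq> \<Omega> \<and>
           d_TV \<Omega> (pmf \<Gamma>) (pmf (pmf_of_set \<Omega>)) \<le> \<delta>))"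
    proof (clarify)
      fix lam N S k and a b :: nat
      assume F: "(lam, N, S) \<in> \<F>" and p: "pretableau lam N k S" and ab: "0 < a" "a < b"
      note T = SVT_triplesD[OF subsetD[OF sub F] p]
      let ?\<delta> = "real a / real b" and ?X = "Suc k ^ (2 * C)" and ?Om = "Om lam N S"
      obtain n where n: "1 \<le> n" "b \<le> 2 ^ n * a" "2 ^ (n - 1) * a < b"
        "outputs_within (main_prog (2 * C)) lam N k S a b (main_time k (2 * C) n)
          (map_pmf the (chain lam N k S (n * ?X) None))"
        using outputs_main[OF T(1,2,4,3,5) ab] by blast
      let ?G = "map_pmf the (chain lam N k S (n * ?X) None)"
      obtain t where t: "n * ?X = Suc t" using n(1) by (cases "n * ?X") auto
      obtain x where x: "x \<in> ?Om" "set_pmf ?G \<subseteq> ?Om"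
        "\<And>y. y \<in> ?Om \<Longrightarrow> pmf ?G y = mat_pow ?Om (MC_SVT lam N k S) (n * ?X) x y"
        using chain_None_output[OF T(1,2,4,3,5)] unfolding t by blast
      have pos: "0 < real a" "0 < real b" using ab by auto
      have time: "real (main_time k (2 * C) n) \<le> ?p (real k) (real (card (empty_boxes lam S))) (ln (1 / ?\<delta>))"
      proof -
        have "real (2 ^ (n - 1) * a) < real b" using n(3) by (subst of_nat_less_iff)
        then have "2 ^ (n - 1) < 1 / ?\<delta>" using pos by (simp add: field_simps)
        then have "ln (2 ^ (n - 1)) \<le> ln (1 / ?\<delta>)" using pos by (subst ln_le_cancel_iff) auto
        then have "real (n - 1) * ln 2 \<le> ln (1 / ?\<delta>)" by (simp add: ln_realpow)
        moreover have "1 / 2 \<le> ln (2 :: real)" using ln_le_minus_one[of "1 / 2"] by (simp add: ln_div)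
        then have "real (n - 1) * (1 / 2) \<le> real (n - 1) * ln 2" by (intro mult_left_mono) auto
        ultimately have n': "real n \<le> 1 + 2 * ln (1 / ?\<delta>)" using n(1) by (simp add: of_nat_diff)
        have "real (main_time k (2 * C) n) \<le> real (n * (A * Suc k ^ D))" using AD[OF n(1), of k] by (subst of_nat_le_iff)
        also have "\<dots> = real n * (real A * real (Suc k) ^ D)" by simp
        also have "\<dots> \<le> (1 + 2 * ln (1 / ?\<delta>)) * (real A * real (Suc k) ^ D)"
          using n' by (intro mult_right_mono) auto
        finally show ?thesis by (simp add: mult_ac)
      qed
      have tv: "d_TV ?Om (pmf ?G) (pmf (pmf_of_set ?Om)) \<le> ?\<delta>"
      proof -
        let ?b = "1 / real (Suc k) ^ (2 * C)"
        note fin = finite_Om[OF T(1,2), of N S] and ne = Om_ne[OF T(1-5)]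
        have b: "0 < ?b" by simp
        note chainfacts = fin ne MC_rows[OF T(1-5)] MC_sym[OF T(1-5)] MC_minor[OF T(1-5) C[OF F p]] b
        have "d_TV ?Om (pmf ?G) (pmf (pmf_of_set ?Om)) \<le> (1 - ?b) ^ (n * ?X)"
          by (rule d_TV_mat_pow_uniform[OF chainfacts x(1)]) (use x(3) fin ne in auto)
        also have "\<dots> \<le> exp (- ?b * real (n * ?X))" by (rule one_minus_beta_power[OF chainfacts])
        also have "- ?b * real (n * ?X) = - real n" by simp
        also have "exp (- real n) = 1 / exp 1 ^ n" by (simp add: exp_minus exp_of_nat_mult[symmetric] field_simps)
        also have "\<dots> \<le> 1 / 2 ^ n"
          using exp_ge_add_one_self[of 1] by (intro divide_left_mono power_mono) auto
        also have "\<dots> \<le> ?\<delta>"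
        proof -
          have "real b \<le> real (2 ^ n * a)" using n(2) by (subst of_nat_le_iff)
          then show ?thesis using pos by (simp add: field_simps)
        qed
        finally show ?thesis .
      qed
      show "let \<delta> = ?\<delta>; \<Omega> = SVT_ext lam N S in
         \<exists>n \<Gamma>. real n \<le> ?p (real k) (real (card (empty_boxes lam S))) (ln (1 / \<delta>)) \<and>
           outputs_within (main_prog (2 * C)) lam N k S a b n \<Gamma> \<and>
           set_pmf \<Gamma> \<subseteq> \<Omega> \<and>
           d_TV \<Omega> (pmf \<Gamma>) (pmf (pmf_of_set \<Omega>)) \<le> \<delta>"
        unfolding Let_def T(6) using time n(4) x(2) tv by blast
    qed
  qed
qed

lemma chain_efficient_on_family:
  assumes "\<F> \<subseteq> SVT_triples"
    and "\<And>lam N S k. (lam, N, S) \<in> \<F> \<Longrightarrow> pretableau lam N k S \<Longrightarrow>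
      card (empty_boxes lam S) \<le> C \<or> k - card (empty_boxes lam S) \<le> C"
  shows "rapidly_mixing \<F> \<and> chain_gives_FPAUS \<F>"
proof -
  have "rapidly_mixing \<F>" by (rule rapidly_mixing_family[OF assms(1)]) (erule (1) assms(2))
  moreover have "is_FPAUS (main_prog (2 * C)) \<F>" by (rule is_FPAUS_main[OF assms(1)]) (erule (1) assms(2))
  ultimately show ?thesis
    unfolding chain_gives_FPAUS_def using simulates_chain_main[OF assms(1)] by blast
qed

theorem theorem5p8:
  fixes c :: real
  assumes "0 \<le> c"
  shows "(rapidly_mixing (Fix_empty c) \<and> chain_gives_FPAUS (Fix_empty c)) \<and>
         (rapidly_mixing (Fix_diff c) \<and> chain_gives_FPAUS (Fix_diff c))"
proof -
  define C where "C = nat \<lceil>c\<rceil>"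
  have C: "m \<le> C" if "real m \<le> c" for m using that unfolding C_def by linarith
  have E: "Fix_empty c \<subseteq> SVT_triples" "Fix_diff c \<subseteq> SVT_triples"
    by (auto simp: Fix_empty_def Fix_diff_def)
  have 1: "card (empty_boxes lam S) \<le> C \<or> k - card (empty_boxes lam S) \<le> C"
    if "(lam, N, S) \<in> Fix_empty c" "pretableau lam N k S" for lam N S k
    using that C by (auto simp: Fix_empty_def)
  have 2: "card (empty_boxes lam S) \<le> C \<or> k - card (empty_boxes lam S) \<le> C"
    if F: "(lam, N, S) \<in> Fix_diff c" and p: "pretableau lam N k S" for lam N S k
  proof -
    obtain k' where k': "pretableau lam N k' S" "real k' - real (card (empty_boxes lam S)) \<le> c"
      using F by (auto simp: Fix_diff_def)
    \<comment> \<open>The integer in \<open>Fix_diff\<close> is \<open>k\<close> by uniqueness.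
      Where the truncated difference is 0, the bound is \<open>0 \<le> c\<close>.\<close>
    have "real (k - card (empty_boxes lam S)) \<le> c"
      using k'(2) pretableau_unique[OF p k'(1)] assms by linarith
    then show ?thesis using C by blast
  qed
  have "rapidly_mixing (Fix_empty c) \<and> chain_gives_FPAUS (Fix_empty c)"
    by (rule chain_efficient_on_family[OF E(1)]) (erule (1) 1)
  moreover have "rapidly_mixing (Fix_diff c) \<and> chain_gives_FPAUS (Fix_diff c)"
    by (rule chain_efficient_on_family[OF E(2)]) (erule (1) 2)
  ultimately show ?thesis ..
qed

end
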